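(* Let $b\in\mathbb{N}$ and let $\theta\in\mathbb{R}$ be fixed with $0<\theta\le 1/2$. (i) If $b>1$, then as $T\to\infty$ $$M_{1,b,1}^{\theta}(T)=T\,K_b(\log T)-C_{1,b,1}T^{1-\theta(1/2-1/(2b))}+O\big(T^{1-\theta/2}(\log T)^2\big).$$ (ii) If $b=1$, then $$M_{1,1,1}^{\theta}(T)=\frac{\theta^2}{2}T(\log T)^2+c_1T\log T+c_0T+O\big(T^{1-\theta/2}(\log T)^2\big).$$
   Context: For $\theta>0$ and real $\sigma$, $\tau>0$, let $D_\theta(\sigma+i\tau)=\sum_{1\le n\le (\tau/2\pi)^{\theta}} n^{-\sigma-i\tau}$, and $$M_{1,b,1}^{\theta}(T)=\int_0^T D_\theta(1/2+it)\,\zeta(1/2-ibt)\,\zeta(1/2-it)\,dt.$$ Let $\gamma$ be Euler's constant, $\gamma_1=\frac12\lim_{s\to1}\frac{d^2}{ds^2}\big((s-1)\zeta(s)\big)$, and $\lambda_\theta=2/\theta-1$. For $b>1$ let $E_b=\zeta((b+1)/2)\gamma+b\,\zeta'((b+1)/2)$ and define the linear polynomial $$K_b(x)=\theta\zeta\Big(\frac{b+1}{2}\Big)x+E_b-\theta\zeta\Big(\frac{b+1}{2}\Big)-\theta\zeta\Big(\frac{b+1}{2}\Big)\log 2\pi,$$ and $$C_{1,b,1}=\frac{4b}{\theta(b-1)(\lambda_\theta b+1)}\,\zeta\Big(\frac{1}{2b}+\frac12\Big)(2\pi)^{\theta(1/2-1/(2b))}.$$ Let $F_{0,1}=\frac{4\gamma}{\lambda_\theta+1}-\frac{4}{(\lambda_\theta+1)^2}$,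 $F_{1,1}=\frac{2}{\lambda_\theta+1}$, and $$c_1=\theta(2\gamma-F_{1,1})-\theta^2\log 2\pi,\qquad c_0=\gamma^2+2\gamma_1-F_{0,1}-\theta(2\gamma-F_{1,1})\log 2\pi+\frac{\theta^2}{2}(\log 2\pi)^2.$$ Implied constants depend on $b,\theta$. *)

theory Defs
  imports "HOL-Analysis.Analysis" "HOL-Library.Landau_Symbols"
begin

definition dir_eta :: "complex \<Rightarrow> complex" where
  "dir_eta s = (\<Sum>n. (-1) ^ n / (of_nat (Suc n)) powr s)"

definition rzeta :: "complex \<Rightarrow> complex" where
  "rzeta s = dir_eta s / (1 - 2 powr (1 - s))"

definition stieltjes1 :: complex where
  "stieltjes1 = Lim (at 1) (\<lambda>s. (deriv ^^ 2) (\<lambda>z. (z - 1) * rzeta z) s) / 2"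

definition Dtheta :: "real \<Rightarrow> real \<Rightarrow> real \<Rightarrow> complex" where
  "Dtheta \<theta> \<sigma> \<tau> =
     (\<Sum>n\<in>{n::nat. 1 \<le> n \<and> real n \<le> (\<tau> / (2 * pi)) powr \<theta>}.
        (of_nat n) powr (- (complex_of_real \<sigma> + \<i> * complex_of_real \<tau>)))"

definition M1b1 :: "real \<Rightarrow> nat \<Rightarrow> real \<Rightarrow> complex" where
  "M1b1 \<theta> b T = integral {0..T} (\<lambda>t.
      Dtheta \<theta> (1/2) t
      * rzeta (1/2 - \<i> * of_real (real b * t))
      * rzeta (1/2 - \<i> * of_real t))"

definition lam :: "real \<Rightarrow> real" where
  "lam \<theta> = 2 / \<theta> - 1"

definition Eb :: "nat \<Rightarrow> complex" where
  "Eb b = rzeta (of_real ((real b + 1) / 2)) * of_real euler_mascheroni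
          + of_nat b * deriv rzeta (of_real ((real b + 1) / 2))"

definition Kb :: "real \<Rightarrow> nat \<Rightarrow> real \<Rightarrow> complex" where
  "Kb \<theta> b x = (let z = rzeta (of_real ((real b + 1) / 2)) in
     of_real \<theta> * z * of_real x + Eb b - of_real \<theta> * z - of_real \<theta> * z * of_real (ln (2 * pi)))"

definition C1b1 :: "real \<Rightarrow> nat \<Rightarrow> complex" where
  "C1b1 \<theta> b = of_real (4 * real b / (\<theta> * (real b - 1) * (lam \<theta> * real b + 1)))
     * rzeta (of_real (1 / (2 * real b) + 1 / 2))
     * of_real ((2 * pi) powr (\<theta> * (1/2 - 1 / (2 * real b))))"

definition F01 :: "real \<Rightarrow> real" where
  "F01 \<theta> = 4 * euler_mascheroni / (lam \<theta> + 1) - 4 / (lam \<theta> + 1)^2"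

definition F11 :: "real \<Rightarrow> real" where
  "F11 \<theta> = 2 / (lam \<theta> + 1)"

definition c1 :: "real \<Rightarrow> real" where
  "c1 \<theta> = \<theta> * (2 * euler_mascheroni - F11 \<theta>) - \<theta>^2 * ln (2 * pi)"

definition c0 :: "real \<Rightarrow> complex" where
  "c0 \<theta> = of_real (euler_mascheroni^2) + 2 * stieltjes1 - of_real (F01 \<theta>)
     - of_real (\<theta> * (2 * euler_mascheroni - F11 \<theta>) * ln (2 * pi))
     + of_real (\<theta>^2 / 2 * (ln (2 * pi))^2)"

end

theory Submission
  imports Defs "HOL-Complex_Analysis.Complex_Analysis" "HOL-Real_Asymp.Real_Asymp"
begin

text \<open>
  Exchanging the sum in the Dirichlet polynomial with the integral, the moment becomes a sum over
  $n \le X = (T/2\pi)^\theta$ of integrals of $n^{s-1} \zeta(bs + (1-b)/2) \zeta(s)$ along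
  $s = 1/2 - it$, where $t$ runs from $t_n = 2\pi n^{1/\theta}$ to $T$. Each is moved to the line
  $\Re s = 3/2$. The convexity bound $\zeta(\sigma + it) \ll t^{(1-\sigma)/2} \log t$, which
  follows from van der Corput's second derivative test on dyadic blocks, bounds the horizontal
  segments by $\sqrt{TX} \log^2 T$, and this is admissible exactly because $\theta \le 1/2$.
  On the new line all Dirichlet series converge absolutely; the off-diagonal terms contribute
  $O(X^{3/2} \log X)$, while the diagonal $n = m^b k$ gives the integral over $t$ of the sum of
  $m^{-(b+1)/2} k^{-1}$ over $m^b k \le (t/2\pi)^\theta$. Dirichlet's hyperbola method with both cut-offs equal
  to $x^{1/(b+1)}$ evaluates that sum at $x$ up to $O(x^{-1/2} \log^2 x)$.
\<close>

text \<open>The Dirichlet polynomial carries the phase n^(-it), and the two zeta series carry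
  m^(ibt) and k^(it). These are opposite, so a term is stationary exactly when n = m^b k. The
  segments start at height t_n \<ge> 2 pi, away from the real axis, so moving them crosses no pole.
  The horizontal error is of order T^(1/2 + \<theta>/2) and the off-diagonal error of order T^(3
  \<theta>/2), up to logarithms; both meet T^(1 - \<theta>/2) at the same threshold \<theta> = 1/2.
  The two cases of the theorem reflect the poles of zeta(bw + (b+1)/2) zeta(w+1) x^w / w, which
  generates the divisor sum. For b > 1 there is a double pole at w = 0, giving \<open>Kb\<close>,
  and a simple one at w = -\<beta> with \<beta> = 1/2 - 1/(2b), giving \<open>C1b1\<close>. For b =
  1 they merge into a triple pole, hence the squared logarithm. \<open>rzeta\<close> divides by 1 -
  2^(1-s), which has infinitely many zeros on Re s = 1, where the quotient takes the value 0. The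
  analysis therefore runs on \<open>zeta\<close> and is transferred where the two agree.\<close>

section \<open>Continuation of zeta to the right half-plane\<close>

text \<open>Mean value inequality along the real segment: since Re w \<le> 1, the modulus of the
  derivative is largest at the left end point x.\<close>

lemma powr_diff_bound:
  fixes w :: complex and x y :: real
  assumes "0 < x" "x \<le> y" "Re w \<le> 1"
  shows "norm (of_real y powr w - of_real x powr w) \<le> norm w * (y - x) * x powr (Re w - 1)"
proof -
  have "norm (of_real y powr w - of_real x powr w)
      \<le> (norm w * x powr (Re w - 1)) * norm (complex_of_real y - complex_of_real x)"
  proof (rule field_differentiable_bound[where S = "closed_segment (of_real x) (of_real y)"])
    fix z :: complex assume "z \<in> closed_segment (of_real x) (of_real y)"
    then obtain u where u: "z = of_real u" "x \<le> u"
      using assms by (auto simp: closed_segment_of_real closed_segment_eq_real_ivl)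
    with assms have "u > 0" by linarith
    show "((\<lambda>z. z powr w) has_field_derivative w * z powr (w - 1))
        (at z within closed_segment (of_real x) (of_real y))"
      using u \<open>u > 0\<close> by (intro has_field_derivative_at_within[OF has_field_derivative_powr]) auto
    show "norm (w * z powr (w - 1)) \<le> norm w * x powr (Re w - 1)"
      using u \<open>u > 0\<close> assms by (auto simp: norm_mult norm_powr_real_powr intro!: mult_left_mono powr_mono2')
  qed auto
  also have "norm (complex_of_real y - complex_of_real x) = y - x"
    using assms by (metis norm_of_real of_real_diff abs_of_nonneg diff_ge_0_iff_ge)
  finally show ?thesis by (simp add: mult_ac)
qed

definition zeta_term :: "nat \<Rightarrow> complex \<Rightarrow> complex" where
  "zeta_term n s = (s - 1) * of_nat n powr (-s) + of_nat (Suc n) powr (1 - s) - of_nat n powr (1 - s)"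

text \<open>Over [n, n+1] the term is the increment of a function with derivative (1 - s)(z^(-s) -
  n^(-s)), which vanishes at z = n. Applying \<open>powr_diff_bound\<close> to that difference gains
  a further factor 1/n, which extends convergence from Re s > 1 to Re s > 0.\<close>

lemma norm_zeta_term_le:
  assumes "n \<ge> 1" "Re s > 0"
  shows "norm (zeta_term n s) \<le> norm (s - 1) * norm s * real n powr (- Re s - 1)"
proof -
  define \<phi> where "\<phi> = (\<lambda>z. z powr (1 - s) + (s - 1) * z * of_nat n powr (-s))"
  define a b :: complex where "a = of_real (real n)" and "b = of_real (real (Suc n))"
  have "norm (\<phi> b - \<phi> a) \<le> (norm (s - 1) * norm s * real n powr (- Re s - 1)) * norm (b - a)"
  proof (rule field_differentiable_bound[where S = "closed_segment a b"])
    fix z :: complex assume "z \<in> closed_segment a b"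
    then obtain u where u: "z = of_real u" "real n \<le> u" "u \<le> real (Suc n)"
      unfolding a_def b_def closed_segment_of_real by (auto simp: closed_segment_eq_real_ivl)
    with assms have "u > 0" by linarith
    show "(\<phi> has_field_derivative ((1 - s) * (z powr (- s) - of_nat n powr (-s)))) (at z within closed_segment a b)"
    proof (rule has_field_derivative_at_within)
      have "((\<lambda>z. z powr (1 - s)) has_field_derivative (1 - s) * z powr (1 - s - 1)) (at z)"
        using u \<open>u > 0\<close> by (intro has_field_derivative_powr) auto
      moreover have "((\<lambda>z. (s - 1) * z * of_nat n powr (-s)) has_field_derivative (s - 1) * 1 * of_nat n powr (-s)) (at z)"
        by (auto intro!: derivative_eq_intros)
      ultimately have "(\<phi> has_field_derivative ((1 - s) * z powr (1 - s - 1) + (s - 1) * 1 * of_nat n powr (-s))) (at z)"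
        unfolding \<phi>_def by (rule DERIV_add)
      thus "(\<phi> has_field_derivative ((1 - s) * (z powr (- s) - of_nat n powr (-s)))) (at z)"
        by (simp add: algebra_simps)
    qed
    have "norm (z powr (- s) - of_nat n powr (-s)) \<le> norm (-s) * (u - real n) * real n powr (Re (-s) - 1)"
      using powr_diff_bound[of "real n" u "-s"] u assms by simp
    also have "\<dots> \<le> norm s * 1 * real n powr (- Re s - 1)"
      using u by (intro mult_mono) auto
    finally show "norm ((1 - s) * (z powr (- s) - of_nat n powr (-s))) \<le> norm (s - 1) * norm s * real n powr (- Re s - 1)"
      unfolding norm_mult norm_minus_commute[of 1 s] mult.assoc mult_1_right mult_1_left by (intro mult_left_mono) auto
  qed auto
  moreover have "\<phi> b - \<phi> a = zeta_term n s"
    by (simp add: \<phi>_def zeta_term_def a_def b_def algebra_simps)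
  moreover have "norm (b - a) = 1"
    by (simp add: a_def b_def)
  ultimately show ?thesis by simp
qed

text \<open>By the mean value theorem the difference is \<sigma> z^(-\<sigma> - 1) with z < n + 1
  \<le> 2n; replacing z by 2n costs 2^(\<sigma> + 1). Tails are thereby compared with a telescoping
  series.\<close>

lemma powr_minus_Suc_le_telescope:
  fixes \<sigma> :: real
  assumes "n \<ge> 1" "\<sigma> > 0"
  shows "real n powr (-\<sigma> - 1) \<le> 2 powr (\<sigma> + 1) / \<sigma> * (real n powr (-\<sigma>) - real (Suc n) powr (-\<sigma>))"
proof -
  have "\<exists>z. real n < z \<and> z < real (Suc n) \<and>
      real (Suc n) powr (-\<sigma>) - real n powr (-\<sigma>) = (real (Suc n) - real n) * (-\<sigma> * z powr (-\<sigma> - 1))"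
    using assms by (intro MVT2) (auto intro!: derivative_eq_intros simp: powr_diff)
  then obtain z where z: "real n < z" "z < real (Suc n)"
      "real n powr (-\<sigma>) - real (Suc n) powr (-\<sigma>) = \<sigma> * z powr (-\<sigma> - 1)"
    by auto
  have "real n powr (-\<sigma> - 1) = 2 powr (\<sigma> + 1) * (2 * real n) powr (-\<sigma> - 1)"
  proof -
    have "2 powr (\<sigma> + 1) * 2 powr (-\<sigma> - 1) = (1::real)"
      by (simp flip: powr_add)
    thus ?thesis by (simp add: powr_mult)
  qed
  also have "\<dots> \<le> 2 powr (\<sigma> + 1) * z powr (-\<sigma> - 1)"
    using z assms by (intro mult_left_mono powr_mono2') auto
  also have "\<dots> = 2 powr (\<sigma> + 1) / \<sigma> * (real n powr (-\<sigma>) - real (Suc n) powr (-\<sigma>))"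
    using z assms by simp
  finally show ?thesis .
qed

definition zeta_sum :: "nat \<Rightarrow> complex \<Rightarrow> complex" where
  "zeta_sum N s = (\<Sum>n=1..N. of_nat n powr (-s))"

(* zeta_reg s stands for (s - 1) * zeta s: after multiplication by s - 1 the terms
   n^(-s) - integral of x^(-s) over [n, n+1] have no singularity at s = 1. *)
definition zeta_reg :: "complex \<Rightarrow> complex" where
  "zeta_reg s = 1 + (\<Sum>n. zeta_term (Suc n) s)"

definition zeta :: "complex \<Rightarrow> complex" where
  "zeta s = zeta_reg s / (s - 1)"

text \<open>Divided by s - 1, this is the partial sum plus the integral of x^(-s) over x \<ge> N,
  read as its continuation N^(1-s)/(s - 1).\<close>

definition zeta_approx :: "nat \<Rightarrow> complex \<Rightarrow> complex" where
  "zeta_approx N s = (s - 1) * zeta_sum N s + of_nat N powr (1 - s)"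

lemma sum_zeta_term:
  "1 + (\<Sum>n<N. zeta_term (Suc n) s) = (s - 1) * zeta_sum N s + of_nat (Suc N) powr (1 - s)"
proof (induction N)
  case (Suc N)
  thus ?case by (simp add: zeta_sum_def zeta_term_def algebra_simps del: of_nat_Suc)
qed (simp add: zeta_sum_def)

lemma telescope_powr_sums:
  fixes \<sigma> :: real
  assumes "\<sigma> > 0"
  shows "(\<lambda>n. real (n + Suc N) powr (-\<sigma>) - real (Suc n + Suc N) powr (-\<sigma>)) sums (real (Suc N) powr (-\<sigma>))"
proof -
  have "(\<lambda>n. real (n + Suc N) powr (-\<sigma>)) \<longlonglongrightarrow> 0"
    using assms by real_asymp
  from telescope_sums'[OF this] show ?thesis by simp
qed

lemma zeta_term_tail:
  assumes "Re s > 0"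
  shows "summable (\<lambda>n. zeta_term (n + Suc N) s)"
    and "norm (\<Sum>n. zeta_term (n + Suc N) s)
          \<le> norm (s - 1) * norm s * (2 powr (Re s + 1) / Re s) * real (Suc N) powr (- Re s)"
proof -
  define c where "c = norm (s - 1) * norm s * (2 powr (Re s + 1) / Re s)"
  define h where "h = (\<lambda>n. c * (real (n + Suc N) powr (-Re s) - real (Suc n + Suc N) powr (-Re s)))"
  have h: "h sums (c * real (Suc N) powr (- Re s))"
    unfolding h_def by (intro sums_mult telescope_powr_sums assms)
  have le: "norm (zeta_term (n + Suc N) s) \<le> h n" for n
  proof -
    have "norm (zeta_term (n + Suc N) s) \<le> norm (s - 1) * norm s * real (n + Suc N) powr (- Re s - 1)"
      using assms by (intro norm_zeta_term_le) auto
    also have "\<dots> \<le> norm (s - 1) * norm s * (2 powr (Re s + 1) / Re s * (real (n + Suc N) powr (-Re s) - real (Suc (n + Suc N)) powr (-Re s)))"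
      using assms by (intro mult_left_mono powr_minus_Suc_le_telescope) auto
    also have "\<dots> = h n" by (simp add: h_def c_def mult_ac)
    finally show ?thesis .
  qed
  from le show "summable (\<lambda>n. zeta_term (n + Suc N) s)"
    by (intro summable_comparison_test[OF _ sums_summable[OF h]]) blast
  have "norm (\<Sum>n. zeta_term (n + Suc N) s) \<le> (\<Sum>n. h n)"
    by (rule norm_suminf_le[OF le sums_summable[OF h]])
  also have "\<dots> = c * real (Suc N) powr (- Re s)" using h by (simp add: sums_iff)
  finally show "norm (\<Sum>n. zeta_term (n + Suc N) s)
          \<le> norm (s - 1) * norm s * (2 powr (Re s + 1) / Re s) * real (Suc N) powr (- Re s)"
    by (simp add: c_def)
qed

text \<open>Cutting the series after N - 1 terms leaves \<open>zeta_sum (N - 1)\<close> with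
  boundary term N^(1-s). The missing summand N^(-s) accounts for the \<open>+ 1\<close> next to the
  tail bound.\<close>

lemma zeta_reg_approx:
  assumes "Re s > 0" "N \<ge> 1"
  shows "norm (zeta_reg s - zeta_approx N s)
     \<le> norm (s - 1) * (norm s * (2 powr (Re s + 1) / Re s) + 1) * real N powr (- Re s)"
proof -
  obtain M where M: "N = Suc M" using assms by (cases N) auto
  have "(\<Sum>n. zeta_term (Suc n) s) = (\<Sum>n. zeta_term (Suc (n + M)) s) + (\<Sum>n<M. zeta_term (Suc n) s)"
    using zeta_term_tail(1)[OF assms(1), of 0] by (intro suminf_split_initial_segment) auto
  hence "zeta_reg s - zeta_approx N s = (\<Sum>n. zeta_term (n + Suc M) s)
           + ((s - 1) * zeta_sum M s + of_nat (Suc M) powr (1 - s)) - zeta_approx N s"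
    unfolding zeta_reg_def by (subst sum_zeta_term[symmetric]) (simp add: algebra_simps)
  also have "\<dots> = (\<Sum>n. zeta_term (n + Suc M) s) - (s - 1) * of_nat N powr (-s)"
    by (simp add: zeta_approx_def M zeta_sum_def algebra_simps del: of_nat_Suc)
  finally have "norm (zeta_reg s - zeta_approx N s)
      \<le> norm (\<Sum>n. zeta_term (n + Suc M) s) + norm ((s - 1) * of_nat N powr (-s))"
    by (simp only: norm_triangle_ineq4)
  also have "norm ((s - 1) * of_nat N powr (-s)) = norm (s - 1) * real N powr (- Re s)"
    using assms norm_powr_real_powr[of "of_nat N" "-s"] by (simp add: norm_mult)
  also note zeta_term_tail(2)[OF assms(1), of M]
  finally show ?thesis by (simp add: M algebra_simps del: of_nat_Suc)
qed

lemma zeta_sum_holomorphic [holomorphic_intros]: "zeta_sum N holomorphic_on A"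
proof -
  have "(\<lambda>s. \<Sum>n=1..N. of_nat n powr (-s)) holomorphic_on A"
    by (intro holomorphic_intros) auto
  thus ?thesis by (simp add: zeta_sum_def[abs_def])
qed

lemma zeta_approx_holomorphic: "N \<ge> 1 \<Longrightarrow> zeta_approx N holomorphic_on A"
proof -
  assume "N \<ge> 1"
  hence "(\<lambda>s. (s - 1) * zeta_sum N s + of_nat N powr (1 - s)) holomorphic_on A"
    by (intro holomorphic_intros) auto
  thus ?thesis by (simp add: zeta_approx_def[abs_def])
qed

lemma zeta_reg_holomorphic: "zeta_reg holomorphic_on {s. Re s > 0}"
proof (rule holomorphic_uniform_sequence[where f = "\<lambda>N. zeta_approx (Suc N)"])
  show "open {s. Re s > 0}" by (rule open_halfspace_Re_gt)
  show "zeta_approx (Suc N) holomorphic_on {s. Re s > 0}" for N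
    by (rule zeta_approx_holomorphic) auto
  fix z assume z: "z \<in> {s. Re s > 0}"
  \<comment> \<open>Half the distance to the imaginary axis: on the closed disc Re s \<ge> r, so the
    approximation error is uniformly O(N^(-r)).\<close>
  define r where "r = Re z / 2"
  have r: "r > 0" using z by (simp add: r_def)
  define R where "R = norm z + r"
  have Re: "r \<le> Re s" "Re s \<le> R" "norm s \<le> R" if "s \<in> cball z r" for s
  proof -
    have "\<bar>Re z - Re s\<bar> \<le> r"
      using that abs_Re_le_cmod[of "z - s"] by (simp add: dist_norm)
    thus "r \<le> Re s" unfolding r_def by linarith
    have "norm s \<le> norm z + norm (z - s)"
      by (metis norm_minus_commute norm_triangle_sub add.commute)
    thus "norm s \<le> R" using that by (simp add: R_def dist_norm)
    thus "Re s \<le> R" using complex_Re_le_cmod[of s] by linarith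
  qed
  define C where "C = (R + 1) * (R * (2 powr (R + 1) / r) + 1)"
  have bound: "norm (zeta_approx (Suc N) s - zeta_reg s) \<le> C * real (Suc N) powr (-r)" if s: "s \<in> cball z r" for N s
  proof -
    have R: "R \<ge> 0" using Re[OF s] norm_ge_zero[of s] by linarith
    have "norm (zeta_approx (Suc N) s - zeta_reg s)
       \<le> norm (s - 1) * (norm s * (2 powr (Re s + 1) / Re s) + 1) * real (Suc N) powr (- Re s)"
      using zeta_reg_approx[of s "Suc N"] Re[OF s] r by (simp add: norm_minus_commute)
    also have "\<dots> \<le> C * real (Suc N) powr (-r)"
      unfolding C_def using Re[OF s] r R norm_triangle_ineq4[of s 1]
      by (intro mult_mono add_mono frac_le powr_mono) auto
    finally show ?thesis .
  qed
  have "uniform_limit (cball z r) (\<lambda>N. zeta_approx (Suc N)) zeta_reg sequentially"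
  proof (rule uniform_limitI)
    fix e :: real assume e: "e > 0"
    have "(\<lambda>N. C * real (Suc N) powr (-r)) \<longlonglongrightarrow> 0"
      using r by real_asymp
    hence "\<forall>\<^sub>F N in sequentially. C * real (Suc N) powr (-r) < e"
      using e by (auto dest: order_tendstoD)
    thus "\<forall>\<^sub>F N in sequentially. \<forall>s\<in>cball z r. dist (zeta_approx (Suc N) s) (zeta_reg s) < e"
      by eventually_elim (use bound in \<open>unfold dist_norm, blast intro: le_less_trans\<close>)
  qed
  moreover have "cball z r \<subseteq> {s. Re s > 0}" using Re r by force
  ultimately show "\<exists>d>0. cball z d \<subseteq> {s. Re s > 0} \<and>
      uniform_limit (cball z d) (\<lambda>N. zeta_approx (Suc N)) zeta_reg sequentially"
    using r by blast
qed

lemma zeta_holomorphic: "zeta holomorphic_on {s. Re s > 0} - {1}"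
proof -
  have "(\<lambda>s. zeta_reg s / (s - 1)) holomorphic_on {s. Re s > 0} - {1}"
    by (intro holomorphic_intros holomorphic_on_subset[OF zeta_reg_holomorphic]) auto
  thus ?thesis by (simp add: zeta_def[abs_def])
qed

lemma zeta_reg_limit:
  assumes "Re s > 0"
  shows "(\<lambda>N. zeta_reg s - zeta_approx N s) \<longlonglongrightarrow> 0"
proof (rule Lim_null_comparison)
  show "\<forall>\<^sub>F N in sequentially. norm (zeta_reg s - zeta_approx N s)
     \<le> norm (s - 1) * (norm s * (2 powr (Re s + 1) / Re s) + 1) * real N powr (- Re s)"
    using eventually_ge_at_top[of 1] by eventually_elim (rule zeta_reg_approx[OF assms])
  show "(\<lambda>N. norm (s - 1) * (norm s * (2 powr (Re s + 1) / Re s) + 1) * real N powr (- Re s)) \<longlonglongrightarrow> 0"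
    using assms by real_asymp
qed

section \<open>The alternating series behind \<open>rzeta\<close>\<close>

lemma eta_partial_sum:
  "(\<Sum>n<2*N. (-1) ^ n / (of_nat (Suc n)) powr s) = zeta_sum (2*N) s - 2 powr (1 - s) * zeta_sum N s"
proof (induction N)
  case (Suc N)
  have 1: "(2::complex) powr (1 - s) = 2 * 2 powr (-s)"
    using powr_add[of "2::complex" 1 "-s"] by simp
  have 2: "(2 + 2 * of_nat N :: complex) powr (-s) = 2 powr (-s) * (1 + of_nat N) powr (-s)"
    using powr_times_real[of 2 "1 + of_nat N :: complex" "-s"] by (simp add: algebra_simps)
  have 3: "zeta_sum (2 * Suc N) s = zeta_sum (2*N) s + (1 + 2 * of_nat N) powr (-s) + (2 + 2 * of_nat N) powr (-s)"
    by (simp add: zeta_sum_def)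
  have 4: "zeta_sum (Suc N) s = zeta_sum N s + (1 + of_nat N) powr (-s)"
    by (simp add: zeta_sum_def)
  have "(\<Sum>n<2*Suc N. (-1) ^ n / (of_nat (Suc n)) powr s) =
      (zeta_sum (2*N) s - 2 powr (1 - s) * zeta_sum N s) + (1 + 2 * of_nat N) powr (-s) - (2 + 2 * of_nat N) powr (-s)"
    by (subst Suc[symmetric]) (simp add: powr_minus divide_inverse)
  also have "\<dots> = zeta_sum (2 * Suc N) s - 2 powr (1 - s) * zeta_sum (Suc N) s"
    unfolding 1 2 3 4 by (simp only: ring_distribs) simp
  finally show ?case .
qed (simp add: zeta_sum_def)

lemma tendsto_even_odd:
  fixes f :: "nat \<Rightarrow> 'a :: topological_space"
  assumes "(\<lambda>n. f (2 * n)) \<longlonglongrightarrow> l" and "(\<lambda>n. f (Suc (2 * n))) \<longlonglongrightarrow> l"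
  shows "f \<longlonglongrightarrow> l"
proof (rule topological_tendstoI)
  fix S assume "open S" "l \<in> S"
  with assms obtain a b where ab: "\<And>n. n \<ge> a \<Longrightarrow> f (2 * n) \<in> S" "\<And>n. n \<ge> b \<Longrightarrow> f (Suc (2 * n)) \<in> S"
    by (fastforce simp: lim_explicit)
  show "\<forall>\<^sub>F n in sequentially. f n \<in> S"
    unfolding eventually_sequentially
  proof (intro exI allI impI)
    fix n assume "n \<ge> 2 * a + 2 * b + 1"
    thus "f n \<in> S" using ab by (cases "even n") (auto elim!: evenE oddE)
  qed
qed

text \<open>An alternating sum of length 2N is the full sum minus twice its even part, that is,
  minus 2^(1-s) times the sum of length N. For Re s \<le> 1 these two sums need not converge, but
  their growing parts cancel because (2N)^(1-s) = 2^(1-s) N^(1-s). This settles even cut-offs; odd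
  ones differ by a term tending to 0.\<close>

lemma dir_eta_eq:
  assumes "Re s > 0" "s \<noteq> 1"
  shows "dir_eta s = (1 - 2 powr (1 - s)) * zeta s"
proof -
  define f where "f = (\<lambda>n. (-1) ^ n / (of_nat (Suc n)) powr s)"
  define E where "E = (1 - 2 powr (1 - s)) * zeta s"
  have l1: "(\<lambda>N. zeta s - zeta_sum N s - of_nat N powr (1 - s) / (s - 1)) \<longlonglongrightarrow> 0"
  proof -
    have "(\<lambda>N. (zeta_reg s - zeta_approx N s) / (s - 1)) \<longlonglongrightarrow> 0 / (s - 1)"
      using assms by (intro tendsto_intros zeta_reg_limit) auto
    also have "(\<lambda>N. (zeta_reg s - zeta_approx N s) / (s - 1)) = (\<lambda>N. zeta s - zeta_sum N s - of_nat N powr (1 - s) / (s - 1))"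
      using assms by (simp add: zeta_def zeta_approx_def diff_divide_distrib add_divide_distrib fun_eq_iff)
    finally show ?thesis by simp
  qed
  have l2: "(\<lambda>N. zeta s - zeta_sum (2*N) s - of_nat (2*N) powr (1 - s) / (s - 1)) \<longlonglongrightarrow> 0"
    by (rule filterlim_compose[OF l1]) (auto intro!: mult_nat_left_at_top)
  have "(\<lambda>N. E - (zeta s - zeta_sum (2*N) s - of_nat (2*N) powr (1 - s) / (s - 1))
      + 2 powr (1 - s) * (zeta s - zeta_sum N s - of_nat N powr (1 - s) / (s - 1))) \<longlonglongrightarrow> E - 0 + 2 powr (1 - s) * 0"
    by (intro tendsto_intros l1 l2)
  also have "(\<lambda>N. E - (zeta s - zeta_sum (2*N) s - of_nat (2*N) powr (1 - s) / (s - 1))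
      + 2 powr (1 - s) * (zeta s - zeta_sum N s - of_nat N powr (1 - s) / (s - 1))) = (\<lambda>N. \<Sum>n<2*N. f n)"
  proof
    fix N
    have "(of_nat (2*N) :: complex) powr (1 - s) = 2 powr (1 - s) * of_nat N powr (1 - s)"
      using powr_times_real[of 2 "of_nat N :: complex" "1-s"] by simp
    thus "E - (zeta s - zeta_sum (2*N) s - of_nat (2*N) powr (1 - s) / (s - 1))
      + 2 powr (1 - s) * (zeta s - zeta_sum N s - of_nat N powr (1 - s) / (s - 1)) = (\<Sum>n<2*N. f n)"
      unfolding f_def eta_partial_sum E_def by (simp add: algebra_simps)
  qed
  finally have even_lim: "(\<lambda>N. \<Sum>n<2*N. f n) \<longlonglongrightarrow> E" by simp
  have "f \<longlonglongrightarrow> 0"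
  proof (rule tendsto_norm_zero_cancel)
    have "norm (f n) = real (Suc n) powr (- Re s)" for n
      using norm_powr_real_powr[of "of_nat (Suc n)" s]
      by (simp add: f_def norm_divide norm_power norm_mult norm_inverse powr_minus divide_inverse)
    moreover have "(\<lambda>n. real (Suc n) powr (- Re s)) \<longlonglongrightarrow> 0" using assms by real_asymp
    ultimately show "(\<lambda>n. norm (f n)) \<longlonglongrightarrow> 0" by simp
  qed
  hence "(\<lambda>N. f (2 * N)) \<longlonglongrightarrow> 0"
    by (rule filterlim_compose) (auto intro!: mult_nat_left_at_top)
  from tendsto_add[OF even_lim this] have odd_lim: "(\<lambda>N. \<Sum>n<Suc (2*N). f n) \<longlonglongrightarrow> E" by simp
  have "f sums E"
    unfolding sums_def by (rule tendsto_even_odd) (use even_lim odd_lim in simp_all)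
  thus ?thesis by (simp add: dir_eta_def f_def E_def sums_iff)
qed

lemma rzeta_eq_zeta:
  assumes "Re s > 0" "2 powr (1 - s) \<noteq> 1"
  shows "rzeta s = zeta s"
  using dir_eta_eq[of s] assms by (cases "s = 1") (auto simp: rzeta_def)

text \<open>The modulus of 2^(1-s) is 2^(1 - Re s), so the denominator of \<open>rzeta\<close> can
  vanish only on the line Re s = 1.\<close>

lemma rzeta_eq_zeta':
  assumes "Re s > 0" "Re s \<noteq> 1"
  shows "rzeta s = zeta s"
proof (rule rzeta_eq_zeta)
  have "norm (2 powr (1 - s)) = 2 powr (1 - Re s)"
    using norm_powr_real_powr[of 2 "1 - s"] by simp
  also have "\<dots> \<noteq> 1" using assms by simp
  finally show "2 powr (1 - s) \<noteq> 1" by force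
qed fact

section \<open>Exponential sums\<close>

lemma cot_le_inverse:
  fixes h :: real
  assumes "0 < h" "h < pi"
  shows "cot h \<le> 1 / h"
proof -
  have "sin 0 - 0 * cos 0 \<le> sin h - h * cos h"
  proof (rule DERIV_nonneg_imp_nondecreasing[where f = "\<lambda>x. sin x - x * cos x"])
    fix x :: real assume "0 \<le> x" "x \<le> h"
    thus "\<exists>y. ((\<lambda>x. sin x - x * cos x) has_real_derivative y) (at x) \<and> 0 \<le> y"
      using assms by (intro exI[of _ "x * sin x"]) (auto intro!: derivative_eq_intros mult_nonneg_nonneg sin_ge_zero)
  qed (use assms in auto)
  moreover have "sin h > 0" using assms by (intro sin_gt_zero) auto
  ultimately show ?thesis using assms by (simp add: cot_def field_simps)
qed

lemma abs_cot_le: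
  fixes h \<delta> :: real
  assumes "0 < \<delta>" "\<delta> \<le> h" "h \<le> pi - \<delta>"
  shows "\<bar>cot h\<bar> \<le> 1 / \<delta>"
proof -
  have "cot h \<le> 1 / h" using assms by (intro cot_le_inverse) auto
  also have "\<dots> \<le> 1 / \<delta>" using assms by (simp add: frac_le)
  finally have 1: "cot h \<le> 1 / \<delta>" .
  have "- cot h = cot (pi - h)" by (simp add: cot_def)
  also have "\<dots> \<le> 1 / (pi - h)" using assms by (intro cot_le_inverse) auto
  also have "\<dots> \<le> 1 / \<delta>" using assms by (intro frac_le) auto
  finally show ?thesis using 1 by linarith
qed

lemma cot_antimono:
  fixes a b :: real
  assumes "0 < a" "a \<le> b" "b < pi"
  shows "cot b \<le> cot a"
proof -
  have "sin a > 0" "sin b > 0" "sin (b - a) \<ge> 0"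
    using assms by (auto intro!: sin_gt_zero sin_ge_zero)
  thus ?thesis by (simp add: cot_def sin_diff field_simps)
qed

text \<open>The reciprocal of 1 - cis d in explicit form: its real part is constantly 1/2, so only
  the cotangent varies from term to term.\<close>

lemma one_minus_cis_times:
  assumes "0 < d" "d < 2 * pi"
  shows "(1 - cis d) * (1/2 + \<i>/2 * of_real (cot (d/2))) = 1"
proof -
  define h where "h = d / 2"
  have s: "sin h > 0" using assms by (intro sin_gt_zero) (auto simp: h_def)
  have d: "d = 2 * h" by (simp add: h_def)
  have pyth: "(sin h)\<^sup>2 + (cos h)\<^sup>2 = 1" by simp
  have "1 - cis d = Complex (2 * (sin h)\<^sup>2) (- 2 * sin h * cos h)"
    unfolding d by (simp add: complex_eq_iff cos_double_sin sin_double)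
  moreover have "1/2 + \<i>/2 * of_real (cot h) = Complex (1/2) (cos h / (2 * sin h))"
    by (simp add: complex_eq_iff cot_def)
  ultimately have "(1 - cis d) * (1/2 + \<i>/2 * of_real (cot h))
      = Complex ((sin h)\<^sup>2 + (cos h)\<^sup>2) 0"
    using s by (simp add: complex_eq_iff power2_eq_square)
  thus ?thesis unfolding pyth h_def[symmetric] by (simp add: complex_eq_iff)
qed

lemma kusmin_landau_aux:
  fixes f :: "nat \<Rightarrow> real" and \<delta> :: real
  defines "d \<equiv> (\<lambda>n. f (Suc n) - f n)"
  assumes "0 < \<delta>"
    and range: "\<And>n. M \<le> n \<Longrightarrow> n < N \<Longrightarrow> \<delta> \<le> d n \<and> d n \<le> 2 * pi - \<delta>"
    and decr: "\<And>n. M \<le> n \<Longrightarrow> Suc n < N \<Longrightarrow> d (Suc n) \<le> d n"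
  shows "norm (\<Sum>n=M..<N. cis (f n)) \<le> 8 / \<delta>"
proof (cases "M < N")
  case True
  (* w n = 1 / (1 - cis (d n)); its imaginary part is monotone in n, so its total variation
     is controlled by its end values. *)
  define c where "c = (\<lambda>n. cot (d n / 2))"
  define w where "w = (\<lambda>n. 1/2 + \<i>/2 * complex_of_real (c n))"
  have \<delta>: "\<delta> \<le> pi" using range[of M] True by auto
  have step: "cis (f n) = w n * (cis (f n) - cis (f (Suc n)))" if "M \<le> n" "n < N" for n
  proof -
    have "cis (f (Suc n)) = cis (f n) * cis (d n)" by (simp add: d_def cis_mult)
    hence "w n * (cis (f n) - cis (f (Suc n))) = cis (f n) * ((1 - cis (d n)) * w n)"
      by (simp add: algebra_simps)
    also have "(1 - cis (d n)) * w n = 1"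
      unfolding w_def c_def using range[OF that] \<open>0 < \<delta>\<close> by (intro one_minus_cis_times) auto
    finally show ?thesis by simp
  qed
  \<comment> \<open>Summation by parts with \<open>w\<close>. Keeping the boundary term on the left
    makes each step add exactly the increment of \<open>c\<close>, and since \<open>c\<close> is
    nondecreasing the increments telescope under the norm.\<close>
  have main: "norm ((\<Sum>n=M..<M + Suc k. cis (f n)) + w (M + k) * cis (f (M + Suc k)))
       \<le> norm (w M) + (c (M + k) - c M) / 2" if "M + k < N" for k
    using that
  proof (induction k)
    case 0
    have "cis (f M) + w M * cis (f (Suc M)) = w M * cis (f M)"
      using step[of M] 0 by (simp add: algebra_simps)
    thus ?case by (simp add: norm_mult)
  next
    case (Suc k)
    define T where "T = (\<Sum>n=M..<M + Suc k. cis (f n))"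
    define z where "z = cis (f (M + Suc k))"
    have cle: "c (M + k) \<le> c (M + Suc k)"
      unfolding c_def using range[of "M + k"] range[of "M + Suc k"] decr[of "M + k"] Suc.prems \<open>0 < \<delta>\<close>
      by (intro cot_antimono) auto
    have st: "z + w (M + Suc k) * cis (f (Suc (M + Suc k))) = w (M + Suc k) * z"
      using step[of "M + Suc k"] Suc.prems by (simp add: z_def algebra_simps)
    have "(\<Sum>n=M..<M + Suc (Suc k). cis (f n)) + w (M + Suc k) * cis (f (M + Suc (Suc k)))
       = T + (z + w (M + Suc k) * cis (f (Suc (M + Suc k))))"
      by (simp add: T_def z_def)
    also have "\<dots> = (T + w (M + k) * z) + (w (M + Suc k) - w (M + k)) * z"
      unfolding st by (simp add: algebra_simps)
    also have "norm \<dots> \<le> norm (T + w (M + k) * z) + norm ((w (M + Suc k) - w (M + k)) * z)"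
      by (rule norm_triangle_ineq)
    also have "norm ((w (M + Suc k) - w (M + k)) * z) = (c (M + Suc k) - c (M + k)) / 2"
    proof -
      have "w (M + Suc k) - w (M + k) = \<i> * of_real ((c (M + Suc k) - c (M + k)) / 2)"
        by (simp add: w_def field_simps)
      thus ?thesis using cle by (simp only: norm_mult norm_of_real z_def norm_cis) simp
    qed
    also have "norm (T + w (M + k) * z) \<le> norm (w M) + (c (M + k) - c M) / 2"
      using Suc unfolding T_def z_def by simp
    finally show ?case by (simp add: field_simps)
  qed
  define k where "k = N - M - 1"
  have k: "M + Suc k = N" "M + k < N" using True by (auto simp: k_def)
  have cbd: "\<bar>c n\<bar> \<le> 2 / \<delta>" if "M \<le> n" "n < N" for n
  proof -
    have "\<bar>cot (d n / 2)\<bar> \<le> 1 / (\<delta> / 2)"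
      using range[OF that] \<open>0 < \<delta>\<close> by (intro abs_cot_le) (auto simp: field_simps)
    thus ?thesis by (simp add: c_def)
  qed
  have wbd: "norm (w n) \<le> 1/2 + 1 / \<delta>" if "M \<le> n" "n < N" for n
  proof -
    have "norm (w n) \<le> norm (1/2 :: complex) + norm (\<i>/2 * complex_of_real (c n))"
      unfolding w_def by (rule norm_triangle_ineq)
    also have "\<dots> = 1/2 + \<bar>c n\<bar> / 2" by (simp add: norm_mult)
    finally show ?thesis using cbd[OF that] by simp
  qed
  define E where "E = (\<Sum>n=M..<N. cis (f n)) + w (M + k) * cis (f N)"
  have "(\<Sum>n=M..<N. cis (f n)) = E - w (M + k) * cis (f N)" by (simp add: E_def)
  also have "norm \<dots> \<le> norm E + norm (w (M + k) * cis (f N))" by (rule norm_triangle_ineq4)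
  also have "\<dots> \<le> (norm (w M) + (c (M + k) - c M) / 2) + norm (w (M + k))"
    using main[OF k(2)] unfolding k(1) E_def by (simp add: norm_mult)
  also have "\<dots> \<le> 1 + 4 / \<delta>"
  proof -
    have le: "M \<le> M + k" by simp
    define e where "e = 1 / \<delta>"
    have e: "2 / \<delta> = 2 * e" "4 / \<delta> = 4 * e" by (simp_all add: e_def)
    have "norm (w M) \<le> 1/2 + e" "norm (w (M + k)) \<le> 1/2 + e"
      using wbd[OF order_refl True] wbd[OF le k(2)] by (simp_all add: e_def)
    moreover have "- c M \<le> 2 * e" "c (M + k) \<le> 2 * e"
      using cbd[OF order_refl True] cbd[OF le k(2)] unfolding e by auto
    ultimately show ?thesis unfolding e by argo
  qed
  \<comment> \<open>Since \<delta> \<le> pi < 4, the summand 1 is at most 4/\<delta>.\<close>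
  also have "\<dots> \<le> 8 / \<delta>"
    using \<delta> pi_less_4 \<open>0 < \<delta>\<close> by (simp add: field_simps)
  finally show ?thesis .
qed (use assms in simp)

text \<open>Subtracting 2 pi \<nu> n from the phase moves the differences into the basic window and
  leaves \<open>cis\<close> unchanged at integers n.\<close>

lemma kusmin_landau:
  fixes f :: "nat \<Rightarrow> real" and \<delta> :: real and \<nu> :: int
  defines "d \<equiv> (\<lambda>n. f (Suc n) - f n)"
  assumes "0 < \<delta>"
    and range: "\<And>n. M \<le> n \<Longrightarrow> n < N \<Longrightarrow> 2 * pi * \<nu> + \<delta> \<le> d n \<and> d n \<le> 2 * pi * (\<nu> + 1) - \<delta>"
    and decr: "\<And>n. M \<le> n \<Longrightarrow> Suc n < N \<Longrightarrow> d (Suc n) \<le> d n"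
  shows "norm (\<Sum>n=M..<N. cis (f n)) \<le> 8 / \<delta>"
proof -
  define g where "g = (\<lambda>n. f n - 2 * pi * of_int (\<nu> * int n))"
  have "cis (g n) = cis (f n)" for n
    unfolding g_def by (subst cis_divide[symmetric]) (subst cis_multiple_2pi, auto)
  hence "(\<Sum>n=M..<N. cis (f n)) = (\<Sum>n=M..<N. cis (g n))" by simp
  also have "norm \<dots> \<le> 8 / \<delta>"
  proof (rule kusmin_landau_aux)
    fix n assume "M \<le> n" "n < N"
    from range[OF this] show "\<delta> \<le> g (Suc n) - g n \<and> g (Suc n) - g n \<le> 2 * pi - \<delta>"
      by (simp add: g_def d_def algebra_simps)
  next
    fix n assume "M \<le> n" "Suc n < N"
    from decr[OF this] show "g (Suc (Suc n)) - g (Suc n) \<le> g (Suc n) - g n"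
      by (simp add: g_def d_def algebra_simps)
  qed fact
  finally show ?thesis .
qed

section \<open>Van der Corput's second derivative test and Abel's inequality\<close>

lemma convex_nat_set_eq_ivl:
  fixes B :: "nat set"
  assumes "finite B" "\<And>x y z. x \<in> B \<Longrightarrow> z \<in> B \<Longrightarrow> x \<le> y \<Longrightarrow> y \<le> z \<Longrightarrow> y \<in> B"
  shows "\<exists>p q. B = {p..<q}"
proof (cases "B = {}")
  case False
  have "B = {Min B..<Suc (Max B)}"
    using assms(1) False by (auto simp: less_Suc_eq_le intro: assms(2)[OF Min_in Max_in])
  thus ?thesis by blast
qed (auto intro!: exI[of _ 0])

text \<open>The first factor counts the multiples of 2 pi that the differences can be near to. In
  the second, \<delta> is left to the caller, who balances 2\<delta>/\<mu> against 8/\<delta> by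
  taking \<delta> of order sqrt \<mu>.\<close>

lemma van_der_corput:
  fixes f :: "nat \<Rightarrow> real" and \<delta> \<mu> \<alpha> \<beta> :: real
  defines "d \<equiv> (\<lambda>n. f (Suc n) - f n)"
  assumes pos: "0 < \<delta>" "0 < \<mu>" "\<alpha> \<le> \<beta>"
    and range: "\<And>n. M \<le> n \<Longrightarrow> n < N \<Longrightarrow> \<alpha> \<le> d n \<and> d n \<le> \<beta>"
    and gap: "\<And>n. M \<le> n \<Longrightarrow> Suc n < N \<Longrightarrow> \<mu> \<le> d n - d (Suc n)"
  shows "norm (\<Sum>n=M..<N. cis (f n)) \<le> ((\<beta> - \<alpha>) / (2 * pi) + 2) * (2 * \<delta> / \<mu> + 1 + 8 / \<delta>)"
proof -
  (* On each fibre of \<nu> the few n with d n within \<delta> of 2 * pi * \<nu> n are counted trivially,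
     and kusmin_landau applies to the others. *)
  define \<nu> where "\<nu> = (\<lambda>n. \<lfloor>(d n + \<delta>) / (2 * pi)\<rfloor>)"
  define V where "V = {\<lfloor>(\<alpha> + \<delta>) / (2 * pi)\<rfloor>..\<lfloor>(\<beta> + \<delta>) / (2 * pi)\<rfloor>}"
  define K where "K = 2 * \<delta> / \<mu> + 1 + 8 / \<delta>"
  \<comment> \<open>The difference \<open>d\<close> drops by at least \<mu> per step, so a window of
    length 2\<delta> holds at most 2\<delta>/\<mu> + 1 of its values. The monotonicity that follows
    also makes the rest of a fibre an interval of indices, as Kusmin-Landau requires.\<close>
  have gap': "real (n - m) * \<mu> \<le> d m - d n" if "M \<le> m" "m \<le> n" "n < N" for m n
    using that(2,3,1)
  proof (induction n rule: dec_induct)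
    case (step n)
    thus ?case using gap[of n] by (simp add: Suc_diff_le algebra_simps)
  qed auto
  have mono: "d n \<le> d m" if "M \<le> m" "m \<le> n" "n < N" for m n
  proof -
    have "0 \<le> real (n - m) * \<mu>" using pos by simp
    with gap'[OF that] show ?thesis by linarith
  qed
  have fibre: "norm (\<Sum>n\<in>{n\<in>{M..<N}. \<nu> n = v}. cis (f n)) \<le> K" for v
  proof -
    define S where "S = {n\<in>{M..<N}. \<nu> n = v}"
    define A where "A = {n\<in>S. d n < 2 * pi * v + \<delta>}"
    define B where "B = {n\<in>S. 2 * pi * v + \<delta> \<le> d n}"
    have S: "2 * pi * v - \<delta> \<le> d n" "d n < 2 * pi * (v + 1) - \<delta>" if "n \<in> S" for n
    proof -
      have "of_int v \<le> (d n + \<delta>) / (2 * pi)" "(d n + \<delta>) / (2 * pi) < of_int v + 1"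
        using that by (auto simp: S_def \<nu>_def)
      thus "2 * pi * v - \<delta> \<le> d n" "d n < 2 * pi * (v + 1) - \<delta>"
        by (simp_all add: field_simps)
    qed
    have fin: "finite S" by (simp add: S_def)
    have cA: "real (card A) \<le> 2 * \<delta> / \<mu> + 1"
    proof (cases "A = {}")
      case False
      have fA: "finite A" using fin by (simp add: A_def)
      define p q where "p = Min A" and "q = Max A"
      have pq: "p \<in> A" "q \<in> A" "p \<le> q" using fA False by (auto simp: p_def q_def)
      have "A \<subseteq> {p..q}" using fA False by (auto simp: p_def q_def)
      hence "card A \<le> card {p..q}" by (intro card_mono) auto
      hence c: "real (card A) \<le> real (q - p) + 1" using pq by simp
      have "real (q - p) * \<mu> \<le> d p - d q"
        using pq by (intro gap') (auto simp: A_def S_def)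
      also have "\<dots> \<le> 2 * \<delta>" using pq S[of q] by (auto simp: A_def)
      finally have "real (q - p) \<le> 2 * \<delta> / \<mu>" using pos by (simp add: field_simps)
      with c show ?thesis by linarith
    qed (use pos in simp)
    have "norm (\<Sum>n\<in>A. cis (f n)) \<le> (\<Sum>n\<in>A. 1)" by (intro sum_norm_le) auto
    with cA have nA: "norm (\<Sum>n\<in>A. cis (f n)) \<le> 2 * \<delta> / \<mu> + 1" by simp
    have "\<exists>p q. B = {p..<q}"
    proof (rule convex_nat_set_eq_ivl)
      show "finite B" using fin by (simp add: B_def)
      fix x y z assume xyz: "x \<in> B" "z \<in> B" "x \<le> y" "y \<le> z"
      hence y: "y \<in> {M..<N}" by (auto simp: B_def S_def)
      have le: "d y \<le> d x" "d z \<le> d y" using xyz by (auto simp: B_def S_def intro!: mono)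
      have "2 * pi * v + \<delta> \<le> d y" using le xyz by (auto simp: B_def)
      moreover have "\<nu> y = v"
        unfolding \<nu>_def
      proof (rule floor_unique)
        have "2 * pi * v + \<delta> \<le> d y" "d y < 2 * pi * (v + 1) - \<delta>" using le xyz S[of x] by (auto simp: B_def)
        thus "of_int v \<le> (d y + \<delta>) / (2 * pi)" "(d y + \<delta>) / (2 * pi) < of_int v + 1"
          using pos by (simp_all add: field_simps)
      qed
      ultimately show "y \<in> B" using y by (simp add: B_def S_def)
    qed
    then obtain p q where B: "B = {p..<q}" by blast
    have nB: "norm (\<Sum>n\<in>B. cis (f n)) \<le> 8 / \<delta>"
      unfolding B
    proof (rule kusmin_landau[where \<nu> = v])
      fix n assume "p \<le> n" "n < q"
      hence "n \<in> B" by (simp add: B)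
      with S[of n] show "2 * pi * v + \<delta> \<le> f (Suc n) - f n \<and> f (Suc n) - f n \<le> 2 * pi * (v + 1) - \<delta>"
        by (auto simp: B_def d_def)
    next
      fix n assume "p \<le> n" "Suc n < q"
      hence "n \<in> B" "Suc n \<in> B" by (simp_all add: B)
      thus "f (Suc (Suc n)) - f (Suc n) \<le> f (Suc n) - f n"
        using mono[of n "Suc n"] by (auto simp: B_def S_def d_def)
    qed fact
    have "(\<Sum>n\<in>S. cis (f n)) = (\<Sum>n\<in>A. cis (f n)) + (\<Sum>n\<in>B. cis (f n))"
      by (subst sum.union_disjoint[symmetric]) (auto simp: A_def B_def fin intro!: sum.cong)
    thus ?thesis using nA nB norm_triangle_ineq[of "\<Sum>n\<in>A. cis (f n)" "\<Sum>n\<in>B. cis (f n)"]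
      by (simp add: K_def S_def)
  qed
  have K: "K \<ge> 0" using pos by (simp add: K_def)
  have "(\<Sum>n=M..<N. cis (f n)) = (\<Sum>v\<in>V. \<Sum>n\<in>{n\<in>{M..<N}. \<nu> n = v}. cis (f n))"
  proof (rule sum.group[symmetric])
    show "\<nu> ` {M..<N} \<subseteq> V"
      using range by (auto simp: V_def \<nu>_def intro!: floor_mono divide_right_mono)
  qed (auto simp: V_def)
  also have "norm \<dots> \<le> (\<Sum>v\<in>V. K)" by (intro sum_norm_le fibre)
  also have "\<dots> = real (card V) * K" by simp
  also have "real (card V) \<le> (\<beta> - \<alpha>) / (2 * pi) + 2"
  proof -
    have "\<lfloor>(\<alpha> + \<delta>) / (2 * pi)\<rfloor> \<le> \<lfloor>(\<beta> + \<delta>) / (2 * pi)\<rfloor>"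
      using pos by (intro floor_mono divide_right_mono) auto
    hence "real (card V) = of_int \<lfloor>(\<beta> + \<delta>) / (2 * pi)\<rfloor> - of_int \<lfloor>(\<alpha> + \<delta>) / (2 * pi)\<rfloor> + 1"
      by (simp add: V_def)
    also have "\<dots> \<le> (\<beta> + \<delta>) / (2 * pi) - ((\<alpha> + \<delta>) / (2 * pi) - 1) + 1"
      by linarith
    finally show ?thesis by (simp add: diff_divide_distrib add_divide_distrib)
  qed
  finally show ?thesis using K by (simp add: K_def mult_right_mono)
qed

text \<open>Summation by parts: the decrements of the weights are nonnegative and, together with the
  last weight, add up to the first one.\<close>

lemma norm_weighted_sum_le:
  fixes w :: "nat \<Rightarrow> real" and z :: "nat \<Rightarrow> 'a :: real_normed_vector"
  assumes "\<And>n. M \<le> n \<Longrightarrow> n \<le> N \<Longrightarrow> norm (\<Sum>k=M..<n. z k) \<le> B"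
    and "\<And>n. M \<le> n \<Longrightarrow> Suc n < N \<Longrightarrow> w (Suc n) \<le> w n" and "\<And>n. M \<le> n \<Longrightarrow> n < N \<Longrightarrow> 0 \<le> w n" "M < N"
  shows "norm (\<Sum>k=M..<N. w k *\<^sub>R z k) \<le> w M * B"
proof -
  define S where "S = (\<lambda>n. \<Sum>k=M..<n. z k)"
  have "norm ((\<Sum>k=M..<M + Suc j. w k *\<^sub>R z k) - w (M + j) *\<^sub>R S (M + Suc j)) \<le> (w M - w (M + j)) * B"
    if "M + j < N" for j using that
  proof (induction j)
    case (Suc j)
    let ?n = "M + Suc j"
    define D where "D = (\<Sum>k=M..<M + Suc j. w k *\<^sub>R z k) - w (M + j) *\<^sub>R S (M + Suc j)"
    have "(\<Sum>k=M..<M + Suc (Suc j). w k *\<^sub>R z k) - w ?n *\<^sub>R S (Suc ?n) = D + (w (M + j) - w ?n) *\<^sub>R S ?n"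
      by (simp add: D_def S_def algebra_simps)
    also have "norm \<dots> \<le> norm D + norm ((w (M + j) - w ?n) *\<^sub>R S ?n)" by (rule norm_triangle_ineq)
    also have "\<dots> \<le> (w M - w (M + j)) * B + (w (M + j) - w ?n) * B"
      using Suc assms(1)[of ?n] assms(2)[of "M + j"] unfolding D_def S_def
      by (intro add_mono) (auto intro!: mult_left_mono)
    finally show ?case by (simp add: algebra_simps)
  qed (simp add: S_def)
  from this[of "N - M - 1"] \<open>M < N\<close>
  have 1: "norm ((\<Sum>k=M..<N. w k *\<^sub>R z k) - w (N - 1) *\<^sub>R S N) \<le> (w M - w (N - 1)) * B" by simp
  have 2: "norm (w (N - 1) *\<^sub>R S N) \<le> w (N - 1) * B"
    using assms(1)[of N] assms(3)[of "N - 1"] \<open>M < N\<close> by (auto simp: S_def intro!: mult_left_mono)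
  show ?thesis
    using norm_triangle_sub[of "\<Sum>k=M..<N. w k *\<^sub>R z k" "w (N - 1) *\<^sub>R S N"] 1 2 by (simp add: algebra_simps)
qed

section \<open>The convexity bound for zeta\<close>

text \<open>The convexity exponent of zeta to the right of Re s = 1/2: it is 1/4 at 1/2, falls
  linearly to 0 at 1 and stays there.\<close>

definition growth_exp :: "real \<Rightarrow> real" where
  "growth_exp \<sigma> = max 0 ((1 - \<sigma>) / 2)"

lemma ln_Suc_minus_ln:
  assumes "n \<ge> 1"
  shows "1 / (real n + 1) \<le> ln (real (Suc n)) - ln (real n)" "ln (real (Suc n)) - ln (real n) \<le> 1 / real n"
proof -
  have "ln (real (Suc n)) - ln (real n) = ln (1 + 1 / real n)"
    using assms by (subst ln_divide_pos[symmetric]) (auto simp: field_simps)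
  also have "\<dots> \<le> 1 / real n" using assms by (intro ln_add_one_self_le_self) auto
  finally show "ln (real (Suc n)) - ln (real n) \<le> 1 / real n" .
  have "ln (real n) - ln (real (Suc n)) = ln (real n / real (Suc n))"
    using assms by (subst ln_divide_pos) auto
  also have "\<dots> \<le> real n / real (Suc n) - 1" using assms by (intro ln_le_minus_one) auto
  also have "\<dots> = - (1 / (real n + 1))" using assms by (simp add: field_simps)
  finally show "1 / (real n + 1) \<le> ln (real (Suc n)) - ln (real n)" by simp
qed

text \<open>This is ln y \<le> y - 1 for y = n(n+2)/(n+1)^2 = 1 - 1/(n+1)^2.\<close>

lemma ln_second_difference:
  assumes "n \<ge> 1"
  shows "1 / (real n + 1)^2 \<le> (ln (real (Suc n)) - ln (real n)) - (ln (real (Suc (Suc n))) - ln (real (Suc n)))"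
proof -
  have pos: "real n * (real n + 2) > 0" using assms by (intro mult_pos_pos) auto
  have "(ln (real (Suc (Suc n))) - ln (real (Suc n))) - (ln (real (Suc n)) - ln (real n))
      = ln (real n * (real n + 2)) - ln ((real n + 1)^2)"
  proof -
    have "ln (real n * (real n + 2)) = ln (real n) + ln (real n + 2)" "ln ((real n + 1)^2) = 2 * ln (real n + 1)"
      using assms by (simp_all add: ln_mult ln_realpow)
    thus ?thesis by (simp add: algebra_simps)
  qed
  also have "\<dots> = ln (real n * (real n + 2) / (real n + 1)^2)"
    using pos by (subst ln_divide_pos) auto
  also have "\<dots> \<le> real n * (real n + 2) / (real n + 1)^2 - 1"
    using pos by (intro ln_le_minus_one divide_pos_pos) auto
  also have "\<dots> = - (1 / (real n + 1)^2)"
  proof -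
    define D where "D = (real n + 1)^2"
    have "D > 0" unfolding D_def by (intro zero_less_power) auto
    moreover have "real n * (real n + 2) = D - 1" by (simp add: D_def power2_eq_square algebra_simps)
    ultimately have "D \<noteq> 0" and "real n * (real n + 2) = D - 1" by auto
    thus ?thesis unfolding D_def[symmetric] by (simp add: diff_divide_distrib)
  qed
  finally show ?thesis by simp
qed

text \<open>For N \<ge> t the phase increments lie in [t/(2N), 1]: the only multiple of 2 pi nearby
  is 0, so Kusmin-Landau covers the whole block at once.\<close>

lemma cis_ln_block_large:
  assumes "t > 0" "t \<le> real N" "N' \<le> 2 * N" "N \<ge> 1"
  shows "norm (\<Sum>n=N..<N'. cis (t * ln (real n))) \<le> 16 * real N / t"
proof -
  have "norm (\<Sum>n=N..<N'. cis (t * ln (real n))) \<le> 8 / (t / (2 * real N))"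
  proof (rule kusmin_landau_aux)
    show "0 < t / (2 * real N)" using assms by simp
  next
    fix n assume n: "N \<le> n" "n < N'"
    hence n1: "n \<ge> 1" "real n + 1 \<le> 2 * real N" using assms by auto
    have "t / (2 * real N) \<le> t * (1 / (real n + 1))"
      using n1 assms by (simp add: frac_le)
    also have "\<dots> \<le> t * (ln (real (Suc n)) - ln (real n))"
      using assms by (intro mult_left_mono ln_Suc_minus_ln n1) auto
    finally have lower: "t / (2 * real N) \<le> t * ln (real (Suc n)) - t * ln (real n)"
      by (simp add: algebra_simps)
    have "t * (ln (real (Suc n)) - ln (real n)) \<le> t * (1 / real n)"
      using assms by (intro mult_left_mono ln_Suc_minus_ln n1) auto
    also have "\<dots> \<le> 1" using n n1 assms by (simp add: field_simps)
    also have "\<dots> \<le> 2 * pi - t / (2 * real N)"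
    proof -
      have "t / (2 * real N) \<le> 1" using assms by (simp add: field_simps)
      thus ?thesis using pi_gt3 by linarith
    qed
    finally show "t / (2 * real N) \<le> t * ln (real (Suc n)) - t * ln (real n) \<and>
        t * ln (real (Suc n)) - t * ln (real n) \<le> 2 * pi - t / (2 * real N)"
      using lower by (simp add: algebra_simps)
  next
    fix n assume n: "N \<le> n" "Suc n < N'"
    have "0 \<le> (ln (real (Suc n)) - ln (real n)) - (ln (real (Suc (Suc n))) - ln (real (Suc n)))"
      by (rule order_trans[OF _ ln_second_difference]) (use n assms in auto)
    hence "0 \<le> t * ((ln (real (Suc n)) - ln (real n)) - (ln (real (Suc (Suc n))) - ln (real (Suc n))))"
      using assms by (intro mult_nonneg_nonneg) auto
    thus "t * ln (real (Suc (Suc n))) - t * ln (real (Suc n)) \<le> t * ln (real (Suc n)) - t * ln (real n)"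
      by (simp add: algebra_simps)
  qed
  thus ?thesis by simp
qed

text \<open>Second differences are at least \<mu> = t/(4N^2). The choice \<delta> = 2 sqrt \<mu>
  makes both 2\<delta>/\<mu> and 8/\<delta> equal to 8N/sqrt t, and sqrt t \<le> N absorbs the 1,
  giving 17 N/sqrt t per fibre. With a fibre count of at most 3t/N the product is 51 sqrt t.\<close>

lemma cis_ln_block_middle:
  assumes "t > 0" "sqrt t \<le> real N" "real N \<le> t" "N' \<le> 2 * N" "N \<ge> 1"
  shows "norm (\<Sum>n=N..<N'. cis (t * ln (real n))) \<le> 51 * sqrt t"
proof -
  define \<delta> where "\<delta> = sqrt t / real N"
  define \<mu> where "\<mu> = t / (4 * real N ^ 2)"
  have N0: "real N > 0" and s0: "sqrt t > 0" using assms by auto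
  have tt: "t = sqrt t * sqrt t" using assms by simp
  have "norm (\<Sum>n=N..<N'. cis (t * ln (real n))) \<le> ((t / real N - 0) / (2 * pi) + 2) * (2 * \<delta> / \<mu> + 1 + 8 / \<delta>)"
  proof (rule van_der_corput)
    show "0 < \<delta>" "0 < \<mu>" "0 \<le> t / real N" using assms N0 by (auto simp: \<delta>_def \<mu>_def)
  next
    fix n assume n: "N \<le> n" "n < N'"
    hence n1: "n \<ge> 1" using assms by auto
    have "0 \<le> t * (1 / (real n + 1))" using assms by simp
    also have "\<dots> \<le> t * (ln (real (Suc n)) - ln (real n))"
      using assms by (intro mult_left_mono ln_Suc_minus_ln n1) auto
    finally have lower: "0 \<le> t * ln (real (Suc n)) - t * ln (real n)"
      by (simp add: algebra_simps)
    have "t * (ln (real (Suc n)) - ln (real n)) \<le> t * (1 / real n)"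
      using assms by (intro mult_left_mono ln_Suc_minus_ln n1) auto
    also have "\<dots> \<le> t / real N" using n N0 assms by (simp add: frac_le)
    finally show "0 \<le> t * ln (real (Suc n)) - t * ln (real n) \<and>
        t * ln (real (Suc n)) - t * ln (real n) \<le> t / real N"
      using lower by (simp add: algebra_simps)
  next
    fix n assume n: "N \<le> n" "Suc n < N'"
    hence "real n + 1 \<le> 2 * real N" using assms by auto
    hence "(real n + 1)^2 \<le> (2 * real N)^2" by (intro power_mono) auto
    hence "\<mu> \<le> t * (1 / (real n + 1)^2)" using assms N0 unfolding \<mu>_def
      by (simp add: power_mult_distrib frac_le)
    also have "\<dots> \<le> t * ((ln (real (Suc n)) - ln (real n)) - (ln (real (Suc (Suc n))) - ln (real (Suc n))))"
      using assms n by (intro mult_left_mono ln_second_difference) auto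
    finally show "\<mu> \<le> t * ln (real (Suc n)) - t * ln (real n) - (t * ln (real (Suc (Suc n))) - t * ln (real (Suc n)))"
      by (simp add: algebra_simps)
  qed
  also have "\<dots> \<le> (3 * (t / real N)) * (17 * (real N / sqrt t))"
  proof (intro mult_mono)
    have 1: "1 \<le> t / real N" using assms N0 by simp
    have "(t / real N) / (2 * pi) \<le> t / real N / 1"
      using 1 pi_gt3 assms by (intro frac_le) auto
    thus "(t / real N - 0) / (2 * pi) + 2 \<le> 3 * (t / real N)" using 1 by simp
    have "2 * \<delta> / \<mu> = 8 * (real N / sqrt t)"
      unfolding \<delta>_def \<mu>_def using N0 s0 by (subst (3) tt) (simp add: field_simps power2_eq_square)
    moreover have "8 / \<delta> = 8 * (real N / sqrt t)" by (simp add: \<delta>_def)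
    moreover have "1 \<le> real N / sqrt t" using assms s0 by simp
    ultimately show "2 * \<delta> / \<mu> + 1 + 8 / \<delta> \<le> 17 * (real N / sqrt t)" by simp
    show "0 \<le> 3 * (t / real N)" using assms by simp
    show "0 \<le> 2 * \<delta> / \<mu> + 1 + 8 / \<delta>" using assms by (simp add: \<delta>_def \<mu>_def)
  qed
  also have "\<dots> = 51 * (t / sqrt t)" using N0 by simp
  also have "t / sqrt t = sqrt t" using assms by (simp add: real_div_sqrt)
  finally show ?thesis .
qed

lemma of_nat_powr_eq_cis:
  assumes "n \<ge> 1"
  shows "complex_of_nat n powr s = of_real (real n powr Re s) * cis (Im s * ln (real n))"
proof -
  have "complex_of_nat n powr s = exp (s * of_real (ln (real n)))"
    using assms by (simp add: powr_def Ln_of_nat)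
  also have "\<dots> = exp (of_real (Re s * ln (real n)) + \<i> * of_real (Im s * ln (real n)))"
    by (rule arg_cong[of _ _ exp]) (simp add: complex_eq_iff)
  also have "\<dots> = of_real (exp (Re s * ln (real n))) * cis (Im s * ln (real n))"
    by (simp only: exp_add exp_of_real cis_conv_exp)
  finally show ?thesis using assms by (simp add: powr_def)
qed

text \<open>Abel's inequality with weights n^(-Re s). Conjugation reverses the frequency, so a bound
  at t = |Im s| serves both signs of Im s.\<close>

lemma norm_sum_powr_le_weighted:
  assumes "t = \<bar>Im s\<bar>" "Re s \<ge> 0" "1 \<le> N" "N < N'"
    and "\<And>n. N \<le> n \<Longrightarrow> n \<le> N' \<Longrightarrow> norm (\<Sum>k=N..<n. cis (t * ln (real k))) \<le> B"
  shows "norm (\<Sum>n=N..<N'. complex_of_nat n powr (-s)) \<le> real N powr (- Re s) * B"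
proof -
  define u where "u = - Im s"
  have B: "norm (\<Sum>k=N..<n. cis (u * ln (real k))) \<le> B" if "N \<le> n" "n \<le> N'" for n
  proof (cases "u = t")
    case True
    thus ?thesis using assms(5)[OF that] by simp
  next
    case False
    hence "u = - t" using assms(1) by (auto simp: u_def)
    hence "(\<Sum>k=N..<n. cis (u * ln (real k))) = cnj (\<Sum>k=N..<n. cis (t * ln (real k)))"
      by (simp add: cis_cnj)
    thus ?thesis using assms(5)[OF that] by (simp only: complex_mod_cnj)
  qed
  have "(\<Sum>n=N..<N'. complex_of_nat n powr (-s)) = (\<Sum>n=N..<N'. real n powr (- Re s) *\<^sub>R cis (u * ln (real n)))"
    using assms by (intro sum.cong refl) (simp add: of_nat_powr_eq_cis u_def scaleR_conv_of_real)
  also have "norm \<dots> \<le> real N powr (- Re s) * B"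
    using assms by (intro norm_weighted_sum_le B powr_mono2') auto
  finally show ?thesis .
qed

lemma powr_half_exp_le:
  assumes "t \<ge> 1"
  shows "1 \<le> t powr growth_exp \<sigma>" "sqrt t powr (1 - \<sigma>) \<le> t powr growth_exp \<sigma>"
proof -
  show "1 \<le> t powr growth_exp \<sigma>" using assms by (intro ge_one_powr_ge_zero) (auto simp: growth_exp_def)
  have "sqrt t powr (1 - \<sigma>) = t powr ((1 - \<sigma>) / 2)"
    using assms by (simp add: powr_half_sqrt[symmetric] powr_powr)
  also have "\<dots> \<le> t powr growth_exp \<sigma>" using assms by (intro powr_mono) (auto simp: growth_exp_def)
  finally show "sqrt t powr (1 - \<sigma>) \<le> t powr growth_exp \<sigma>" .
qed

text \<open>Three ranges: the trivial bound for N \<le> sqrt t, van der Corput up to t,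
  Kusmin-Landau beyond. For Re s \<le> 1 the first two are worst at N near sqrt t, which is the
  origin of t^((1 - Re s)/2). In the third, N \<le> 2t^2 keeps sqrt N / t bounded.\<close>

lemma dyadic_block_bound:
  assumes t: "t = \<bar>Im s\<bar>" "t \<ge> 2" and s: "Re s \<ge> 1/2" and N: "1 \<le> N" "real N \<le> 2 * t^2"
  shows "norm (\<Sum>n=N..<2*N. complex_of_nat n powr (-s)) \<le> 51 * t powr growth_exp (Re s)"
proof -
  define \<sigma> where "\<sigma> = Re s"
  have t1: "t \<ge> 1" using t by simp
  note pe = powr_half_exp_le[OF t1, of \<sigma>]
  have N0: "real N > 0" using N by simp
  have W: "norm (\<Sum>n=N..<2*N. complex_of_nat n powr (-s)) \<le> real N powr (- \<sigma>) * B"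
    if "\<And>n. N \<le> n \<Longrightarrow> n \<le> 2 * N \<Longrightarrow> norm (\<Sum>k=N..<n. cis (t * ln (real k))) \<le> B" for B
    unfolding \<sigma>_def using that s N t(1) by (intro norm_sum_powr_le_weighted) auto
  consider "real N \<le> sqrt t" | "sqrt t \<le> real N" "real N \<le> t" | "t \<le> real N" by linarith
  hence "norm (\<Sum>n=N..<2*N. complex_of_nat n powr (-s)) \<le> 51 * t powr growth_exp \<sigma>"
  proof cases
    case 1
    have "norm (\<Sum>n=N..<2*N. complex_of_nat n powr (-s)) \<le> real N powr (- \<sigma>) * real N"
    proof (rule W)
      fix n assume "N \<le> n" "n \<le> 2 * N"
      have "norm (\<Sum>k=N..<n. cis (t * ln (real k))) \<le> (\<Sum>k=N..<n. 1)" by (intro sum_norm_le) auto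
      also have "\<dots> \<le> real N" using \<open>n \<le> 2 * N\<close> \<open>N \<le> n\<close> by (simp add: of_nat_diff)
      finally show "norm (\<Sum>k=N..<n. cis (t * ln (real k))) \<le> real N" .
    qed
    also have "\<dots> = real N powr (1 - \<sigma>)" using N0 by (simp add: powr_diff powr_minus divide_inverse mult.commute)
    also have "\<dots> \<le> t powr growth_exp \<sigma>"
    proof (cases "\<sigma> \<le> 1")
      case True
      have "real N powr (1 - \<sigma>) \<le> sqrt t powr (1 - \<sigma>)" using True 1 by (intro powr_mono2) auto
      thus ?thesis using pe by linarith
    next
      case False
      have "real N powr (1 - \<sigma>) \<le> real N powr 0" using False N by (intro powr_mono) auto
      thus ?thesis using pe N0 by simp
    qed
    finally show ?thesis using pe by linarith
  next
    case 2
    have "norm (\<Sum>n=N..<2*N. complex_of_nat n powr (-s)) \<le> real N powr (- \<sigma>) * (51 * sqrt t)"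
      using 2 t N by (intro W cis_ln_block_middle) auto
    also have "\<dots> \<le> sqrt t powr (- \<sigma>) * (51 * sqrt t)"
      using 2 t s by (intro mult_right_mono powr_mono2') (auto simp: \<sigma>_def)
    also have "\<dots> = 51 * sqrt t powr (1 - \<sigma>)"
      using t by (simp add: powr_diff powr_minus divide_inverse mult.commute)
    finally show ?thesis using pe by linarith
  next
    case 3
    have "norm (\<Sum>n=N..<2*N. complex_of_nat n powr (-s)) \<le> real N powr (- \<sigma>) * (16 * real N / t)"
      using 3 t N by (intro W cis_ln_block_large) auto
    also have "\<dots> \<le> real N powr (- (1/2)) * (16 * real N / t)"
      using N s t by (intro mult_right_mono powr_mono) (auto simp: \<sigma>_def)
    also have "\<dots> = 16 * (sqrt (real N) / t)"
    proof -
      have "real N powr (- (1/2)) * real N = sqrt (real N)"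
        using N0 by (simp add: powr_minus powr_half_sqrt real_div_sqrt flip: divide_inverse mult.commute)
      thus ?thesis by (simp add: field_simps)
    qed
    also have "sqrt (real N) \<le> 2 * t"
      using N t by (intro real_le_lsqrt) (auto simp: power2_eq_square)
    hence "16 * (sqrt (real N) / t) \<le> 16 * 2" using t by (simp add: field_simps)
    finally show ?thesis using pe by linarith
  qed
  thus ?thesis by (simp add: \<sigma>_def)
qed

lemma zeta_sum_dyadic:
  "zeta_sum (2 ^ J - 1) s = (\<Sum>j<J. \<Sum>n=2^j..<2*2^j. complex_of_nat n powr (-s))"
proof (induction J)
  case (Suc J)
  have "zeta_sum (2 ^ Suc J - 1) s = (\<Sum>n=1..<2^Suc J. complex_of_nat n powr (-s))"
    unfolding zeta_sum_def by (intro sum.cong) auto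
  also have "\<dots> = (\<Sum>n=1..<2^J. complex_of_nat n powr (-s)) + (\<Sum>n=2^J..<2*2^J. complex_of_nat n powr (-s))"
    by (subst sum.atLeastLessThan_concat) auto
  also have "(\<Sum>n=1..<2^J. complex_of_nat n powr (-s)) = zeta_sum (2 ^ J - 1) s"
    unfolding zeta_sum_def by (intro sum.cong) auto
  finally show ?case using Suc by simp
qed (simp add: zeta_sum_def)

text \<open>At most 6 ln t dyadic blocks, each at most 51 times the power of t, give 306 = 6 * 51.
  The terms at the cut-off are bounded, and 2 ln t \<ge> 1 absorbs them, whence 2c.\<close>

lemma zeta_growth:
  fixes A :: real
  shows "\<exists>C>0. \<forall>s. 1/2 \<le> Re s \<and> Re s \<le> A \<and> 2 \<le> \<bar>Im s\<bar> \<longrightarrow>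
           norm (zeta s) \<le> C * \<bar>Im s\<bar> powr growth_exp (Re s) * ln \<bar>Im s\<bar>"
proof -
  \<comment> \<open>\<open>k\<close> bounds 2^(\<sigma>+1)/\<sigma> for 1/2 \<le> \<sigma> \<le> A,
    and \<open>c\<close> adds up the bounds 1, 2 and k|A| + k + 1 of the three terms left at the
    cut-off.\<close>
  define k where "k = 2 powr (\<bar>A\<bar> + 1) * 2"
  define c where "c = k * \<bar>A\<bar> + k + 4"
  have k: "k \<ge> 0" by (simp add: k_def)
  have c: "c \<ge> 0" using k by (simp add: c_def)
  have main: "norm (zeta s) \<le> (306 + 2 * c) * \<bar>Im s\<bar> powr growth_exp (Re s) * ln \<bar>Im s\<bar>"
    if s: "1/2 \<le> Re s" "Re s \<le> A" "2 \<le> \<bar>Im s\<bar>" for s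
  proof -
    define t where "t = \<bar>Im s\<bar>"
    define \<sigma> where "\<sigma> = Re s"
    have t: "t \<ge> 2" using s by (simp add: t_def)
    have t1: "t \<ge> 1" using t by simp
    note pe = powr_half_exp_le(1)[OF t1, of \<sigma>]
    have A: "A \<ge> 0" using s by linarith
    (* N is of size t^2, so that norm s * N powr (- Re s) stays bounded for Re s \<ge> 1/2. *)
    define J where "J = nat \<lceil>log 2 (t^2)\<rceil>"
    define N :: nat where "N = 2 ^ J"
    have t4: "1 \<le> t^2" using t by simp
    have lg: "log 2 (t^2) \<ge> 0" using t4 t by (subst zero_le_log_cancel_iff) auto
    have J: "log 2 (t^2) \<le> real J" "real J < log 2 (t^2) + 1"
      using lg unfolding J_def by linarith+
    have "2 powr log 2 (t^2) \<le> 2 powr real J" using J by (intro powr_mono) auto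
    moreover have p2: "2 powr log 2 (t^2) = t^2" using t by (intro powr_log_cancel) auto
    ultimately have N_lower: "t^2 \<le> real N" by (simp add: N_def powr_realpow)
    have "2 powr real J \<le> 2 powr (log 2 (t^2) + 1)" using J by (intro powr_mono) auto
    hence N_upper: "real N \<le> 2 * t^2" by (simp add: N_def powr_realpow powr_add p2)
    have N1: "N \<ge> 1" by (simp add: N_def)
    have N0: "real N > 0" using N1 by simp
    have ln2: "ln (2::real) \<ge> 1/2" using ln_Suc_minus_ln(1)[of 1] by simp
    have lnt: "ln t \<ge> 1/2"
    proof -
      have "ln 2 \<le> ln t" using t by (subst ln_le_cancel_iff) auto
      with ln2 show ?thesis by linarith
    qed
    have J_le: "real J \<le> 6 * ln t"
    proof -
      have "log 2 (t^2) = 2 * ln t / ln 2" using t by (simp add: log_def ln_realpow)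
      also have "\<dots> \<le> 2 * ln t / (1/2)" using ln2 lnt by (intro divide_left_mono) auto
      finally show ?thesis using J lnt by simp
    qed
    have S: "norm (zeta_sum (N - 1) s) \<le> real J * (51 * t powr growth_exp \<sigma>)"
    proof -
      have "norm (zeta_sum (N - 1) s) \<le> (\<Sum>j<J. norm (\<Sum>n=2^j..<2*2^j. complex_of_nat n powr (-s)))"
        unfolding N_def zeta_sum_dyadic by (rule norm_sum)
      also have "\<dots> \<le> (\<Sum>j<J. 51 * t powr growth_exp \<sigma>)"
      proof (intro sum_mono)
        fix j assume "j \<in> {..<J}"
        hence "(2::nat)^j \<le> 2^J" by (intro power_increasing) auto
        hence "real (2^j) \<le> 2 * t^2" using N_upper unfolding N_def by (meson of_nat_mono order_trans)
        thus "norm (\<Sum>n=2^j..<2*2^j. complex_of_nat n powr (-s)) \<le> 51 * t powr growth_exp \<sigma>"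
          unfolding \<sigma>_def using t t_def s by (intro dyadic_block_bound) auto
      qed
      finally show ?thesis by simp
    qed
    have Nhalf: "real N powr (-(1/2)) \<le> 1 / t"
    proof -
      have "t \<le> sqrt (real N)" using N_lower t by (simp add: real_le_rsqrt)
      hence "1 / sqrt (real N) \<le> 1 / t" using t by (intro frac_le) auto
      thus ?thesis by (simp only: powr_minus powr_half_sqrt[OF less_imp_le[OF N0]] inverse_eq_divide)
    qed
    have Nsig: "real N powr (-\<sigma>) \<le> 1 / t"
    proof -
      have "real N powr (-\<sigma>) \<le> real N powr (-(1/2))" using s N1 by (intro powr_mono) (auto simp: \<sigma>_def)
      thus ?thesis using Nhalf by linarith
    qed
    have split: "zeta_sum N s = zeta_sum (N - 1) s + of_nat N powr (-s)"
      using N1 by (cases N) (auto simp: zeta_sum_def)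
    have nN: "norm (of_nat N powr (-s) :: complex) = real N powr (-\<sigma>)"
      using N0 norm_powr_real_powr[of "of_nat N" "-s"] by (simp add: \<sigma>_def)
    have nN': "norm (of_nat N powr (1-s) :: complex) = real N powr (1-\<sigma>)"
      using N0 norm_powr_real_powr[of "of_nat N" "1-s"] by (simp add: \<sigma>_def)
    have s1: "norm (s - 1) \<ge> t"
      using abs_Im_le_cmod[of "s - 1"] by (simp add: t_def)
    have ne: "s - 1 \<noteq> 0" using s1 t by auto
    have T1: "norm (of_nat N powr (1-s) / (s - 1)) \<le> 2"
    proof -
      have "norm (of_nat N powr (1-s) / (s - 1)) \<le> real N powr (1-\<sigma>) / t"
        unfolding norm_divide nN' using s1 t by (intro divide_left_mono mult_pos_pos) auto
      also have "real N powr (1-\<sigma>) \<le> real N powr (1/2)"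
        using s N1 by (intro powr_mono) (auto simp: \<sigma>_def)
      also have "\<dots> \<le> 2 * t"
        using N_upper t unfolding powr_half_sqrt[OF less_imp_le[OF N0]]
        by (intro real_le_lsqrt) (auto simp: power2_eq_square)
      finally show ?thesis using t by (simp add: divide_right_mono field_simps)
    qed
    have T2: "norm ((zeta_reg s - zeta_approx N s) / (s - 1)) \<le> k * \<bar>A\<bar> + k + 1"
    proof -
      have "norm (zeta_reg s - zeta_approx N s)
         \<le> norm (s - 1) * (norm s * (2 powr (Re s + 1) / Re s) + 1) * real N powr (- Re s)"
        using s N1 by (intro zeta_reg_approx) auto
      hence "norm ((zeta_reg s - zeta_approx N s) / (s - 1)) \<le> (norm s * (2 powr (Re s + 1) / Re s) + 1) * real N powr (- Re s)"
        using ne unfolding norm_divide by (simp add: divide_le_eq mult_ac)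
      also have "\<dots> \<le> ((\<bar>A\<bar> + t) * k + 1) * (1 / t)"
      proof (intro mult_mono add_mono)
        have "norm s \<le> \<bar>Re s\<bar> + \<bar>Im s\<bar>" by (rule cmod_le)
        thus "norm s \<le> \<bar>A\<bar> + t" using s by (simp add: t_def)
        have "2 powr (Re s + 1) / Re s \<le> 2 powr (\<bar>A\<bar> + 1) / (1/2)"
          using s by (intro frac_le powr_mono) auto
        thus "2 powr (Re s + 1) / Re s \<le> k" by (simp add: k_def)
        show "real N powr (- Re s) \<le> 1 / t" using Nsig by (simp add: \<sigma>_def)
      qed (use t k s in auto)
      also have "\<dots> = k * \<bar>A\<bar> / t + k + 1 / t" using t by (simp add: field_simps)
      also have "\<dots> \<le> k * \<bar>A\<bar> / 1 + k + 1 / 1"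
        using t k by (intro add_mono frac_le mult_nonneg_nonneg) auto
      finally show ?thesis by simp
    qed
    have "zeta s = zeta_sum (N - 1) s + (of_nat N powr (-s) + of_nat N powr (1-s) / (s - 1) + (zeta_reg s - zeta_approx N s) / (s - 1))"
      using ne unfolding zeta_def zeta_approx_def split by (simp add: diff_divide_distrib add_divide_distrib)
    also have "norm \<dots> \<le> norm (zeta_sum (N - 1) s) + (norm (of_nat N powr (-s) :: complex) + norm (of_nat N powr (1-s) / (s - 1)) + norm ((zeta_reg s - zeta_approx N s) / (s - 1)))"
      by (intro norm_triangle_mono order_refl)
    also have "\<dots> \<le> real J * (51 * t powr growth_exp \<sigma>) + (1 + 2 + (k * \<bar>A\<bar> + k + 1))"
    proof -
      have "1 / t \<le> 1" using t by simp
      thus ?thesis using S T1 T2 Nsig unfolding nN by linarith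
    qed
    also have "\<dots> \<le> (6 * ln t) * (51 * t powr growth_exp \<sigma>) + c * (2 * ln t * t powr growth_exp \<sigma>)"
    proof (intro add_mono mult_right_mono J_le)
      have "1 * 1 \<le> 2 * ln t * t powr growth_exp \<sigma>" using lnt pe by (intro mult_mono) auto
      hence "c * 1 \<le> c * (2 * ln t * t powr growth_exp \<sigma>)" using c by (intro mult_left_mono) auto
      thus "1 + 2 + (k * \<bar>A\<bar> + k + 1) \<le> c * (2 * ln t * t powr growth_exp \<sigma>)" by (simp add: c_def)
    qed auto
    also have "\<dots> = (306 + 2 * c) * t powr growth_exp \<sigma> * ln t" by (simp add: algebra_simps)
    finally show ?thesis by (simp add: t_def \<sigma>_def)
  qed
  show ?thesis
    using c by (intro exI[of _ "306 + 2 * c"] conjI allI impI main) auto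
qed

section \<open>Asymptotics of partial sums of zeta and its derivative\<close>

text \<open>The estimate is uniform for bounded s because Cauchy's inequality is applied to it on
  circles around points a \<ge> 1/2; going down to Re s = 1/4 leaves room for a radius of 1/4.
  Passing from N = floor x to x costs a multiple of N^(-Re s), and N \<ge> x/2 costs a bounded
  factor.\<close>

lemma zeta_reg_approx_real:
  fixes R :: real
  shows "\<exists>C\<ge>0. \<forall>x s. x \<ge> 1 \<and> 1/4 \<le> Re s \<and> norm s \<le> R \<longrightarrow>
     norm (zeta_reg s - ((s - 1) * zeta_sum (nat \<lfloor>x\<rfloor>) s + of_real x powr (1 - s))) \<le> C * x powr (- Re s)"
proof -
  define K where "K = (\<bar>R\<bar> + 1) * (\<bar>R\<bar> * (2 powr (\<bar>R\<bar> + 1) / (1/4)) + 1) + (\<bar>R\<bar> + 1)"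
  have K: "K \<ge> 0" by (simp add: K_def)
  have "norm (zeta_reg s - ((s - 1) * zeta_sum (nat \<lfloor>x\<rfloor>) s + of_real x powr (1 - s))) \<le> (K * 2 powr \<bar>R\<bar>) * x powr (- Re s)"
    if x: "x \<ge> 1" and s: "1/4 \<le> Re s" "norm s \<le> R" for x s
  proof -
    define N where "N = nat \<lfloor>x\<rfloor>"
    have N: "N \<ge> 1" "real N \<le> x" "x \<le> real N + 1" using x unfolding N_def by linarith+
    have R: "Re s \<le> \<bar>R\<bar>" using s complex_Re_le_cmod[of s] by linarith
    have s1: "norm (s - 1) \<le> \<bar>R\<bar> + 1" using s norm_triangle_ineq4[of s 1] by simp
    have 1: "norm (zeta_reg s - zeta_approx N s) \<le> (\<bar>R\<bar> + 1) * (\<bar>R\<bar> * (2 powr (\<bar>R\<bar> + 1) / (1/4)) + 1) * real N powr (- Re s)"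
    proof -
      have "norm (zeta_reg s - zeta_approx N s)
         \<le> norm (s - 1) * (norm s * (2 powr (Re s + 1) / Re s) + 1) * real N powr (- Re s)"
        using s N by (intro zeta_reg_approx) auto
      also have "\<dots> \<le> (\<bar>R\<bar> + 1) * (\<bar>R\<bar> * (2 powr (\<bar>R\<bar> + 1) / (1/4)) + 1) * real N powr (- Re s)"
        using s R s1 N by (intro mult_mono add_mono frac_le powr_mono) auto
      finally show ?thesis .
    qed
    have 2: "norm (of_real x powr (1 - s) - of_real (real N) powr (1 - s)) \<le> (\<bar>R\<bar> + 1) * real N powr (- Re s)"
    proof -
      have "norm (of_real x powr (1 - s) - of_real (real N) powr (1 - s))
         \<le> norm (1 - s) * (x - real N) * real N powr (Re (1 - s) - 1)"
        using N s by (intro powr_diff_bound) auto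
      also have "\<dots> \<le> (\<bar>R\<bar> + 1) * 1 * real N powr (Re (1 - s) - 1)"
        using s1 N by (intro mult_mono) (auto simp: norm_minus_commute)
      finally show ?thesis by simp
    qed
    have "zeta_reg s - ((s - 1) * zeta_sum N s + of_real x powr (1 - s))
       = (zeta_reg s - zeta_approx N s) - (of_real x powr (1 - s) - of_real (real N) powr (1 - s))"
      by (simp add: zeta_approx_def)
    also have "norm \<dots> \<le> norm (zeta_reg s - zeta_approx N s) + norm (of_real x powr (1 - s) - of_real (real N) powr (1 - s))"
      by (rule norm_triangle_ineq4)
    also have "\<dots> \<le> K * real N powr (- Re s)" using 1 2 by (simp add: K_def algebra_simps)
    also have "\<dots> \<le> K * (x / 2) powr (- Re s)"
      using K N x s by (intro mult_left_mono powr_mono2') auto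
    also have "(x / 2) powr (- Re s) = 2 powr Re s * x powr (- Re s)"
      using x by (simp add: powr_divide powr_minus_divide)
    also have "K * (2 powr Re s * x powr (- Re s)) \<le> K * (2 powr \<bar>R\<bar> * x powr (- Re s))"
      using K R by (intro mult_left_mono mult_right_mono powr_mono) auto
    finally show ?thesis by (simp add: N_def mult_ac)
  qed
  thus ?thesis using K by (intro exI[of _ "K * 2 powr \<bar>R\<bar>"]) auto
qed

section \<open>Derivatives in s of the truncated sums\<close>

definition log_sum :: "nat \<Rightarrow> complex \<Rightarrow> complex" where
  "log_sum N s = (\<Sum>n=1..N. of_real (ln (real n)) * of_nat n powr (-s))"

lemma zeta_sum_deriv: "(zeta_sum N has_field_derivative - log_sum N s) (at s)"
proof -
  have "((\<lambda>s. \<Sum>n=1..N. of_nat n powr (-s)) has_field_derivative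
           (\<Sum>n=1..N. - (of_real (ln (real n)) * of_nat n powr (-s)))) (at s)"
  proof (rule DERIV_sum)
    fix n assume "n \<in> {1..N}"
    hence n: "of_nat n \<noteq> (0::complex)" "ln (of_nat n) = complex_of_real (ln (real n))" by (auto simp: Ln_of_nat)
    from DERIV_chain2[OF has_field_derivative_powr_right[OF n(1)] DERIV_minus[OF DERIV_ident]]
    show "((\<lambda>s. of_nat n powr (-s)) has_field_derivative - (of_real (ln (real n)) * of_nat n powr (-s))) (at s)"
      by (simp add: n(2))
  qed
  thus ?thesis by (simp add: zeta_sum_def[abs_def] log_sum_def sum_negf)
qed

text \<open>Existence suffices: in the second derivative of \<open>zeta_main\<close> at 1 this value
  is multiplied by s - 1 = 0.\<close>

lemma log_sum_deriv: "\<exists>D. (log_sum N has_field_derivative D) (at s)"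
proof -
  have "log_sum N holomorphic_on UNIV"
    unfolding log_sum_def[abs_def] by (intro holomorphic_intros) auto
  from holomorphic_derivI[OF this open_UNIV] show ?thesis by auto
qed

lemma of_real_powr_deriv:
  assumes "x > 0"
  shows "((\<lambda>s. complex_of_real x powr (1 - s)) has_field_derivative - (of_real (ln x) * of_real x powr (1 - s))) (at s)"
proof -
  have x: "of_real x \<noteq> (0::complex)" "ln (of_real x) = complex_of_real (ln x)"
    using assms by (auto simp: Ln_of_real)
  from DERIV_chain2[OF has_field_derivative_powr_right[OF x(1)] DERIV_diff[OF DERIV_const DERIV_ident]]
  show ?thesis by (simp add: x(2))
qed

definition zeta_main :: "real \<Rightarrow> complex \<Rightarrow> complex" where
  "zeta_main x s = (s - 1) * zeta_sum (nat \<lfloor>x\<rfloor>) s + of_real x powr (1 - s)"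

lemma zeta_main_deriv:
  assumes "x > 0"
  shows "(zeta_main x has_field_derivative
           zeta_sum (nat \<lfloor>x\<rfloor>) s - (s - 1) * log_sum (nat \<lfloor>x\<rfloor>) s - of_real (ln x) * of_real x powr (1 - s)) (at s)"
proof -
  have "((\<lambda>s. (s - 1) * zeta_sum (nat \<lfloor>x\<rfloor>) s) has_field_derivative
      (1 - 0) * zeta_sum (nat \<lfloor>x\<rfloor>) s + - log_sum (nat \<lfloor>x\<rfloor>) s * (s - 1)) (at s)"
    by (intro DERIV_mult DERIV_diff DERIV_ident DERIV_const zeta_sum_deriv)
  from DERIV_add[OF this of_real_powr_deriv[OF assms]]
  show ?thesis by (simp add: zeta_main_def[abs_def] algebra_simps)
qed

lemma deriv_zeta_main:
  assumes "x > 0"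
  shows "deriv (zeta_main x) = (\<lambda>s. zeta_sum (nat \<lfloor>x\<rfloor>) s - (s - 1) * log_sum (nat \<lfloor>x\<rfloor>) s - of_real (ln x) * of_real x powr (1 - s))"
  by (intro ext DERIV_imp_deriv zeta_main_deriv assms)

lemma deriv2_zeta_main_1:
  assumes "x > 0"
  shows "(deriv ^^ 2) (zeta_main x) 1 = - 2 * log_sum (nat \<lfloor>x\<rfloor>) 1 + of_real ((ln x)^2)"
proof -
  obtain D where D: "(log_sum (nat \<lfloor>x\<rfloor>) has_field_derivative D) (at 1)" using log_sum_deriv by blast
  have "((\<lambda>s. zeta_sum (nat \<lfloor>x\<rfloor>) s - (s - 1) * log_sum (nat \<lfloor>x\<rfloor>) s - of_real (ln x) * of_real x powr (1 - s))
      has_field_derivative - 2 * log_sum (nat \<lfloor>x\<rfloor>) 1 + of_real ((ln x)^2)) (at 1)"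
  proof -
    have "((\<lambda>s. (s - 1) * log_sum (nat \<lfloor>x\<rfloor>) s) has_field_derivative
        (1 - 0) * log_sum (nat \<lfloor>x\<rfloor>) 1 + D * (1 - 1)) (at 1)"
      by (intro DERIV_mult DERIV_diff DERIV_ident DERIV_const D)
    from DERIV_diff[OF DERIV_diff[OF zeta_sum_deriv[of "nat \<lfloor>x\<rfloor>"] this] DERIV_cmult[OF of_real_powr_deriv[OF assms], of "of_real (ln x)"]]
    show ?thesis using assms by (simp add: power2_eq_square)
  qed
  thus ?thesis unfolding numeral_2_eq_2 funpow.simps o_def id_def deriv_zeta_main[OF assms]
    by (rule DERIV_imp_deriv)
qed

lemma zeta_main_holomorphic: "x > 0 \<Longrightarrow> zeta_main x holomorphic_on A"
  unfolding holomorphic_on_def field_differentiable_def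
  using zeta_main_deriv has_field_derivative_at_within by blast

text \<open>Cauchy's inequality for the difference of two functions holomorphic on Re s > 0. The
  cases k = 0, 1, 2 are the source of all expansions of sums of n^(-a) and n^(-a) ln n below. The
  factor 4^k comes from the radius and exp (1/4) from x^r \<le> exp (1/4).\<close>

lemma deriv_zeta_approx_bound:
  assumes "a \<ge> 1/2"
  shows "\<exists>C\<ge>0. \<forall>x\<ge>1. norm ((deriv ^^ k) zeta_reg (of_real a) - (deriv ^^ k) (zeta_main x) (of_real a))
            \<le> C * (1 + ln x) ^ k * x powr (- a)"
proof -
  obtain C where C: "C \<ge> 0" and bd: "\<And>x s. x \<ge> 1 \<Longrightarrow> 1/4 \<le> Re s \<Longrightarrow> norm s \<le> a + 1 \<Longrightarrow>
     norm (zeta_reg s - zeta_main x s) \<le> C * x powr (- Re s)"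
    using zeta_reg_approx_real[of "a + 1"] unfolding zeta_main_def by blast
  have "norm ((deriv ^^ k) zeta_reg (of_real a) - (deriv ^^ k) (zeta_main x) (of_real a))
            \<le> (fact k * C * exp (1/4) * 4 ^ k) * (1 + ln x) ^ k * x powr (- a)" if x: "x \<ge> 1" for x
  proof -
    (* x powr r is bounded for this radius, so each derivative costs only a factor ln x. *)
    define r where "r = 1 / (4 * (1 + ln x))"
    have lx: "ln x \<ge> 0" using x by simp
    have r: "0 < r" "r \<le> 1/4" "r * ln x \<le> 1/4"
      using lx unfolding r_def by (auto simp: field_simps)
    have hol: "zeta_reg holomorphic_on {s. Re s > 0}" "zeta_main x holomorphic_on {s. Re s > 0}"
      using zeta_reg_holomorphic zeta_main_holomorphic x by auto
    have Re: "a - r \<le> Re s" "norm s \<le> a + r" if "norm (of_real a - s) \<le> r" for s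
    proof -
      have "Re (of_real a - s) \<le> r" using complex_Re_le_cmod[of "of_real a - s"] that by linarith
      thus "a - r \<le> Re s" by simp
      have "norm s \<le> norm (of_real a :: complex) + norm (of_real a - s)"
        by (metis norm_minus_commute norm_triangle_sub add.commute)
      thus "norm s \<le> a + r" using that assms by simp
    qed
    have sub: "cball (of_real a) r \<subseteq> {s. Re s > 0}"
      using Re(1) r assms by (force simp: dist_norm)
    have hol2: "(\<lambda>s. zeta_reg s - zeta_main x s) holomorphic_on {s. Re s > 0}"
      by (intro holomorphic_intros hol)
    have "norm ((deriv ^^ k) (\<lambda>s. zeta_reg s - zeta_main x s) (of_real a)) \<le> fact k * (C * exp (1/4) * x powr (- a)) / r ^ k"
    proof (rule Cauchy_inequality)
      show "(\<lambda>s. zeta_reg s - zeta_main x s) holomorphic_on ball (complex_of_real a) r"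
        using hol2 sub ball_subset_cball holomorphic_on_subset by blast
      show "continuous_on (cball (complex_of_real a) r) (\<lambda>s. zeta_reg s - zeta_main x s)"
        using hol2 sub holomorphic_on_imp_continuous_on holomorphic_on_subset by blast
      fix s assume s: "norm (complex_of_real a - s) = r"
      have "norm (zeta_reg s - zeta_main x s) \<le> C * x powr (- Re s)"
        using Re[of s] s r x assms by (intro bd) auto
      also have "x powr (- Re s) \<le> x powr (- a + r)"
        using Re[of s] s x by (intro powr_mono) auto
      also have "\<dots> = exp (r * ln x) * x powr (- a)"
        using x by (simp add: powr_def exp_add ring_distribs flip: exp_add)
      also have "\<dots> \<le> exp (1/4) * x powr (- a)" using r by (intro mult_right_mono) auto
      finally show "norm (zeta_reg s - zeta_main x s) \<le> C * exp (1/4) * x powr (- a)"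
        using C by (simp add: mult_left_mono mult.assoc)
    qed (use r in auto)
    also have "\<dots> = (fact k * C * exp (1/4) * 4 ^ k) * (1 + ln x) ^ k * x powr (- a)"
      unfolding r_def power_divide power_mult_distrib by simp
    also have "(deriv ^^ k) (\<lambda>s. zeta_reg s - zeta_main x s) (of_real a)
        = (deriv ^^ k) zeta_reg (of_real a) - (deriv ^^ k) (zeta_main x) (of_real a)"
      using assms by (intro higher_deriv_diff[OF hol open_halfspace_Re_gt]) auto
    finally show ?thesis .
  qed
  thus ?thesis using C by (intro exI[of _ "fact k * C * exp (1/4) * 4 ^ k"]) auto
qed

section \<open>Expansions at s = 1: Euler's constant and \<open>stieltjes1\<close>\<close>

lemma zeta_sum_1_eq_harm: "zeta_sum N 1 = of_real (harm N)"
proof -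
  have "zeta_sum N 1 = (\<Sum>n=1..N. of_real (inverse (real n)))"
    unfolding zeta_sum_def by (intro sum.cong refl) (simp add: powr_minus)
  thus ?thesis by (simp add: harm_def)
qed

text \<open>At 1 the derivative of \<open>zeta_main n\<close> is exactly the n-th harmonic number
  minus ln n, so the approximation bound identifies the limit.\<close>

lemma deriv_zeta_reg_1: "deriv zeta_reg 1 = of_real euler_mascheroni"
proof -
  obtain C where C: "\<And>x. x \<ge> 1 \<Longrightarrow> norm ((deriv ^^ 1) zeta_reg (of_real 1) - (deriv ^^ 1) (zeta_main x) (of_real 1))
            \<le> C * (1 + ln x) ^ 1 * x powr (- 1)"
    using deriv_zeta_approx_bound[of 1 1] by auto
  have eq: "(deriv ^^ 1) (zeta_main (real n)) (of_real 1) = of_real (harm n - ln (real n))" if "n \<ge> 1" for n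
    using that by (simp add: deriv_zeta_main zeta_sum_1_eq_harm)
  have "(\<lambda>n. deriv zeta_reg 1 - of_real (harm n - ln (real n))) \<longlonglongrightarrow> 0"
  proof (rule Lim_null_comparison)
    show "\<forall>\<^sub>F n in sequentially. norm (deriv zeta_reg 1 - of_real (harm n - ln (real n))) \<le> C * (1 + ln (real n)) ^ 1 * real n powr (- 1)"
      using eventually_ge_at_top[of 1]
    proof eventually_elim
      case (elim n)
      show ?case using C[of "real n"] elim unfolding eq[OF elim] by simp
    qed
    show "(\<lambda>n. C * (1 + ln (real n)) ^ 1 * real n powr (- 1)) \<longlonglongrightarrow> 0" by real_asymp
  qed
  moreover have "(\<lambda>n. deriv zeta_reg 1 - of_real (harm n - ln (real n))) \<longlonglongrightarrow> deriv zeta_reg 1 - of_real euler_mascheroni"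
    by (intro tendsto_intros tendsto_of_real euler_mascheroni_LIMSEQ)
  ultimately show ?thesis using LIMSEQ_unique by fastforce
qed

text \<open>The zeros of 1 - 2^(1-z) are spaced 2 pi/ln 2 apart on Re z = 1, so the unit disc about
  1 contains only z = 1. There \<open>(z - 1) * rzeta z\<close> is 0, whereas
  \<open>zeta_reg\<close> is 1; hence the comparison is made on the punctured disc and the limit is
  taken afterwards.\<close>

lemma stieltjes1_eq: "stieltjes1 = (deriv ^^ 2) zeta_reg 1 / 2"
proof -
  have eq: "(z - 1) * rzeta z = zeta_reg z" if z: "z \<in> ball 1 1 - {1}" for z
  proof -
    have n: "norm (1 - z) < 1" "z \<noteq> 1" using z by (auto simp: dist_norm)
    have "Re (1 - z) < 1" using n complex_Re_le_cmod[of "1 - z"] by linarith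
    hence Re: "Re z > 0" by simp
    have "2 powr (1 - z) \<noteq> 1"
    proof
      assume a: "2 powr (1 - z) = 1"
      have l2: "Ln 2 = complex_of_real (ln 2)" using Ln_of_real[of 2] by simp
      have "exp ((1 - z) * of_real (ln 2)) = 1" using a by (simp add: powr_def l2)
      then obtain n :: int where "Re ((1 - z) * of_real (ln 2)) = 0" and n2: "Im ((1 - z) * of_real (ln 2)) = of_int (2 * n) * pi"
        unfolding exp_eq_1 by blast
      hence re: "Re (1 - z) = 0" by simp
      have "\<bar>Im (1 - z)\<bar> \<le> 1" using abs_Im_le_cmod[of "1 - z"] n by linarith
      moreover have "ln (2::real) \<le> 1" using ln_le_minus_one[of "2::real"] by simp
      ultimately have "\<bar>Im (1 - z)\<bar> * ln 2 \<le> 1 * 1" by (intro mult_mono) auto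
      hence le: "\<bar>Im ((1 - z) * of_real (ln 2))\<bar> \<le> 1" by (simp add: abs_mult)
      have "n = 0"
      proof (rule ccontr)
        assume "n \<noteq> 0"
        hence "\<bar>real_of_int n\<bar> \<ge> 1" by linarith
        hence "1 * (2 * pi) \<le> \<bar>real_of_int n\<bar> * (2 * pi)" by (intro mult_right_mono) auto
        hence "2 * pi \<le> \<bar>Im ((1 - z) * of_real (ln 2))\<bar>" unfolding n2 by (simp add: abs_mult mult_ac)
        with le pi_gt3 show False by linarith
      qed
      hence "Im (1 - z) = 0" using n2 by simp
      hence "1 - z = 0" using re by (simp add: complex_eq_iff)
      thus False using n by simp
    qed
    thus ?thesis using Re n by (simp add: rzeta_eq_zeta zeta_def)
  qed
  have "((deriv ^^ 2) zeta_reg \<longlongrightarrow> (deriv ^^ 2) zeta_reg 1) (at 1)"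
  proof -
    have "continuous_on {s. Re s > 0} ((deriv ^^ 2) zeta_reg)"
      by (intro holomorphic_on_imp_continuous_on holomorphic_higher_deriv zeta_reg_holomorphic open_halfspace_Re_gt)
    hence "isCont ((deriv ^^ 2) zeta_reg) 1"
      using open_halfspace_Re_gt by (auto simp: continuous_on_eq_continuous_at)
    thus ?thesis by (simp add: isCont_def)
  qed
  moreover have "\<forall>\<^sub>F s in at 1. (deriv ^^ 2) (\<lambda>z. (z - 1) * rzeta z) s = (deriv ^^ 2) zeta_reg s"
  proof -
    have "\<forall>\<^sub>F s in at 1. s \<in> ball (1::complex) 1 - {1}"
      by (intro eventually_at_in_open) auto
    thus ?thesis
    proof eventually_elim
      case (elim s)
      have "\<forall>\<^sub>F z in nhds s. z \<in> ball (1::complex) 1 - {1}"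
        using elim by (intro eventually_nhds_in_open) auto
      hence "\<forall>\<^sub>F z in nhds s. (z - 1) * rzeta z = zeta_reg z"
        by eventually_elim (rule eq)
      thus ?case by (intro higher_deriv_cong_ev) auto
    qed
  qed
  ultimately have "((deriv ^^ 2) (\<lambda>z. (z - 1) * rzeta z) \<longlongrightarrow> (deriv ^^ 2) zeta_reg 1) (at 1)"
    by (subst tendsto_cong) auto
  hence "Lim (at 1) ((deriv ^^ 2) (\<lambda>z. (z - 1) * rzeta z)) = (deriv ^^ 2) zeta_reg 1"
    by (intro tendsto_Lim) auto
  thus ?thesis by (simp add: stieltjes1_def)
qed

text \<open>The factor s - 1 hides the sum itself at s = 1: the harmonic sum becomes visible in the
  first derivative of \<open>zeta_main\<close>, the logarithmic sum in the second.\<close>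

lemma zeta_sum_1_asymp:
  "\<exists>C\<ge>0. \<forall>x\<ge>1. norm (zeta_sum (nat \<lfloor>x\<rfloor>) 1 - of_real (ln x + euler_mascheroni)) \<le> C * (1 + ln x) * x powr (-1)"
proof -
  obtain C where C: "C \<ge> 0" "\<And>x. x \<ge> 1 \<Longrightarrow> norm ((deriv ^^ 1) zeta_reg (of_real 1) - (deriv ^^ 1) (zeta_main x) (of_real 1))
            \<le> C * (1 + ln x) ^ 1 * x powr (- 1)"
    using deriv_zeta_approx_bound[of 1 1] by auto
  show ?thesis
  proof (intro exI[of _ C] conjI allI impI C(1))
    fix x :: real assume x: "x \<ge> 1"
    have "(deriv ^^ 1) zeta_reg (of_real 1) - (deriv ^^ 1) (zeta_main x) (of_real 1)
        = - (zeta_sum (nat \<lfloor>x\<rfloor>) 1 - of_real (ln x + euler_mascheroni))"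
      using x by (simp add: deriv_zeta_main deriv_zeta_reg_1)
    thus "norm (zeta_sum (nat \<lfloor>x\<rfloor>) 1 - of_real (ln x + euler_mascheroni)) \<le> C * (1 + ln x) * x powr (-1)"
      using C(2)[OF x] by (simp only: norm_minus_cancel power_one_right)
  qed
qed

(* stieltjes1 is the negative of the usual first Stieltjes constant. *)
lemma log_sum_1_asymp:
  "\<exists>C\<ge>0. \<forall>x\<ge>1. norm (log_sum (nat \<lfloor>x\<rfloor>) 1 - of_real ((ln x)^2 / 2) + stieltjes1) \<le> C * (1 + ln x)^2 * x powr (-1)"
proof -
  obtain C where C: "C \<ge> 0" "\<And>x. x \<ge> 1 \<Longrightarrow> norm ((deriv ^^ 2) zeta_reg (of_real 1) - (deriv ^^ 2) (zeta_main x) (of_real 1))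
            \<le> C * (1 + ln x) ^ 2 * x powr (- 1)"
    using deriv_zeta_approx_bound[of 1 2] by auto
  show ?thesis
  proof (intro exI[of _ C] conjI allI impI C(1))
    fix x :: real assume x: "x \<ge> 1"
    have "(deriv ^^ 2) zeta_reg (of_real 1) - (deriv ^^ 2) (zeta_main x) (of_real 1)
        = 2 * (log_sum (nat \<lfloor>x\<rfloor>) 1 - of_real ((ln x)^2 / 2) + stieltjes1)"
      unfolding of_real_1 using x by (subst deriv2_zeta_main_1) (auto simp: stieltjes1_eq)
    hence "2 * norm (log_sum (nat \<lfloor>x\<rfloor>) 1 - of_real ((ln x)^2 / 2) + stieltjes1) \<le> C * (1 + ln x)^2 * x powr (-1)"
      using C(2)[OF x] by (simp only: norm_mult norm_numeral)
    thus "norm (log_sum (nat \<lfloor>x\<rfloor>) 1 - of_real ((ln x)^2 / 2) + stieltjes1) \<le> C * (1 + ln x)^2 * x powr (-1)"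
      using norm_ge_zero[of "log_sum (nat \<lfloor>x\<rfloor>) 1 - of_real ((ln x)^2 / 2) + stieltjes1"] by linarith
  qed
qed

section \<open>Expansions at real a other than 1\<close>

lemma zeta_sum_asymp:
  fixes a :: real
  assumes "a \<ge> 1/2" "a \<noteq> 1"
  shows "\<exists>C\<ge>0. \<forall>x\<ge>1. norm (zeta (of_real a) - zeta_sum (nat \<lfloor>x\<rfloor>) (of_real a) - of_real (x powr (1 - a) / (a - 1)))
           \<le> C * x powr (-a)"
proof -
  obtain C where C: "C \<ge> 0" "\<And>x. x \<ge> 1 \<Longrightarrow> norm ((deriv ^^ 0) zeta_reg (of_real a) - (deriv ^^ 0) (zeta_main x) (of_real a))
            \<le> C * (1 + ln x) ^ 0 * x powr (- a)"
    using deriv_zeta_approx_bound[of a 0] assms by auto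
  have ne: "complex_of_real a - 1 \<noteq> 0" using assms by (metis eq_iff_diff_eq_0 of_real_eq_1_iff)
  have na: "norm (complex_of_real a - 1) = \<bar>a - 1\<bar>" by (metis norm_of_real of_real_1 of_real_diff)
  show ?thesis
  proof (intro exI[of _ "C / \<bar>a - 1\<bar>"] conjI allI impI)
    fix x :: real assume x: "x \<ge> 1"
    have "of_real x powr (1 - complex_of_real a) = of_real (x powr (1 - a))"
      using x powr_of_real[of x "1 - a"] by simp
    hence "zeta (of_real a) - zeta_sum (nat \<lfloor>x\<rfloor>) (of_real a) - of_real (x powr (1 - a) / (a - 1))
       = (zeta_reg (of_real a) - zeta_main x (of_real a)) / (of_real a - 1)"
      using ne by (simp add: zeta_def zeta_main_def diff_divide_distrib add_divide_distrib)
    thus "norm (zeta (of_real a) - zeta_sum (nat \<lfloor>x\<rfloor>) (of_real a) - of_real (x powr (1 - a) / (a - 1)))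
           \<le> C / \<bar>a - 1\<bar> * x powr (-a)"
      using C(2)[OF x] assms by (simp add: norm_divide na divide_right_mono)
  qed (use C assms in auto)
qed

lemma zeta_deriv:
  assumes "Re s > 0" "s \<noteq> 1"
  shows "(zeta has_field_derivative deriv zeta s) (at s)"
  using zeta_holomorphic assms
  by (intro holomorphic_derivI[of zeta "{s. Re s > 0} - {1}"]) (auto intro!: open_Diff open_halfspace_Re_gt)

lemma deriv_zeta_reg:
  assumes "Re s > 0" "s \<noteq> 1"
  shows "deriv zeta_reg s = zeta s + (s - 1) * deriv zeta s"
proof -
  have "((\<lambda>s. (s - 1) * zeta s) has_field_derivative zeta s + (s - 1) * deriv zeta s) (at s)"
    using zeta_deriv[OF assms] by (auto intro!: derivative_eq_intros)
  moreover have "\<forall>\<^sub>F z in nhds s. (z - 1) * zeta z = zeta_reg z"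
  proof -
    have "\<forall>\<^sub>F z in nhds s. z \<in> - {1}" using assms by (intro eventually_nhds_in_open) auto
    thus ?thesis by eventually_elim (auto simp: zeta_def)
  qed
  ultimately have "(zeta_reg has_field_derivative zeta s + (s - 1) * deriv zeta s) (at s)"
    by (subst (asm) DERIV_cong_ev[OF refl _ refl]) auto
  thus ?thesis by (rule DERIV_imp_deriv)
qed

text \<open>The first derivative of \<open>zeta_main\<close> contains both \<open>zeta_sum\<close>
  and \<open>log_sum\<close>. Subtracting the expansion of the former isolates a - 1 times the
  latter, and is where the term with (a - 1)^2 in the denominator comes from.\<close>

lemma log_sum_asymp:
  fixes a :: real
  assumes "a \<ge> 1/2" "a \<noteq> 1"
  shows "\<exists>C\<ge>0. \<forall>x\<ge>1. norm (log_sum (nat \<lfloor>x\<rfloor>) (of_real a) + deriv zeta (of_real a)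
             + of_real (x powr (1 - a) * (ln x / (a - 1) + 1 / (a - 1)^2)))
           \<le> C * (1 + ln x) * x powr (-a)"
proof -
  obtain C where C: "C \<ge> 0" "\<And>x. x \<ge> 1 \<Longrightarrow> norm ((deriv ^^ 1) zeta_reg (of_real a) - (deriv ^^ 1) (zeta_main x) (of_real a))
            \<le> C * (1 + ln x) ^ 1 * x powr (- a)"
    using deriv_zeta_approx_bound[of a 1] assms by auto
  obtain C' where C': "C' \<ge> 0" "\<And>x. x \<ge> 1 \<Longrightarrow>
      norm (zeta (of_real a) - zeta_sum (nat \<lfloor>x\<rfloor>) (of_real a) - of_real (x powr (1 - a) / (a - 1))) \<le> C' * x powr (-a)"
    using zeta_sum_asymp[OF assms] by auto
  have ne: "complex_of_real a - 1 \<noteq> 0" "a - 1 \<noteq> 0" "complex_of_real a \<noteq> 1"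
    using assms by simp_all
  have na: "norm (complex_of_real a - 1) = \<bar>a - 1\<bar>" by (metis norm_of_real of_real_1 of_real_diff)
  show ?thesis
  proof (intro exI[of _ "(C + C') / \<bar>a - 1\<bar>"] conjI allI impI)
    fix x :: real assume x: "x \<ge> 1"
    define L where "L = log_sum (nat \<lfloor>x\<rfloor>) (of_real a) + deriv zeta (of_real a)
             + of_real (x powr (1 - a) * (ln x / (a - 1) + 1 / (a - 1)^2))"
    define E1 where "E1 = (deriv ^^ 1) zeta_reg (of_real a) - (deriv ^^ 1) (zeta_main x) (of_real a)"
    define E2 where "E2 = zeta (of_real a) - zeta_sum (nat \<lfloor>x\<rfloor>) (of_real a) - of_real (x powr (1 - a) / (a - 1))"
    have p: "of_real x powr (1 - complex_of_real a) = of_real (x powr (1 - a))"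
      using x powr_of_real[of x "1 - a"] by simp
    have "(of_real a - 1) * complex_of_real (x powr (1 - a) * (ln x / (a - 1) + 1 / (a - 1)^2))
       = of_real ((a - 1) * (x powr (1 - a) * (ln x / (a - 1) + 1 / (a - 1)^2)))" by simp
    also have "(a - 1) * (x powr (1 - a) * (ln x / (a - 1) + 1 / (a - 1)^2)) = x powr (1 - a) * ln x + x powr (1 - a) / (a - 1)"
    proof -
      have "d * (p * (l / d + 1 / d^2)) = p * l + p / d" if "d \<noteq> 0" for d p l :: real
        using that by (simp add: field_simps power2_eq_square)
      thus ?thesis using ne(2) by blast
    qed
    finally have q: "(of_real a - 1) * complex_of_real (x powr (1 - a) * (ln x / (a - 1) + 1 / (a - 1)^2))
       = of_real (x powr (1 - a) * ln x) + of_real (x powr (1 - a) / (a - 1))" by simp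
    have E1: "E1 = zeta (of_real a) + (of_real a - 1) * deriv zeta (of_real a)
         - (zeta_sum (nat \<lfloor>x\<rfloor>) (of_real a) - (of_real a - 1) * log_sum (nat \<lfloor>x\<rfloor>) (of_real a) - of_real (ln x) * of_real (x powr (1 - a)))"
      using x assms ne p by (simp add: E1_def deriv_zeta_main deriv_zeta_reg)
    have L: "(of_real a - 1) * L = (of_real a - 1) * log_sum (nat \<lfloor>x\<rfloor>) (of_real a) + (of_real a - 1) * deriv zeta (of_real a)
        + (of_real (x powr (1 - a) * ln x) + of_real (x powr (1 - a) / (a - 1)))"
    proof -
      have "d * (A + B + W) = d * A + d * B + d * W" for d A B W :: complex by (simp add: algebra_simps)
      thus ?thesis unfolding L_def by (simp only: q)
    qed
    have "(of_real a - 1) * L = E1 - E2"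
      unfolding L E1 E2_def by (simp add: algebra_simps)
    hence "\<bar>a - 1\<bar> * norm L = norm (E1 - E2)" by (metis na norm_mult)
    also have "\<dots> \<le> norm E1 + norm E2" by (rule norm_triangle_ineq4)
    also have "\<dots> \<le> C * (1 + ln x) ^ 1 * x powr (- a) + C' * x powr (-a)"
      unfolding E1_def E2_def using C(2)[OF x] C'(2)[OF x] by (rule add_mono)
    also have "\<dots> \<le> C * (1 + ln x) * x powr (- a) + C' * (1 + ln x) * x powr (-a)"
      using x C' by (intro add_mono mult_right_mono) (auto simp: mult_le_cancel_left1)
    finally have "\<bar>a - 1\<bar> * norm L \<le> (C + C') * (1 + ln x) * x powr (- a)" by (simp add: algebra_simps)
    thus "norm L \<le> (C + C') / \<bar>a - 1\<bar> * (1 + ln x) * x powr (-a)"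
      using ne by (simp add: field_simps)
  qed (use C C' in auto)
qed

lemma deriv_rzeta_eq:
  assumes "Re s > 1"
  shows "deriv rzeta s = deriv zeta s"
proof (rule deriv_cong_ev)
  have "\<forall>\<^sub>F z in nhds s. z \<in> {z. Re z > 1}"
    using assms by (intro eventually_nhds_in_open open_halfspace_Re_gt) auto
  thus "\<forall>\<^sub>F z in nhds s. rzeta z = zeta z" by eventually_elim (auto intro!: rzeta_eq_zeta')
qed simp

section \<open>The hyperbola method\<close>

text \<open>The exponent (b+1)/2 is what remains of the weights on the line Re s = 3/2 when n = m^b
  k; see \<open>line_weight_diagonal\<close>.\<close>

definition weighted_divisor_sum :: "nat \<Rightarrow> real \<Rightarrow> complex" where
  "weighted_divisor_sum b x = (\<Sum>(m,k)\<in>{(m,k). 1 \<le> m \<and> 1 \<le> k \<and> real (m ^ b * k) \<le> x}.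
     of_nat m powr (- of_real ((real b + 1) / 2)) * of_nat k powr (-1))"

lemma nat_floor_eq_atLeastAtMost:
  "{1..nat \<lfloor>x\<rfloor>} = {n. 1 \<le> n \<and> real n \<le> x}"
proof (intro set_eqI iffI)
  fix n assume "n \<in> {n. 1 \<le> n \<and> real n \<le> x}"
  thus "n \<in> {1..nat \<lfloor>x\<rfloor>}" by (auto simp: le_nat_iff le_floor_iff)
next
  fix n assume n: "n \<in> {1..nat \<lfloor>x\<rfloor>}"
  hence "int n \<le> \<lfloor>x\<rfloor>" by (cases "\<lfloor>x\<rfloor> \<ge> 0") auto
  thus "n \<in> {n. 1 \<le> n \<and> real n \<le> x}" using n by (auto simp: le_floor_iff)
qed

text \<open>Because x = Y^(b+1), the same cut-off Y serves m and k. If both exceed Y then m^b k > x,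
  so the two pieces cover everything; if both are at most Y then m^b k \<le> x, so the pieces
  overlap in the full square, over which the sum factorises.\<close>

lemma hyperbola_method:
  fixes b :: nat and Y :: real
  assumes "b \<ge> 1" "Y \<ge> 1"
  defines "x \<equiv> Y powr (real b + 1)" and "a \<equiv> complex_of_real ((real b + 1) / 2)" and "M \<equiv> nat \<lfloor>Y\<rfloor>"
  shows "weighted_divisor_sum b x =
      (\<Sum>m=1..M. of_nat m powr (-a) * zeta_sum (nat \<lfloor>x / real m ^ b\<rfloor>) 1)
    + (\<Sum>k=1..M. of_nat k powr (-1) * zeta_sum (nat \<lfloor>(x / real k) powr (1 / real b)\<rfloor>) a)
    - zeta_sum M a * zeta_sum M 1"
proof -
  define f where "f = (\<lambda>(m,k). of_nat m powr (-a) * of_nat k powr (-1::complex))"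
  define S where "S = {(m,k). 1 \<le> m \<and> 1 \<le> k \<and> real (m ^ b * k) \<le> x}"
  define S1 where "S1 = Sigma {1..M} (\<lambda>m. {1..nat \<lfloor>x / real m ^ b\<rfloor>})"
  define S2 where "S2 = (\<lambda>(k,m). (m,k)) ` Sigma {1..M} (\<lambda>k. {1..nat \<lfloor>(x / real k) powr (1 / real b)\<rfloor>})"
  have xY: "x = Y ^ b * Y" using assms by (simp add: powr_add powr_realpow)
  have S1: "S1 = {(m,k). (m,k) \<in> S \<and> real m \<le> Y}"
    unfolding S1_def S_def M_def nat_floor_eq_atLeastAtMost by (auto simp: field_simps)
  have root: "real m \<le> (x / real k) powr (1 / real b) \<longleftrightarrow> real (m ^ b * k) \<le> x" if "k \<ge> 1" "m \<ge> 1" for m k :: nat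
  proof -
    have y: "x / real k > 0" using assms that by (simp add: x_def)
    have "real m = (real m ^ b) powr (1 / real b)"
      using that assms by (simp add: powr_powr flip: powr_realpow)
    hence "real m \<le> (x / real k) powr (1 / real b) \<longleftrightarrow> (real m ^ b) powr (1 / real b) \<le> (x / real k) powr (1 / real b)"
      by simp
    also have "\<dots> \<longleftrightarrow> real m ^ b \<le> x / real k"
    proof
      assume le: "(real m ^ b) powr (1 / real b) \<le> (x / real k) powr (1 / real b)"
      show "real m ^ b \<le> x / real k"
      proof (rule ccontr)
        assume "\<not> real m ^ b \<le> x / real k"
        hence "(x / real k) powr (1 / real b) < (real m ^ b) powr (1 / real b)"
          using y assms by (intro powr_less_mono2) auto
        with le show False by simp
      qed
    qed (use assms in \<open>auto intro!: powr_mono2\<close>)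
    also have "\<dots> \<longleftrightarrow> real (m ^ b * k) \<le> x" using that by (simp add: field_simps)
    finally show ?thesis .
  qed
  have S2: "S2 = {(m,k). (m,k) \<in> S \<and> real k \<le> Y}"
    unfolding S2_def S_def M_def nat_floor_eq_atLeastAtMost using root by (auto simp: image_iff)
  have S12: "S1 \<inter> S2 = {1..M} \<times> {1..M}"
  proof -
    have "real (m ^ b * k) \<le> x" if "real m \<le> Y" "real k \<le> Y" for m k :: nat
      using that unfolding xY by (auto intro!: mult_mono power_mono)
    thus ?thesis unfolding S1 S2 M_def nat_floor_eq_atLeastAtMost S_def by auto
  qed
  have Sun: "S = S1 \<union> S2"
  proof -
    have "real m \<le> Y \<or> real k \<le> Y" if "real (m ^ b * k) \<le> x" for m k :: nat
    proof (rule ccontr)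
      assume n: "\<not> (real m \<le> Y \<or> real k \<le> Y)"
      hence "Y ^ b * Y < real m ^ b * real k"
        using assms by (intro mult_le_less_imp_less power_mono) auto
      with that show False unfolding xY by simp
    qed
    thus ?thesis unfolding S1 S2 by (auto simp: S_def)
  qed
  have fin: "finite S1" "finite S2" by (auto simp: S1_def S2_def)
  have "weighted_divisor_sum b x = sum f (S1 \<union> S2)"
    unfolding weighted_divisor_sum_def f_def a_def Sun[symmetric] S_def by simp
  also have "\<dots> = sum f S1 + sum f S2 - sum f (S1 \<inter> S2)"
    using fin by (rule sum_Un)
  also have "sum f S1 = (\<Sum>m=1..M. of_nat m powr (-a) * zeta_sum (nat \<lfloor>x / real m ^ b\<rfloor>) 1)"
    unfolding S1_def f_def by (subst sum.Sigma[symmetric]) (auto simp: zeta_sum_def sum_distrib_left)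
  also have "sum f S2 = (\<Sum>k=1..M. of_nat k powr (-1) * zeta_sum (nat \<lfloor>(x / real k) powr (1 / real b)\<rfloor>) a)"
  proof -
    have "sum f S2 = (\<Sum>(k,m)\<in>Sigma {1..M} (\<lambda>k. {1..nat \<lfloor>(x / real k) powr (1 / real b)\<rfloor>}). f (m,k))"
      unfolding S2_def by (subst sum.reindex) (auto simp: inj_on_def intro!: sum.cong)
    also have "\<dots> = (\<Sum>k=1..M. of_nat k powr (-1) * zeta_sum (nat \<lfloor>(x / real k) powr (1 / real b)\<rfloor>) a)"
      by (subst sum.Sigma[symmetric]) (auto simp: f_def zeta_sum_def sum_distrib_left mult.commute)
    finally show ?thesis .
  qed
  also have "sum f (S1 \<inter> S2) = zeta_sum M a * zeta_sum M 1"
    unfolding S12 zeta_sum_def sum_product sum.cartesian_product f_def by simp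
  finally show ?thesis .
qed

lemma norm_of_nat_powr:
  assumes "n \<ge> 1"
  shows "norm (of_nat n powr s :: complex) = real n powr Re s"
  using assms norm_powr_real_powr[of "of_nat n" s] by simp

text \<open>The main term comes from ln (x/m^b) = (b+1) ln Y - b ln m. In the error, m^(b-a) \<le>
  Y^(b-a) because b - a = (b-1)/2 \<ge> 0, so each of the at most Y summands is O((1 + ln Y)
  Y^(-a-1)).\<close>

lemma hyperbola_part1:
  fixes b :: nat
  assumes "b \<ge> 1"
  defines "a \<equiv> (real b + 1) / 2"
  shows "\<exists>C\<ge>0. \<forall>Y\<ge>1. norm ((\<Sum>m=1..nat \<lfloor>Y\<rfloor>. of_nat m powr (- of_real a) * zeta_sum (nat \<lfloor>Y powr (real b + 1) / real m ^ b\<rfloor>) 1)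
      - (of_real ((real b + 1) * ln Y + euler_mascheroni) * zeta_sum (nat \<lfloor>Y\<rfloor>) (of_real a) - of_nat b * log_sum (nat \<lfloor>Y\<rfloor>) (of_real a)))
      \<le> C * (1 + ln Y) * Y powr (-a)"
proof -
  obtain C where C: "C \<ge> 0" "\<And>x. x \<ge> 1 \<Longrightarrow> norm (zeta_sum (nat \<lfloor>x\<rfloor>) 1 - of_real (ln x + euler_mascheroni)) \<le> C * (1 + ln x) * x powr (-1)"
    using zeta_sum_1_asymp by blast
  show ?thesis
  proof (intro exI[of _ "C * (real b + 1)"] conjI allI impI)
    fix Y :: real assume Y: "Y \<ge> 1"
    define x where "x = Y powr (real b + 1)"
    define M where "M = nat \<lfloor>Y\<rfloor>"
    have lnY: "ln Y \<ge> 0" using Y by simp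
    have lnx: "ln x = (real b + 1) * ln Y" using Y by (simp add: x_def ln_powr)
    define e where "e = (\<lambda>m. zeta_sum (nat \<lfloor>x / real m ^ b\<rfloor>) 1 - of_real (ln (x / real m ^ b) + euler_mascheroni))"
    have bnd: "norm (of_nat m powr (- of_real a) * e m) \<le> C * (real b + 1) * (1 + ln Y) * Y powr (- a - 1)" if "m \<in> {1..M}" for m
    proof -
      have m: "m \<ge> 1" "real m \<le> Y" using that unfolding M_def nat_floor_eq_atLeastAtMost by auto
      have mb: "real m ^ b = real m powr real b" using m by (simp add: powr_realpow)
      have "real m powr real b \<le> Y powr (real b + 1)"
        using m Y by (intro order_trans[OF powr_mono2 powr_mono]) auto
      hence y: "x / real m ^ b \<ge> 1" using m by (simp add: x_def mb)
      have "ln (x / real m ^ b) = ln x - real b * ln (real m)"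
        using m Y by (subst ln_divide_pos) (auto simp: x_def ln_realpow)
      also have "\<dots> \<le> (real b + 1) * ln Y" using m by (simp add: lnx)
      also have "1 + \<dots> \<le> (real b + 1) * (1 + ln Y)" by (simp add: algebra_simps)
      finally have l: "1 + ln (x / real m ^ b) \<le> (real b + 1) * (1 + ln Y)" by simp
      have "norm (e m) \<le> C * (1 + ln (x / real m ^ b)) * (x / real m ^ b) powr (-1)"
        unfolding e_def by (rule C(2)[OF y])
      also have "\<dots> \<le> C * ((real b + 1) * (1 + ln Y)) * (x / real m ^ b) powr (-1)"
        using C l by (intro mult_right_mono mult_left_mono) auto
      also have "(x / real m ^ b) powr (-1) = real m powr real b * Y powr (- real b - 1)"
      proof -
        have "(x / real m ^ b) powr (-1) = real m powr real b * inverse (Y powr (real b + 1))"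
          using y by (simp add: powr_minus x_def mb divide_inverse)
        also have "inverse (Y powr (real b + 1)) = Y powr (- (real b + 1))" by (rule powr_minus[symmetric])
        finally show ?thesis by simp
      qed
      finally have ne: "norm (e m) \<le> C * ((real b + 1) * (1 + ln Y)) * (real m powr real b * Y powr (- real b - 1))" .
      have "norm (of_nat m powr (- of_real a) * e m) = real m powr (-a) * norm (e m)"
        using m by (simp add: norm_mult norm_of_nat_powr)
      also have "\<dots> \<le> real m powr (-a) * (C * ((real b + 1) * (1 + ln Y)) * (real m powr real b * Y powr (- real b - 1)))"
        by (intro mult_left_mono ne) auto
      also have "\<dots> = C * (real b + 1) * (1 + ln Y) * Y powr (- real b - 1) * real m powr (real b - a)"
        using m by (simp add: powr_diff powr_minus field_simps)
      also have "\<dots> \<le> C * (real b + 1) * (1 + ln Y) * Y powr (- real b - 1) * Y powr (real b - a)"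
        using C lnY m assms by (intro mult_left_mono powr_mono2 mult_nonneg_nonneg) (auto simp: a_def)
      also have "Y powr (- real b - 1) * Y powr (real b - a) = Y powr (- a - 1)"
      proof -
        have e: "(- real b - 1) + (real b - a) = - a - 1" by simp
        show ?thesis unfolding powr_add[symmetric] e ..
      qed
      hence "C * (real b + 1) * (1 + ln Y) * Y powr (- real b - 1) * Y powr (real b - a) = C * (real b + 1) * (1 + ln Y) * Y powr (- a - 1)"
        by (simp only: mult.assoc)
      finally show ?thesis .
    qed
    have "(\<Sum>m=1..M. of_nat m powr (- of_real a) * zeta_sum (nat \<lfloor>x / real m ^ b\<rfloor>) 1)
       = (\<Sum>m=1..M. of_nat m powr (- of_real a) * e m + (of_real ((real b + 1) * ln Y + euler_mascheroni) * of_nat m powr (- of_real a)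
             - of_nat b * (of_real (ln (real m)) * of_nat m powr (- of_real a))))"
    proof (intro sum.cong refl)
      fix m assume "m \<in> {1..M}"
      hence lx: "ln (x / real m ^ b) = (real b + 1) * ln Y - real b * ln (real m)"
        using Y unfolding lnx[symmetric] by (subst ln_divide_pos) (auto simp: x_def ln_realpow)
      show "of_nat m powr (- of_real a) * zeta_sum (nat \<lfloor>x / real m ^ b\<rfloor>) 1
         = of_nat m powr (- of_real a) * e m + (of_real ((real b + 1) * ln Y + euler_mascheroni) * of_nat m powr (- of_real a)
             - of_nat b * (of_real (ln (real m)) * of_nat m powr (- of_real a)))"
        unfolding e_def lx by (simp add: algebra_simps)
    qed
    also have "\<dots> = (\<Sum>m=1..M. of_nat m powr (- of_real a) * e m) +
        (of_real ((real b + 1) * ln Y + euler_mascheroni) * zeta_sum M (of_real a) - of_nat b * log_sum M (of_real a))"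
      by (simp add: zeta_sum_def log_sum_def sum.distrib sum_subtractf sum_distrib_left)
    finally have "(\<Sum>m=1..M. of_nat m powr (- of_real a) * zeta_sum (nat \<lfloor>x / real m ^ b\<rfloor>) 1)
      - (of_real ((real b + 1) * ln Y + euler_mascheroni) * zeta_sum M (of_real a) - of_nat b * log_sum M (of_real a))
      = (\<Sum>m=1..M. of_nat m powr (- of_real a) * e m)" by simp
    also have "norm \<dots> \<le> (\<Sum>m=1..M. C * (real b + 1) * (1 + ln Y) * Y powr (- a - 1))"
      by (intro sum_norm_le bnd)
    also have "\<dots> = real M * (C * (real b + 1) * (1 + ln Y) * Y powr (- a - 1))" by simp
    also have "\<dots> \<le> Y * (C * (real b + 1) * (1 + ln Y) * Y powr (- a - 1))"
      using C lnY Y by (intro mult_right_mono mult_nonneg_nonneg) (auto simp: M_def)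
    also have "\<dots> = C * (real b + 1) * (1 + ln Y) * Y powr (- a)"
      using Y by (simp add: powr_diff)
    finally show "norm ((\<Sum>m=1..nat \<lfloor>Y\<rfloor>. of_nat m powr (- of_real a) * zeta_sum (nat \<lfloor>Y powr (real b + 1) / real m ^ b\<rfloor>) 1)
      - (of_real ((real b + 1) * ln Y + euler_mascheroni) * zeta_sum (nat \<lfloor>Y\<rfloor>) (of_real a) - of_nat b * log_sum (nat \<lfloor>Y\<rfloor>) (of_real a)))
      \<le> C * (real b + 1) * (1 + ln Y) * Y powr (-a)"
      by (simp add: M_def x_def)
  qed (use C in auto)
qed

lemma harm_le_one_plus_ln:
  assumes "Y \<ge> 1"
  shows "(\<Sum>k=1..nat \<lfloor>Y\<rfloor>. 1 / real k) \<le> 1 + ln Y"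
proof -
  have "(\<Sum>k=1..Suc n. 1 / real k) \<le> 1 + ln (real (Suc n))" for n
  proof (induction n)
    case (Suc n)
    have "1 / (real (Suc n) + 1) \<le> ln (real (Suc (Suc n))) - ln (real (Suc n))"
      by (rule ln_Suc_minus_ln) auto
    moreover have "(\<Sum>k=1..Suc (Suc n). 1 / real k) = (\<Sum>k=1..Suc n. 1 / real k) + 1 / (real (Suc n) + 1)" by simp
    ultimately show ?case using Suc by linarith
  qed auto
  from this[of "nat \<lfloor>Y\<rfloor> - 1"] have "(\<Sum>k=1..nat \<lfloor>Y\<rfloor>. 1 / real k) \<le> 1 + ln (real (nat \<lfloor>Y\<rfloor>))"
    using assms by (simp add: Suc_diff_le)
  also have "ln (real (nat \<lfloor>Y\<rfloor>)) \<le> ln Y" using assms by (subst ln_le_cancel_iff) auto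
  finally show ?thesis by simp
qed

text \<open>The inner sums run up to y = (x/k)^(1/b), and y^(1-a) = x^(-\<beta>) k^\<beta> because
  (a-1)/b = \<beta>; together with 1/k this produces a second sum, of exponent 1 - \<beta>. Since y
  \<ge> Y, the inner errors are O(Y^(-a)), and the harmonic sum over k contributes the
  logarithm.\<close>

lemma hyperbola_part2:
  fixes b :: nat
  assumes "b > 1"
  defines "a \<equiv> (real b + 1) / 2" and "\<beta> \<equiv> 1/2 - 1 / (2 * real b)"
  shows "\<exists>C\<ge>0. \<forall>Y\<ge>1. norm ((\<Sum>k=1..nat \<lfloor>Y\<rfloor>. of_nat k powr (-1) * zeta_sum (nat \<lfloor>(Y powr (real b + 1) / real k) powr (1 / real b)\<rfloor>) (of_real a))
      - (zeta (of_real a) * zeta_sum (nat \<lfloor>Y\<rfloor>) 1 - of_real (Y powr (- (real b + 1) * \<beta>) / (a - 1)) * zeta_sum (nat \<lfloor>Y\<rfloor>) (of_real (1 - \<beta>))))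
      \<le> C * (1 + ln Y) * Y powr (-a)"
proof -
  have a: "a > 1" "a \<ge> 1/2" "a \<noteq> 1" using assms by (auto simp: a_def)
  have b0: "real b > 0" using assms by simp
  obtain C where C: "C \<ge> 0" "\<And>x. x \<ge> 1 \<Longrightarrow>
      norm (zeta (of_real a) - zeta_sum (nat \<lfloor>x\<rfloor>) (of_real a) - of_real (x powr (1 - a) / (a - 1))) \<le> C * x powr (-a)"
    using zeta_sum_asymp[OF a(2,3)] by blast
  show ?thesis
  proof (intro exI[of _ C] conjI allI impI C(1))
    fix Y :: real assume Y: "Y \<ge> 1"
    define x where "x = Y powr (real b + 1)"
    define M where "M = nat \<lfloor>Y\<rfloor>"
    define y where "y = (\<lambda>k. (x / real k) powr (1 / real b))"
    define e where "e = (\<lambda>k. zeta (of_real a) - zeta_sum (nat \<lfloor>y k\<rfloor>) (of_real a) - of_real (y k powr (1 - a) / (a - 1)))"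
    have lnY: "ln Y \<ge> 0" using Y by simp
    have x0: "x > 0" using Y by (simp add: x_def)
    have yp: "y k powr r = x powr (r / real b) * real k powr (- (r / real b))" if "k \<ge> 1" for k r
      using that x0 by (simp add: y_def powr_powr powr_divide powr_minus_divide)
    have bnd: "norm (of_nat k powr (-1) * e k) \<le> C * Y powr (-a) * (1 / real k)" if "k \<in> {1..M}" for k
    proof -
      have k: "k \<ge> 1" "real k \<le> Y" using that unfolding M_def nat_floor_eq_atLeastAtMost by auto
      have "Y powr 1 \<le> x" unfolding x_def using Y by (intro powr_mono) auto
      hence "x / real k \<ge> 1" using k Y by (simp add: field_simps)
      hence y1: "y k \<ge> 1" unfolding y_def using b0 by (intro ge_one_powr_ge_zero) auto
      have "norm (e k) \<le> C * y k powr (-a)" unfolding e_def by (rule C(2)[OF y1])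
      also have "y k powr (-a) = x powr (- a / real b) * real k powr (a / real b)"
        using k by (subst yp) auto
      also have "\<dots> \<le> x powr (- a / real b) * Y powr (a / real b)"
        using k a b0 by (intro mult_left_mono powr_mono2) auto
      also have "\<dots> = Y powr ((real b + 1) * (- a / real b) + a / real b)"
        unfolding x_def powr_powr by (rule powr_add[symmetric])
      also have "(real b + 1) * (- a / real b) + a / real b = -a" using b0 by (simp add: field_simps)
      finally have "norm (e k) \<le> C * Y powr (-a)" using C by (simp add: mult_left_mono)
      moreover have "norm (of_nat k powr (-1) :: complex) = 1 / real k"
        using k by (simp add: norm_of_nat_powr powr_minus_divide norm_divide)
      ultimately show ?thesis using mult_right_mono[of "norm (e k)" "C * Y powr (-a)" "1 / real k"]
        by (simp add: norm_mult mult.commute)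
    qed
    have ex: "(1 - a) / real b = - \<beta>" using b0 by (simp add: a_def \<beta>_def field_simps)
    have xb: "x powr (- \<beta>) = Y powr (- (real b + 1) * \<beta>)"
      unfolding x_def powr_powr by (rule arg_cong[of _ _ "(powr) Y"]) (simp add: algebra_simps)
    have "(\<Sum>k=1..M. of_nat k powr (-1) * zeta_sum (nat \<lfloor>y k\<rfloor>) (of_real a))
      = (\<Sum>k=1..M. zeta (of_real a) * of_nat k powr (-1) - of_real (Y powr (- (real b + 1) * \<beta>) / (a - 1)) * of_nat k powr (- of_real (1 - \<beta>))
            - of_nat k powr (-1) * e k)"
    proof (intro sum.cong refl)
      fix k assume "k \<in> {1..M}"
      hence k: "k \<ge> 1" by simp
      have "y k powr (1 - a) = Y powr (- (real b + 1) * \<beta>) * real k powr \<beta>"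
        unfolding yp[OF k] ex xb by simp
      moreover have "of_nat k powr (-1) * complex_of_real (real k powr \<beta>) = of_nat k powr (- of_real (1 - \<beta>))"
      proof -
        have "of_nat k powr (- complex_of_real (1 - \<beta>)) = of_nat k powr (-1 + complex_of_real \<beta>)" by simp
        also have "\<dots> = of_nat k powr (-1) * of_nat k powr (complex_of_real \<beta>)" by (rule powr_add)
        also have "of_nat k powr (complex_of_real \<beta>) = complex_of_real (real k powr \<beta>)"
          using powr_of_real[of "real k" \<beta>] by simp
        finally show ?thesis by simp
      qed
      ultimately have "of_nat k powr (-1) * complex_of_real (y k powr (1 - a) / (a - 1))
          = of_real (Y powr (- (real b + 1) * \<beta>) / (a - 1)) * of_nat k powr (- of_real (1 - \<beta>))"
        by (simp add: mult_ac)
      thus "of_nat k powr (-1) * zeta_sum (nat \<lfloor>y k\<rfloor>) (of_real a) = zeta (of_real a) * of_nat k powr (-1) - of_real (Y powr (- (real b + 1) * \<beta>) / (a - 1)) * of_nat k powr (- of_real (1 - \<beta>))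
            - of_nat k powr (-1) * e k"
        unfolding e_def right_diff_distrib by simp
    qed
    also have "\<dots> = (zeta (of_real a) * zeta_sum M 1 - of_real (Y powr (- (real b + 1) * \<beta>) / (a - 1)) * zeta_sum M (of_real (1 - \<beta>)))
         - (\<Sum>k=1..M. of_nat k powr (-1) * e k)"
      unfolding zeta_sum_def sum_distrib_left sum_subtractf ..
    finally have "(\<Sum>k=1..M. of_nat k powr (-1) * zeta_sum (nat \<lfloor>y k\<rfloor>) (of_real a))
        - (zeta (of_real a) * zeta_sum M 1 - of_real (Y powr (- (real b + 1) * \<beta>) / (a - 1)) * zeta_sum M (of_real (1 - \<beta>)))
        = - (\<Sum>k=1..M. of_nat k powr (-1) * e k)" by simp
    also have "norm \<dots> \<le> (\<Sum>k=1..M. C * Y powr (-a) * (1 / real k))"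
      unfolding norm_minus_cancel by (intro sum_norm_le bnd)
    also have "\<dots> = C * Y powr (-a) * (\<Sum>k=1..M. 1 / real k)" by (rule sum_distrib_left[symmetric])
    also have "\<dots> \<le> C * Y powr (-a) * (1 + ln Y)"
      unfolding M_def using C Y by (intro mult_left_mono harm_le_one_plus_ln) auto
    finally show "norm ((\<Sum>k=1..nat \<lfloor>Y\<rfloor>. of_nat k powr (-1) * zeta_sum (nat \<lfloor>(Y powr (real b + 1) / real k) powr (1 / real b)\<rfloor>) (of_real a))
      - (zeta (of_real a) * zeta_sum (nat \<lfloor>Y\<rfloor>) 1 - of_real (Y powr (- (real b + 1) * \<beta>) / (a - 1)) * zeta_sum (nat \<lfloor>Y\<rfloor>) (of_real (1 - \<beta>))))
      \<le> C * (1 + ln Y) * Y powr (-a)"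
      by (simp add: M_def x_def y_def mult_ac)
  qed
qed

lemma weighted_divisor_sum_asymp_1:
  "\<exists>C\<ge>0. \<forall>x\<ge>1. norm (weighted_divisor_sum 1 x
      - (of_real ((ln x)^2 / 2 + 2 * euler_mascheroni * ln x + euler_mascheroni^2) + 2 * stieltjes1))
      \<le> C * (1 + ln x)^2 * x powr (-1/2)"
proof -
  obtain C1 where C1: "C1 \<ge> 0" "\<And>Y. Y \<ge> 1 \<Longrightarrow> norm ((\<Sum>m=1..nat \<lfloor>Y\<rfloor>. of_nat m powr (-1) * zeta_sum (nat \<lfloor>Y powr 2 / real m\<rfloor>) 1)
      - (of_real (2 * ln Y + euler_mascheroni) * zeta_sum (nat \<lfloor>Y\<rfloor>) 1 - log_sum (nat \<lfloor>Y\<rfloor>) 1))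
      \<le> C1 * (1 + ln Y) * Y powr (-1)"
    using hyperbola_part1[of 1] by (auto simp: one_add_one)
  obtain C2 where C2: "C2 \<ge> 0" "\<And>x. x \<ge> 1 \<Longrightarrow> norm (zeta_sum (nat \<lfloor>x\<rfloor>) 1 - of_real (ln x + euler_mascheroni)) \<le> C2 * (1 + ln x) * x powr (-1)"
    using zeta_sum_1_asymp by blast
  obtain C3 where C3: "C3 \<ge> 0" "\<And>x. x \<ge> 1 \<Longrightarrow> norm (log_sum (nat \<lfloor>x\<rfloor>) 1 - of_real ((ln x)^2 / 2) + stieltjes1) \<le> C3 * (1 + ln x)^2 * x powr (-1)"
    using log_sum_1_asymp by blast
  have "norm (weighted_divisor_sum 1 x
      - (of_real ((ln x)^2 / 2 + 2 * euler_mascheroni * ln x + euler_mascheroni^2) + 2 * stieltjes1))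
      \<le> (2 * C1 + 2 * C2 + C2^2 + 2 * C3) * (1 + ln x)^2 * x powr (-1/2)" if x: "x \<ge> 1" for x :: real
  proof -
    define Y where "Y = sqrt x"
    have Y: "Y \<ge> 1" using x by (simp add: Y_def)
    have xY: "x = Y powr 2" using x Y by (simp add: Y_def)
    define l where "l = ln Y"
    have l: "l \<ge> 0" using Y by (simp add: l_def)
    have lnx: "ln x = 2 * l" unfolding xY l_def by (rule ln_powr)
    have l2: "1 + l \<le> (1 + l)^2" using l by (simp add: power2_eq_square)
    define u where "u = Y powr (-1)"
    have u: "0 \<le> u" "u \<le> 1" using Y by (auto simp: u_def powr_minus field_simps)
    define P where "P = (\<Sum>m=1..nat \<lfloor>Y\<rfloor>. of_nat m powr (-1) * zeta_sum (nat \<lfloor>Y powr 2 / real m\<rfloor>) 1)"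
    define H where "H = zeta_sum (nat \<lfloor>Y\<rfloor>) 1"
    define L where "L = log_sum (nat \<lfloor>Y\<rfloor>) 1"
    define g :: complex where "g = of_real euler_mascheroni"
    define E1 where "E1 = P - (of_real (2 * l + euler_mascheroni) * H - L)"
    define eH where "eH = H - of_real (l + euler_mascheroni)"
    define eL where "eL = L - of_real (l^2 / 2) + stieltjes1"
    have bE1: "norm E1 \<le> C1 * (1 + l) * u" using C1(2)[OF Y] by (simp add: E1_def P_def H_def L_def l_def u_def)
    have beH: "norm eH \<le> C2 * (1 + l) * u" using C2(2)[OF Y] by (simp add: eH_def H_def l_def u_def)
    have beL: "norm eL \<le> C3 * (1 + l)^2 * u" using C3(2)[OF Y] by (simp add: eL_def L_def l_def u_def)
    \<comment> \<open>For b = 1 the two halves of the hyperbola coincide.\<close>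
    have "weighted_divisor_sum 1 x = P + P - H * H"
    proof -
      have "(Y powr 2 / real k) powr 1 = Y powr 2 / real k" for k by simp
      thus ?thesis using hyperbola_method[of 1 Y] Y by (simp add: P_def H_def xY one_add_one)
    qed
    also have "\<dots> - (of_real ((ln x)^2 / 2 + 2 * euler_mascheroni * ln x + euler_mascheroni^2) + 2 * stieltjes1)
        = 2 * E1 + 2 * of_real l * eH - eH * eH - 2 * eL"
    proof -
      \<comment> \<open>Once P, H and L are expressed through their errors, the main terms match and
        what is left has size Y^(-1) = x^(-1/2), up to logarithms.\<close>
      have P: "P = E1 + ((2 * of_real l + g) * H - L)" and H: "H = eH + of_real l + g"
        and L: "L = eL + of_real l * of_real l / 2 - stieltjes1"
        by (simp_all add: E1_def eH_def eL_def g_def power2_eq_square)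
      have m: "of_real ((ln x)^2 / 2 + 2 * euler_mascheroni * ln x + euler_mascheroni^2)
          = 2 * of_real l * of_real l + 4 * g * of_real l + g * g"
        by (simp add: lnx g_def power2_eq_square)
      show ?thesis unfolding m P unfolding L H by (simp add: algebra_simps)
    qed
    also have "norm \<dots> \<le> norm (2 * E1) + norm (2 * of_real l * eH) + norm (eH * eH) + norm (2 * eL)"
    proof -
      have "norm (A1 + A2 - A3 - A4) \<le> norm A1 + norm A2 + norm A3 + norm A4" for A1 A2 A3 A4 :: complex
        using norm_triangle_ineq4[of "A1 + A2 - A3" A4] norm_triangle_ineq4[of "A1 + A2" A3] norm_triangle_ineq[of A1 A2]
        by linarith
      thus ?thesis .
    qed
    also have "\<dots> = 2 * norm E1 + 2 * l * norm eH + norm eH * norm eH + 2 * norm eL"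
      using l by (simp add: norm_mult)
    also have "\<dots> \<le> 2 * (C1 * (1 + l) * u) + 2 * l * (C2 * (1 + l) * u) + (C2 * (1 + l) * u) * (C2 * (1 + l) * u) + 2 * (C3 * (1 + l)^2 * u)"
      using l C2 u by (intro add_mono mult_mono bE1 beH beL) auto
    also have "\<dots> \<le> (2 * C1 + 2 * C2 + C2^2 + 2 * C3) * (1 + l)^2 * u"
    proof -
      have "2 * (C1 * (1 + l) * u) \<le> 2 * (C1 * (1 + l)^2 * u)"
        using C1 u l2 by (intro mult_left_mono mult_right_mono) auto
      moreover have "2 * l * (C2 * (1 + l) * u) \<le> 2 * (1 + l) * (C2 * (1 + l) * u)"
        using C2 u l by (intro mult_right_mono) auto
      moreover have "(C2 * (1 + l) * u) * (C2 * (1 + l) * u) \<le> (C2 * (1 + l) * u) * (C2 * (1 + l) * 1)"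
        using C2 u l by (intro mult_left_mono) auto
      ultimately show ?thesis by (simp add: power2_eq_square algebra_simps)
    qed
    also have "\<dots> \<le> (2 * C1 + 2 * C2 + C2^2 + 2 * C3) * (1 + ln x)^2 * u"
      using C1 C2 C3 u l lnx by (intro mult_right_mono mult_left_mono power_mono) auto
    also have "u = x powr (-1/2)" unfolding u_def xY powr_powr by simp
    finally show ?thesis .
  qed
  thus ?thesis using C1 C2 C3 by (intro exI[of _ "2 * C1 + 2 * C2 + C2^2 + 2 * C3"]) auto
qed

text \<open>The main terms are the residues at w = 0 and w = -\<beta> of the generating function
  zeta(bw + a) zeta(w+1) x^w / w. Expanding at the cut-off Y introduces further terms of order
  Y^(1-a), up to logarithms, which exceed the target Y^(-a) = x^(-1/2); they have to cancel
  identically.\<close>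

lemma weighted_divisor_sum_asymp:
  fixes b :: nat
  assumes "b > 1"
  defines "a \<equiv> (real b + 1) / 2" and "\<beta> \<equiv> 1/2 - 1 / (2 * real b)"
  shows "\<exists>C\<ge>0. \<forall>x\<ge>1. norm (weighted_divisor_sum b x
      - (zeta (of_real a) * of_real (ln x + euler_mascheroni) + of_nat b * deriv zeta (of_real a)
          - of_real (x powr (- \<beta>) / (a - 1)) * zeta (of_real (1 - \<beta>))))
      \<le> C * (1 + ln x)^2 * x powr (-1/2)"
proof -
  have a: "a > 1" "a \<ge> 1/2" "a \<noteq> 1" using assms by (auto simp: a_def)
  have b0: "real b > 1" "b \<ge> 1" using assms by auto
  have \<beta>: "0 < \<beta>" "\<beta> \<le> 1/2" "b * \<beta> = a - 1" using b0 by (auto simp: \<beta>_def a_def field_simps)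
  have \<beta>': "1 - \<beta> \<ge> 1/2" "1 - \<beta> \<noteq> 1" using \<beta> by auto
  obtain C1 where C1: "C1 \<ge> 0" "\<And>Y. Y \<ge> 1 \<Longrightarrow> norm ((\<Sum>m=1..nat \<lfloor>Y\<rfloor>. of_nat m powr (- of_real a) * zeta_sum (nat \<lfloor>Y powr (real b + 1) / real m ^ b\<rfloor>) 1)
      - (of_real ((real b + 1) * ln Y + euler_mascheroni) * zeta_sum (nat \<lfloor>Y\<rfloor>) (of_real a) - of_nat b * log_sum (nat \<lfloor>Y\<rfloor>) (of_real a)))
      \<le> C1 * (1 + ln Y) * Y powr (-a)"
    using hyperbola_part1[OF b0(2)] unfolding a_def by blast
  obtain C2 where C2: "C2 \<ge> 0" "\<And>Y. Y \<ge> 1 \<Longrightarrow> norm ((\<Sum>k=1..nat \<lfloor>Y\<rfloor>. of_nat k powr (-1) * zeta_sum (nat \<lfloor>(Y powr (real b + 1) / real k) powr (1 / real b)\<rfloor>) (of_real a))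
      - (zeta (of_real a) * zeta_sum (nat \<lfloor>Y\<rfloor>) 1 - of_real (Y powr (- (real b + 1) * \<beta>) / (a - 1)) * zeta_sum (nat \<lfloor>Y\<rfloor>) (of_real (1 - \<beta>))))
      \<le> C2 * (1 + ln Y) * Y powr (-a)"
    using hyperbola_part2[OF assms(1)] unfolding a_def \<beta>_def by blast
  obtain CS where CS: "CS \<ge> 0" "\<And>x. x \<ge> 1 \<Longrightarrow>
      norm (zeta (of_real a) - zeta_sum (nat \<lfloor>x\<rfloor>) (of_real a) - of_real (x powr (1 - a) / (a - 1))) \<le> CS * x powr (-a)"
    using zeta_sum_asymp[OF a(2,3)] by blast
  obtain CV where CV: "CV \<ge> 0" "\<And>x. x \<ge> 1 \<Longrightarrow>
      norm (zeta (of_real (1 - \<beta>)) - zeta_sum (nat \<lfloor>x\<rfloor>) (of_real (1 - \<beta>)) - of_real (x powr (1 - (1 - \<beta>)) / ((1 - \<beta>) - 1))) \<le> CV * x powr (-(1 - \<beta>))"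
    using zeta_sum_asymp[OF \<beta>'] by blast
  obtain CH where CH: "CH \<ge> 0" "\<And>x. x \<ge> 1 \<Longrightarrow> norm (zeta_sum (nat \<lfloor>x\<rfloor>) 1 - of_real (ln x + euler_mascheroni)) \<le> CH * (1 + ln x) * x powr (-1)"
    using zeta_sum_1_asymp by blast
  obtain CL where CL: "CL \<ge> 0" "\<And>x. x \<ge> 1 \<Longrightarrow> norm (log_sum (nat \<lfloor>x\<rfloor>) (of_real a) + deriv zeta (of_real a)
             + of_real (x powr (1 - a) * (ln x / (a - 1) + 1 / (a - 1)^2))) \<le> CL * (1 + ln x) * x powr (-a)"
    using log_sum_asymp[OF a(2,3)] by blast
  define K where "K = C1 + C2 + (CS + 1 / (a - 1)) * CH + real b * CS + real b * CL + CV / (a - 1)"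
  have K: "K \<ge> 0" using C1 C2 CS CV CH CL a b0 by (auto simp: K_def)
  have "norm (weighted_divisor_sum b x
      - (zeta (of_real a) * of_real (ln x + euler_mascheroni) + of_nat b * deriv zeta (of_real a)
          - of_real (x powr (- \<beta>) / (a - 1)) * zeta (of_real (1 - \<beta>))))
      \<le> K * (1 + ln x)^2 * x powr (-1/2)" if x: "x \<ge> 1" for x :: real
  proof -
    define Y where "Y = x powr (1 / (real b + 1))"
    have Y: "Y \<ge> 1" unfolding Y_def using x b0 by (intro ge_one_powr_ge_zero) auto
    have xY: "x = Y powr (real b + 1)" using x b0 by (simp add: Y_def powr_powr)
    define l where "l = ln Y"
    have l: "l \<ge> 0" using Y by (simp add: l_def)
    have lnx: "ln x = (real b + 1) * l" using Y by (simp add: l_def xY ln_powr)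
    define u where "u = Y powr (-a)"
    have u: "0 \<le> u" by (simp add: u_def)
    define P1 where "P1 = (\<Sum>m=1..nat \<lfloor>Y\<rfloor>. of_nat m powr (- of_real a) * zeta_sum (nat \<lfloor>Y powr (real b + 1) / real m ^ b\<rfloor>) 1)"
    define P2 where "P2 = (\<Sum>k=1..nat \<lfloor>Y\<rfloor>. of_nat k powr (-1) * zeta_sum (nat \<lfloor>(Y powr (real b + 1) / real k) powr (1 / real b)\<rfloor>) (of_real a))"
    define S where "S = zeta_sum (nat \<lfloor>Y\<rfloor>) (of_real a)"
    define H where "H = zeta_sum (nat \<lfloor>Y\<rfloor>) 1"
    define V where "V = zeta_sum (nat \<lfloor>Y\<rfloor>) (of_real (1 - \<beta>))"
    define L where "L = log_sum (nat \<lfloor>Y\<rfloor>) (of_real a)"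
    define Z where "Z = zeta (of_real a)"
    define Z' where "Z' = deriv zeta (of_real a)"
    define ZV where "ZV = zeta (of_real (1 - \<beta>))"
    define g :: complex where "g = of_real euler_mascheroni"
    define B :: complex where "B = of_nat b"
    define lc :: complex where "lc = of_real l"
    define p where "p = Y powr (1 - a) / (a - 1)"
    define q where "q = Y powr (- (real b + 1) * \<beta>) / (a - 1)"
    define E1 where "E1 = P1 - (((B + 1) * lc + g) * S - B * L)"
    define E2 where "E2 = P2 - (Z * H - of_real q * V)"
    define eS where "eS = Z - S - of_real p"
    define eH where "eH = H - (lc + g)"
    define eL where "eL = L + Z' + of_real (p * l + p / (a - 1))"
    define eV where "eV = ZV - V - of_real (Y powr \<beta> / (-\<beta>))"
    have bE1: "norm E1 \<le> C1 * (1 + l) * u"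
      using C1(2)[OF Y] by (simp add: E1_def P1_def S_def L_def l_def u_def B_def lc_def g_def)
    have bE2: "norm E2 \<le> C2 * (1 + l) * u"
      using C2(2)[OF Y] by (simp add: E2_def P2_def Z_def H_def V_def q_def l_def u_def)
    have beS: "norm eS \<le> CS * u" using CS(2)[OF Y] by (simp add: eS_def Z_def S_def p_def u_def)
    have beH: "norm eH \<le> CH * (1 + l) * Y powr (-1)"
      using CH(2)[OF Y] by (simp add: eH_def H_def lc_def l_def g_def)
    have peq: "p * l + p / (a - 1) = Y powr (1 - a) * (ln Y / (a - 1) + 1 / (a - 1)^2)"
      using a by (simp add: p_def l_def field_simps power2_eq_square)
    have beL: "norm eL \<le> CL * (1 + l) * u"
      using CL(2)[OF Y] unfolding eL_def peq by (simp only: L_def Z'_def l_def u_def)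
    have beV: "norm eV \<le> CV * Y powr (\<beta> - 1)"
      using CV(2)[OF Y] by (simp add: eV_def ZV_def V_def)
    \<comment> \<open>One half of that cancellation: the boundary term of the sum with exponent 1 -
      \<beta> equals b times the term p/(a - 1) of the logarithmic sum. The other terms in p cancel
      between P1 and the product S * H, except for p * eH.\<close>
    have pq: "q * (Y powr \<beta> / \<beta>) = real b * (p / (a - 1))"
    proof -
      have e: "- (real b + 1) * \<beta> + \<beta> = 1 - a" using \<beta>(3) by (simp add: algebra_simps)
      have "Y powr (- (real b + 1) * \<beta>) * Y powr \<beta> = Y powr (1 - a)"
        unfolding powr_add[symmetric] e ..
      hence "q * (Y powr \<beta> / \<beta>) = p / \<beta>" by (simp add: q_def p_def)
      also have "\<dots> = real b * p / (real b * \<beta>)" using b0 by simp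
      finally show ?thesis by (simp add: \<beta>(3))
    qed
    have "weighted_divisor_sum b x = P1 + P2 - S * H"
      using hyperbola_method[OF b0(2) Y] unfolding xY[symmetric]
      by (simp add: P1_def P2_def S_def H_def a_def xY)
    also have "\<dots> - (zeta (of_real a) * of_real (ln x + euler_mascheroni) + of_nat b * deriv zeta (of_real a)
          - of_real (x powr (- \<beta>) / (a - 1)) * zeta (of_real (1 - \<beta>)))
        = E1 + E2 + (eS + of_real p) * eH - B * lc * eS - B * eL + of_real q * eV"
    proof -
      have qx: "x powr (- \<beta>) / (a - 1) = q"
      proof -
        have e: "(real b + 1) * (- \<beta>) = - (real b + 1) * \<beta>" by (simp add: algebra_simps)
        show ?thesis unfolding q_def xY powr_powr e ..
      qed
      have lx: "of_real (ln x + euler_mascheroni) = (B + 1) * lc + g"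
        by (simp add: lnx B_def lc_def g_def)
      have pq': "of_real q * complex_of_real (Y powr \<beta> / \<beta>) = B * of_real (p / (a - 1))"
      proof -
        have "of_real q * complex_of_real (Y powr \<beta> / \<beta>) = of_real (q * (Y powr \<beta> / \<beta>))"
          by (simp only: of_real_mult)
        thus ?thesis unfolding pq by (simp only: of_real_mult of_real_of_nat_eq B_def)
      qed
      define W where "W = complex_of_real (Y powr \<beta> / \<beta>)"
      define pa where "pa = complex_of_real (p / (a - 1))"
      have V: "V = ZV - eV + W" by (simp add: eV_def W_def)
      have L: "L = eL - Z' - of_real p * lc - pa" by (simp add: eL_def lc_def pa_def)
      have S: "S = Z - eS - of_real p" by (simp add: eS_def)
      have H: "H = eH + lc + g" by (simp add: eH_def)
      have P1: "P1 = E1 + (((B + 1) * lc + g) * S - B * L)" and P2: "P2 = E2 + (Z * H - of_real q * V)"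
        by (simp_all add: E1_def E2_def)
      have qW: "of_real q * W = B * pa" using pq' by (simp add: W_def pa_def)
      have qV: "of_real q * V = of_real q * ZV - of_real q * eV + B * pa"
        unfolding V by (simp add: ring_distribs qW)
      show ?thesis
        unfolding qx lx Z_def[symmetric] Z'_def[symmetric] ZV_def[symmetric] B_def[symmetric]
          P1 P2 qV L unfolding S unfolding H by (simp add: algebra_simps)
    qed
    also have "norm \<dots> \<le> norm E1 + norm E2 + norm ((eS + of_real p) * eH) + norm (B * lc * eS) + norm (B * eL) + norm (of_real q * eV)"
    proof -
      have "norm (A1 + A2 + A3 - A4 - A5 + A6) \<le> norm A1 + norm A2 + norm A3 + norm A4 + norm A5 + norm A6"
        for A1 A2 A3 A4 A5 A6 :: complex
        using norm_triangle_ineq[of "A1 + A2 + A3 - A4 - A5" A6] norm_triangle_ineq4[of "A1 + A2 + A3 - A4" A5]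
          norm_triangle_ineq4[of "A1 + A2 + A3" A4] norm_triangle_ineq[of "A1 + A2" A3] norm_triangle_ineq[of A1 A2]
        by linarith
      thus ?thesis .
    qed
    also have "\<dots> \<le> C1 * (1 + l)^2 * u + C2 * (1 + l)^2 * u + (CS + 1 / (a - 1)) * CH * (1 + l)^2 * u
        + real b * CS * (1 + l)^2 * u + real b * CL * (1 + l)^2 * u + CV / (a - 1) * (1 + l)^2 * u"
    proof (intro add_mono)
      have l2: "1 + l \<le> (1 + l)^2" "1 \<le> (1 + l)^2" "l \<le> (1 + l)^2" using l by (simp_all add: power2_eq_square algebra_simps)
      have up: "C * r * u \<le> C * (1 + l)^2 * u" if "C \<ge> 0" "r \<le> (1 + l)^2" for C r
        using that u by (intro mult_right_mono mult_left_mono)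
      show "norm E1 \<le> C1 * (1 + l)^2 * u" using bE1 up[OF C1(1) l2(1)] by linarith
      show "norm E2 \<le> C2 * (1 + l)^2 * u" using bE2 up[OF C2(1) l2(1)] by linarith
      have "norm (B * lc * eS) \<le> real b * l * (CS * u)"
        unfolding norm_mult using l beS by (simp add: B_def lc_def mult_left_mono)
      also have "\<dots> = real b * CS * l * u" by simp
      also have "\<dots> \<le> real b * CS * (1 + l)^2 * u" using CS by (intro up l2) auto
      finally show "norm (B * lc * eS) \<le> real b * CS * (1 + l)^2 * u" .
      have "norm (B * eL) \<le> real b * (CL * (1 + l) * u)"
        unfolding norm_mult using beL by (simp add: B_def mult_left_mono)
      also have "\<dots> = real b * CL * (1 + l) * u" by simp
      also have "\<dots> \<le> real b * CL * (1 + l)^2 * u" using CL by (intro up l2) auto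
      finally show "norm (B * eL) \<le> real b * CL * (1 + l)^2 * u" .
      have "norm (of_real q * eV) \<le> q * (CV * Y powr (\<beta> - 1))"
      proof -
        have q0: "q \<ge> 0" using a by (simp add: q_def)
        hence "norm (complex_of_real q) = q" by simp
        thus ?thesis unfolding norm_mult using beV q0 by (simp only: mult_left_mono)
      qed
      also have "\<dots> = CV / (a - 1) * (Y powr (- (real b + 1) * \<beta>) * Y powr (\<beta> - 1))" by (simp add: q_def)
      also have "Y powr (- (real b + 1) * \<beta>) * Y powr (\<beta> - 1) = 1 * u"
      proof -
        have e: "- (real b + 1) * \<beta> + (\<beta> - 1) = - a" using \<beta>(3) by (simp add: algebra_simps)
        show ?thesis unfolding powr_add[symmetric] e u_def by simp
      qed
      also have "CV / (a - 1) * (1 * u) \<le> CV / (a - 1) * (1 + l)^2 * u"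
        using up[of "CV / (a - 1)" 1] CV a l2 by simp
      finally show "norm (of_real q * eV) \<le> CV / (a - 1) * (1 + l)^2 * u" .
      \<comment> \<open>The error eH meets a factor as large as Y^(1-a); its own decay Y^(-1) is
        what restores Y^(-a).\<close>
      have Yu: "Y powr (1 - a) * Y powr (-1) = u" unfolding powr_add[symmetric] u_def by simp
      have "norm (eS + of_real p) \<le> norm eS + norm (complex_of_real p)" by (rule norm_triangle_ineq)
      also have "\<dots> \<le> CS * Y powr (1 - a) + 1 / (a - 1) * Y powr (1 - a)"
      proof (intro add_mono)
        have "CS * u \<le> CS * Y powr (1 - a)" unfolding u_def using CS Y by (intro mult_left_mono powr_mono) auto
        thus "norm eS \<le> CS * Y powr (1 - a)" using beS by linarith
        show "norm (complex_of_real p) \<le> 1 / (a - 1) * Y powr (1 - a)"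
        proof -
          have "p \<ge> 0" using a by (simp add: p_def)
          hence "norm (complex_of_real p) = p" by simp
          thus ?thesis by (simp add: p_def)
        qed
      qed
      finally have "norm (eS + of_real p) \<le> (CS + 1 / (a - 1)) * Y powr (1 - a)" by (simp add: algebra_simps)
      hence "norm ((eS + of_real p) * eH) \<le> ((CS + 1 / (a - 1)) * Y powr (1 - a)) * (CH * (1 + l) * Y powr (-1))"
        unfolding norm_mult using CS a by (intro mult_mono beH) auto
      also have "\<dots> = (CS + 1 / (a - 1)) * CH * (1 + l) * u" unfolding Yu[symmetric] by (simp only: mult_ac)
      also have "\<dots> \<le> (CS + 1 / (a - 1)) * CH * (1 + l)^2 * u" using CS CH a by (intro up l2) auto
      finally show "norm ((eS + of_real p) * eH) \<le> (CS + 1 / (a - 1)) * CH * (1 + l)^2 * u" .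
    qed
    also have "\<dots> = K * (1 + l)^2 * u" by (simp add: K_def algebra_simps)
    also have "\<dots> \<le> K * (1 + ln x)^2 * u"
      using K u l b0 unfolding lnx by (intro mult_right_mono mult_left_mono power_mono) (auto simp: mult_le_cancel_right1)
    also have "u = x powr (-1/2)"
      unfolding u_def xY powr_powr by (rule arg_cong[of _ _ "(powr) Y"]) (simp add: a_def field_simps)
    finally show ?thesis .
  qed
  thus ?thesis using K by (intro exI[of _ K]) auto
qed

section \<open>Moving the line of integration\<close>

definition moment_kernel :: "nat \<Rightarrow> nat \<Rightarrow> complex \<Rightarrow> complex" where
  "moment_kernel b n s = of_nat n powr (s - 1) * zeta (of_nat b * s + of_real ((1 - real b) / 2)) * zeta s"

lemma one_le_ln:
  assumes "t \<ge> 2 * pi"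
  shows "1 \<le> ln t" "t \<ge> 6"
proof -
  show t: "t \<ge> 6" using assms pi_gt3 by linarith
  have "exp 1 \<le> t" using exp_le t by linarith
  thus "1 \<le> ln t" using t by (subst ln_ge_iff) auto
qed

text \<open>The argument bs + (1-b)/2 lies to the right of s by (b-1)(Re s - 1/2), so its growth
  exponent is no larger. Up to logarithms and constants the kernel is then at most
  (t/n)^(1-\<sigma>) \<le> sqrt (t/n) for \<sigma> \<le> 1, and n^(\<sigma>-1) \<le> sqrt n for
  \<sigma> > 1.\<close>

lemma moment_kernel_growth:
  assumes "b \<ge> 1"
  shows "\<exists>C\<ge>0. \<forall>n \<sigma> t. 1 \<le> n \<and> 1/2 \<le> \<sigma> \<and> \<sigma> \<le> 3/2 \<and> 2 * pi \<le> t \<and> real n \<le> t \<longrightarrow>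
     norm (moment_kernel b n (Complex \<sigma> (-t))) \<le> C * (sqrt (t / real n) + sqrt (real n)) * (ln t)^2"
proof -
  obtain C where C: "C > 0" "\<And>s. 1/2 \<le> Re s \<Longrightarrow> Re s \<le> real b + 1 \<Longrightarrow> 2 \<le> \<bar>Im s\<bar> \<Longrightarrow>
           norm (zeta s) \<le> C * \<bar>Im s\<bar> powr growth_exp (Re s) * ln \<bar>Im s\<bar>"
    using zeta_growth[of "real b + 1"] by blast
  have b1: "real b \<ge> 1" using assms by simp
  define K where "K = C * C * real b * (1 + ln (real b))"
  have lnb: "ln (real b) \<ge> 0" using b1 by simp
  have "norm (moment_kernel b n (Complex \<sigma> (-t))) \<le> K * (sqrt (t / real n) + sqrt (real n)) * (ln t)^2"
    if n: "1 \<le> n" and \<sigma>: "1/2 \<le> \<sigma>" "\<sigma> \<le> 3/2" and t: "2 * pi \<le> t" "real n \<le> t" for n \<sigma> t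
  proof -
    define s where "s = Complex \<sigma> (-t)"
    define s' where "s' = of_nat b * s + of_real ((1 - real b) / 2)"
    note t' = one_le_ln[OF t(1)]
    have s: "Re s = \<sigma>" "\<bar>Im s\<bar> = t" using t' by (auto simp: s_def)
    have "real b * (1/2) \<le> real b * \<sigma>" "real b * \<sigma> \<le> real b * (3/2)" using b1 \<sigma> by (auto intro!: mult_left_mono)
    moreover have s': "Re s' = real b * \<sigma> + (1 - real b) / 2" "\<bar>Im s'\<bar> = real b * t"
      using t' by (auto simp: s'_def s_def abs_mult)
    ultimately have Re': "1/2 \<le> Re s'" "Re s' \<le> real b + 1" by (auto simp: field_simps)
    have bt: "real b * t \<ge> t" using b1 t' by simp
    have bt1: "real b * t \<ge> 1" using bt t' by linarith
    define e where "e = growth_exp \<sigma>"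
    have e: "0 \<le> e" "e \<le> 1" using \<sigma> by (auto simp: e_def growth_exp_def)
    have "(real b - 1) * (\<sigma> - 1/2) \<ge> 0" using b1 \<sigma> by (intro mult_nonneg_nonneg) auto
    hence "\<sigma> \<le> Re s'" unfolding s' by (simp add: field_simps)
    hence ee: "growth_exp (Re s') \<le> e" by (simp add: e_def growth_exp_def max_def)
    have z1: "norm (zeta s) \<le> C * t powr e * ln t"
      using C(2)[of s] s \<sigma> b1 t' by (simp add: e_def)
    have "norm (zeta s') \<le> C * (real b * t) powr growth_exp (Re s') * ln (real b * t)"
      using C(2)[of s'] s' Re' bt t' by simp
    also have "\<dots> \<le> C * (real b * t powr e) * ((1 + ln (real b)) * ln t)"
    proof (intro mult_mono)
      have "(real b * t) powr growth_exp (Re s') \<le> (real b * t) powr e"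
        using ee bt1 by (rule powr_mono)
      also have "\<dots> = real b powr e * t powr e" using b1 t' by (simp add: powr_mult)
      also have "\<dots> \<le> real b powr 1 * t powr e" using b1 e by (intro mult_right_mono powr_mono) auto
      finally show "(real b * t) powr growth_exp (Re s') \<le> real b * t powr e" using b1 by simp
      have "ln (real b * t) = ln (real b) * 1 + ln t" using b1 t' by (subst ln_mult_pos) auto
      also have "\<dots> \<le> ln (real b) * ln t + ln t" using lnb t' by (intro add_mono mult_left_mono) auto
      finally show "ln (real b * t) \<le> (1 + ln (real b)) * ln t" by (simp add: algebra_simps)
      show "0 \<le> ln (real b * t)" using bt1 by (rule ln_ge_zero)
    qed (use C b1 in auto)
    finally have z2: "norm (zeta s') \<le> C * (real b * t powr e) * ((1 + ln (real b)) * ln t)" .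
    have nn: "norm (of_nat n powr (s - 1) :: complex) = real n powr (\<sigma> - 1)"
      using n s by (simp add: norm_of_nat_powr)
    have "norm (moment_kernel b n s) = real n powr (\<sigma> - 1) * norm (zeta s') * norm (zeta s)"
      unfolding moment_kernel_def s'_def[symmetric] norm_mult nn ..
    also have "\<dots> \<le> real n powr (\<sigma> - 1) * (C * (real b * t powr e) * ((1 + ln (real b)) * ln t)) * (C * t powr e * ln t)"
      using C b1 lnb t' by (intro mult_mono z1 z2 mult_nonneg_nonneg) auto
    also have "\<dots> = K * (real n powr (\<sigma> - 1) * (t powr e * t powr e)) * (ln t)^2"
      by (simp add: K_def power2_eq_square mult_ac)
    also have "\<dots> \<le> K * (sqrt (t / real n) + sqrt (real n)) * (ln t)^2"
    proof (intro mult_right_mono mult_left_mono)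
      have "t powr e * t powr e = t powr max 0 (1 - \<sigma>)"
        unfolding powr_add[symmetric] by (rule arg_cong[of _ _ "(powr) t"]) (simp add: e_def growth_exp_def max_def)
      moreover have "real n powr (\<sigma> - 1) * t powr max 0 (1 - \<sigma>) \<le> sqrt (t / real n) + sqrt (real n)"
      proof (cases "\<sigma> \<le> 1")
        case True
        have tn: "t / real n \<ge> 1" using n t by simp
        have "real n powr (\<sigma> - 1) * t powr max 0 (1 - \<sigma>) = (t / real n) powr (1 - \<sigma>)"
        proof -
          have "real n powr (\<sigma> - 1) = inverse (real n powr (1 - \<sigma>))"
            unfolding powr_minus[symmetric] by simp
          thus ?thesis using True n t' by (simp add: powr_divide max_def mult.commute[of "inverse _"] flip: divide_inverse)
        qed
        also have "\<dots> \<le> (t / real n) powr (1/2)" using tn \<sigma> by (intro powr_mono) auto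
        also have "\<dots> = sqrt (t / real n)" using tn by (simp add: powr_half_sqrt)
        finally show ?thesis using real_sqrt_ge_zero[of "real n"] by linarith
      next
        case False
        have "real n powr (\<sigma> - 1) * t powr max 0 (1 - \<sigma>) = real n powr (\<sigma> - 1)"
          using False t' by (simp add: max_def)
        also have "\<dots> \<le> real n powr (1/2)" using n \<sigma> by (intro powr_mono) auto
        also have "\<dots> = sqrt (real n)" by (simp add: powr_half_sqrt)
        also have "\<dots> \<le> sqrt (t / real n) + sqrt (real n)" using t' by simp
        finally show ?thesis .
      qed
      ultimately show "real n powr (\<sigma> - 1) * (t powr e * t powr e) \<le> sqrt (t / real n) + sqrt (real n)" by simp
      show "0 \<le> K" using C b1 lnb by (simp add: K_def)
    qed auto
    finally show ?thesis by (simp add: s_def)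
  qed
  moreover have "K \<ge> 0" using C b1 lnb by (simp add: K_def)
  ultimately show ?thesis by (intro exI[of _ K]) blast
qed

text \<open>On a convex domain f has a primitive, so Cauchy's theorem for the rectangle becomes an
  identity between its values at the four corners. The mean value inequality then bounds the two
  horizontal differences.\<close>

lemma shift_vertical_segment:
  fixes f :: "complex \<Rightarrow> complex"
  assumes D: "convex D" "open D" "f holomorphic_on D"
    and t: "t0 \<le> T" and \<sigma>: "\<sigma>0 \<le> \<sigma>1"
    and sub: "\<And>\<sigma> t. \<sigma>0 \<le> \<sigma> \<Longrightarrow> \<sigma> \<le> \<sigma>1 \<Longrightarrow> t0 \<le> t \<Longrightarrow> t \<le> T \<Longrightarrow> Complex \<sigma> (-t) \<in> D"
    and B0: "\<And>\<sigma>. \<sigma>0 \<le> \<sigma> \<Longrightarrow> \<sigma> \<le> \<sigma>1 \<Longrightarrow> norm (f (Complex \<sigma> (-t0))) \<le> B0"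
    and B1: "\<And>\<sigma>. \<sigma>0 \<le> \<sigma> \<Longrightarrow> \<sigma> \<le> \<sigma>1 \<Longrightarrow> norm (f (Complex \<sigma> (-T))) \<le> B1"
  shows "norm (integral {t0..T} (\<lambda>t. f (Complex \<sigma>0 (-t))) - integral {t0..T} (\<lambda>t. f (Complex \<sigma>1 (-t))))
           \<le> (B0 + B1) * (\<sigma>1 - \<sigma>0)"
proof -
  obtain G where G: "\<And>x. x \<in> D \<Longrightarrow> (G has_field_derivative f x) (at x within D)"
    using holomorphic_convex_primitive'[OF D] by blast
  have G': "(G has_field_derivative f x) (at x)" if "x \<in> D" for x
    using G[OF that] unfolding at_within_open[OF that D(2)] .
  have vert: "((\<lambda>t. f (Complex \<sigma> (-t))) has_integral \<i> * (G (Complex \<sigma> (-T)) - G (Complex \<sigma> (-t0)))) {t0..T}"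
    if "\<sigma>0 \<le> \<sigma>" "\<sigma> \<le> \<sigma>1" for \<sigma>
  proof -
    have "((\<lambda>t. - \<i> * f (Complex \<sigma> (-t))) has_integral (G (Complex \<sigma> (-T)) - G (Complex \<sigma> (-t0)))) {t0..T}"
    proof (rule fundamental_theorem_of_calculus[OF t])
      fix t assume t: "t \<in> {t0..T}"
      have eq: "(\<lambda>t. Complex \<sigma> (-t)) = (\<lambda>t. of_real \<sigma> - \<i> * of_real t)"
        by (auto simp: complex_eq_iff)
      have "((\<lambda>t. Complex \<sigma> (-t)) has_vector_derivative - \<i>) (at t within {t0..T})"
      proof -
        have "((\<lambda>t. of_real \<sigma> - \<i> * of_real t) has_vector_derivative 0 - \<i> * of_real 1) (at t within {t0..T})"
          by (intro has_vector_derivative_diff has_vector_derivative_const has_vector_derivative_mult_right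
              has_vector_derivative_of_real DERIV_ident)
        thus ?thesis unfolding eq by simp
      qed
      moreover have "(G has_field_derivative f (Complex \<sigma> (-t))) (at (Complex \<sigma> (-t)) within (\<lambda>t. Complex \<sigma> (-t)) ` {t0..T})"
        using t by (intro has_field_derivative_at_within[OF G'[OF sub[OF that]]]) auto
      ultimately have "(G \<circ> (\<lambda>t. Complex \<sigma> (-t)) has_vector_derivative (- \<i>) * f (Complex \<sigma> (-t))) (at t within {t0..T})"
        by (rule field_vector_diff_chain_within)
      thus "((\<lambda>t. G (Complex \<sigma> (-t))) has_vector_derivative - \<i> * f (Complex \<sigma> (-t))) (at t within {t0..T})"
        by (simp add: o_def)
    qed
    from has_integral_mult_right[OF this, of \<i>] show ?thesis by (simp flip: mult.assoc)
  qed
  have horiz: "norm (G (Complex \<sigma>0 (-t)) - G (Complex \<sigma>1 (-t))) \<le> B * (\<sigma>1 - \<sigma>0)"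
    if t: "t0 \<le> t" "t \<le> T" and B: "\<And>\<sigma>. \<sigma>0 \<le> \<sigma> \<Longrightarrow> \<sigma> \<le> \<sigma>1 \<Longrightarrow> norm (f (Complex \<sigma> (-t))) \<le> B" for t B
  proof -
    define S where "S = closed_segment (Complex \<sigma>0 (-t)) (Complex \<sigma>1 (-t))"
    have "norm (G (Complex \<sigma>0 (-t)) - G (Complex \<sigma>1 (-t))) \<le> B * norm (Complex \<sigma>0 (-t) - Complex \<sigma>1 (-t))"
    proof (rule field_differentiable_bound[where S = S])
      fix z assume "z \<in> S"
      then obtain u where u: "0 \<le> u" "u \<le> 1" "z = (1 - u) *\<^sub>R Complex \<sigma>0 (-t) + u *\<^sub>R Complex \<sigma>1 (-t)"
        by (auto simp: S_def closed_segment_def)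
      define \<sigma> where "\<sigma> = (1 - u) * \<sigma>0 + u * \<sigma>1"
      have z: "z = Complex \<sigma> (-t)" using u by (simp add: complex_eq_iff \<sigma>_def algebra_simps)
      have "u * \<sigma>0 \<le> u * \<sigma>1" "(1 - u) * \<sigma>0 \<le> (1 - u) * \<sigma>1" using u \<sigma> by (auto intro!: mult_left_mono)
      hence s: "\<sigma>0 \<le> \<sigma>" "\<sigma> \<le> \<sigma>1" by (auto simp: \<sigma>_def algebra_simps)
      show "norm (f z) \<le> B" unfolding z by (rule B[OF s])
      show "(G has_field_derivative f z) (at z within S)"
        unfolding z using G'[OF sub[OF s t]] by (rule has_field_derivative_at_within)
    qed (auto simp: S_def)
    also have "norm (Complex \<sigma>0 (-t) - Complex \<sigma>1 (-t)) = \<sigma>1 - \<sigma>0"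
      using \<sigma> by (simp add: cmod_def)
    finally show ?thesis .
  qed
  have "integral {t0..T} (\<lambda>t. f (Complex \<sigma>0 (-t))) - integral {t0..T} (\<lambda>t. f (Complex \<sigma>1 (-t)))
      = \<i> * ((G (Complex \<sigma>0 (-T)) - G (Complex \<sigma>1 (-T))) - (G (Complex \<sigma>0 (-t0)) - G (Complex \<sigma>1 (-t0))))"
    using integral_unique[OF vert[OF order_refl \<sigma>]] integral_unique[OF vert[OF \<sigma> order_refl]] by (simp add: algebra_simps)
  also have "norm \<dots> \<le> norm (G (Complex \<sigma>0 (-T)) - G (Complex \<sigma>1 (-T))) + norm (G (Complex \<sigma>0 (-t0)) - G (Complex \<sigma>1 (-t0)))"
    unfolding norm_mult by (simp add: norm_triangle_ineq4)
  also have "\<dots> \<le> B1 * (\<sigma>1 - \<sigma>0) + B0 * (\<sigma>1 - \<sigma>0)"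
    using t by (intro add_mono horiz B0 B1) auto
  finally show ?thesis by (simp add: algebra_simps)
qed

text \<open>For Re s > (b-1)/(2b) the argument of the first zeta factor has positive real part, and
  below the real axis neither factor meets its pole. As (b-1)/(2b) < 1/2, the line Re s = 1/2 lies
  inside.\<close>

lemma moment_kernel_holomorphic:
  assumes "b \<ge> 1" "n \<ge> 1"
  shows "moment_kernel b n holomorphic_on {s. Re s > (real b - 1) / (2 * real b) \<and> Im s < 0}"
    (is "_ holomorphic_on ?D")
proof -
  have b0: "real b > 0" using assms by simp
  define g where "g = (\<lambda>s::complex. of_nat b * s + of_real ((1 - real b) / 2))"
  have g: "Re (g s) > 0" "g s \<noteq> 1" if "s \<in> ?D" for s
  proof -
    have "real b * ((real b - 1) / (2 * real b)) < real b * Re s" using that b0 by (intro mult_strict_left_mono) auto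
    moreover have "real b * ((real b - 1) / (2 * real b)) = (real b - 1) / 2" using b0 by simp
    ultimately show "Re (g s) > 0" by (simp add: g_def diff_divide_distrib)
    have "Im (g s) < 0" using that b0 by (simp add: g_def mult_pos_neg)
    thus "g s \<noteq> 1" by auto
  qed
  have gh: "g holomorphic_on ?D" unfolding g_def by (intro holomorphic_intros)
  have "g ` ?D \<subseteq> {s. Re s > 0} - {1}" using g by auto
  from holomorphic_on_compose_gen[OF gh zeta_holomorphic this]
  have "(\<lambda>s. zeta (g s)) holomorphic_on ?D" by (simp add: o_def)
  moreover have "zeta holomorphic_on ?D"
  proof (rule holomorphic_on_subset[OF zeta_holomorphic])
    have "Re s > 0" if "Re s > (real b - 1) / (2 * real b)" for s
    proof -
      have "(real b - 1) / (2 * real b) \<ge> 0" using assms by simp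
      thus ?thesis using that by linarith
    qed
    thus "?D \<subseteq> {s. Re s > 0} - {1}" by auto
  qed
  ultimately have "(\<lambda>s. of_nat n powr (s - 1) * zeta (g s) * zeta s) holomorphic_on ?D"
    using assms by (intro holomorphic_intros) auto
  thus ?thesis by (simp add: moment_kernel_def[abs_def] g_def)
qed

lemma convex_open_quadrant: "convex {s. Re s > c \<and> Im s < 0}" "open {s. Re s > c \<and> Im s < 0}"
proof -
  have eq: "{s. Re s > c \<and> Im s < 0} = {s. Re s > c} \<inter> {s. Im s < 0}" by auto
  show "convex {s. Re s > c \<and> Im s < 0}"
    unfolding eq by (intro convex_Int convex_halfspace_Re_gt convex_halfspace_Im_lt)
  show "open {s. Re s > c \<and> Im s < 0}"
    unfolding eq by (intro open_Int open_halfspace_Re_gt open_halfspace_Im_lt)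
qed

lemma moment_kernel_shift:
  assumes "b \<ge> 1"
  shows "\<exists>C\<ge>0. \<forall>n t0 T. 1 \<le> n \<and> 2 * pi \<le> t0 \<and> t0 \<le> T \<and> real n \<le> t0 \<longrightarrow>
     norm (integral {t0..T} (\<lambda>t. moment_kernel b n (Complex (1/2) (-t))) - integral {t0..T} (\<lambda>t. moment_kernel b n (Complex (3/2) (-t))))
      \<le> C * (sqrt (T / real n) + sqrt (real n)) * (ln T)^2"
proof -
  obtain C where C: "C \<ge> 0" "\<And>n \<sigma> t. 1 \<le> n \<Longrightarrow> 1/2 \<le> \<sigma> \<Longrightarrow> \<sigma> \<le> 3/2 \<Longrightarrow> 2 * pi \<le> t \<Longrightarrow> real n \<le> t \<Longrightarrow>
     norm (moment_kernel b n (Complex \<sigma> (-t))) \<le> C * (sqrt (t / real n) + sqrt (real n)) * (ln t)^2"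
    using moment_kernel_growth[OF assms] by blast
  have "norm (integral {t0..T} (\<lambda>t. moment_kernel b n (Complex (1/2) (-t))) - integral {t0..T} (\<lambda>t. moment_kernel b n (Complex (3/2) (-t))))
      \<le> (2 * C) * (sqrt (T / real n) + sqrt (real n)) * (ln T)^2"
    if n: "1 \<le> n" "2 * pi \<le> t0" "t0 \<le> T" "real n \<le> t0" for n t0 T
  proof -
    define B where "B = C * (sqrt (T / real n) + sqrt (real n)) * (ln T)^2"
    have t0: "1 \<le> ln t0" "t0 \<ge> 6" using one_le_ln[OF n(2)] by auto
    have b0: "real b > 0" using assms by simp
    have "norm (integral {t0..T} (\<lambda>t. moment_kernel b n (Complex (1/2) (-t))) - integral {t0..T} (\<lambda>t. moment_kernel b n (Complex (3/2) (-t))))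
      \<le> (B + B) * (3/2 - 1/2)"
    proof (rule shift_vertical_segment[OF convex_open_quadrant moment_kernel_holomorphic[OF assms n(1)]])
      fix \<sigma> t :: real assume s: "1/2 \<le> \<sigma>" "\<sigma> \<le> 3/2" "t0 \<le> t" "t \<le> T"
      have "(real b - 1) / (2 * real b) < 1/2" using b0 by (simp add: field_simps)
      hence "(real b - 1) / (2 * real b) < \<sigma>" using s by linarith
      thus "Complex \<sigma> (- t) \<in> {s. (real b - 1) / (2 * real b) < Re s \<and> Im s < 0}"
        using t0 s by auto
    next
      fix \<sigma> :: real assume s: "1/2 \<le> \<sigma>" "\<sigma> \<le> 3/2"
      show "norm (moment_kernel b n (Complex \<sigma> (- T))) \<le> B"
        unfolding B_def using s n by (intro C) auto
      have "norm (moment_kernel b n (Complex \<sigma> (- t0))) \<le> C * (sqrt (t0 / real n) + sqrt (real n)) * (ln t0)^2"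
        using s n by (intro C) auto
      also have "\<dots> \<le> B"
        unfolding B_def using C t0 n
        by (intro mult_mono add_mono power_mono mult_left_mono) (auto simp: divide_right_mono)
      finally show "norm (moment_kernel b n (Complex \<sigma> (- t0))) \<le> B" .
    qed (use n in auto)
    thus ?thesis by (simp add: B_def algebra_simps)
  qed
  thus ?thesis using C by (intro exI[of _ "2 * C"]) auto
qed

section \<open>The Dirichlet series on the line of absolute convergence\<close>

lemma sum_powr_three_halves_le:
  "(\<Sum>k=1..K. real k powr (-3/2)) \<le> 2 powr (3/2) * 2"
proof -
  define c :: real where "c = 2 powr (3/2) * 2"
  have "(\<Sum>k=1..K. real k powr (-3/2)) \<le> c - c * real (Suc K) powr (-(1/2))"
  proof (induction K)
    case (Suc K)
    have e: "-(1/2) - 1 = (-3/2 :: real)" "2 powr (1/2 + 1) / (1/2) = c" by (simp_all add: c_def)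
    have "real (Suc K) powr (-3/2) \<le> c * (real (Suc K) powr (-(1/2)) - real (Suc (Suc K)) powr (-(1/2)))"
      using powr_minus_Suc_le_telescope[of "Suc K" "1/2"] unfolding e by simp
    moreover have "(\<Sum>k=1..Suc K. real k powr (-3/2)) = (\<Sum>k=1..K. real k powr (-3/2)) + real (Suc K) powr (-3/2)" by simp
    ultimately show ?case using Suc unfolding right_diff_distrib by linarith
  qed (simp add: c_def)
  also have "\<dots> \<le> c" by (simp add: c_def)
  finally show ?thesis by (simp only: c_def)
qed

lemma sum_reciprocal_distance_le:
  "(\<Sum>n\<in>{1..M} - {N}. 1 / \<bar>real N - real n\<bar>) \<le> 2 * (\<Sum>j=1..M. 1 / real j)"
proof -
  have *: "(\<Sum>n\<in>A. f n) \<le> (\<Sum>j=1..M. 1 / real j)"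
    if "finite A" "inj_on h A" "h ` A \<subseteq> {1..M}" "\<And>n. n \<in> A \<Longrightarrow> f n \<le> 1 / real (h n)" for A f and h :: "nat \<Rightarrow> nat"
  proof -
    have "(\<Sum>n\<in>A. f n) \<le> (\<Sum>n\<in>A. 1 / real (h n))" by (intro sum_mono that)
    also have "\<dots> = (\<Sum>j\<in>h ` A. 1 / real j)" using that by (simp add: sum.reindex)
    also have "\<dots> \<le> (\<Sum>j=1..M. 1 / real j)" using that by (intro sum_mono2) auto
    finally show ?thesis .
  qed
  define A where "A = {n\<in>{1..M}. n < N}"
  define B where "B = {n\<in>{1..M}. n > N}"
  have AB: "finite A" "finite B" "A \<inter> B = {}" "{1..M} - {N} = A \<union> B" by (auto simp: A_def B_def)
  have "(\<Sum>n\<in>A. 1 / \<bar>real N - real n\<bar>) \<le> (\<Sum>j=1..M. 1 / real j)"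
  proof (rule *[OF AB(1)])
    \<comment> \<open>N may be much larger than M, and then N - n leaves the range 1..M. Replacing N
      by at most M + 1 only shortens the distances and keeps them distinct.\<close>
    show "inj_on (\<lambda>n. min N (Suc M) - n) A" by (auto simp: inj_on_def A_def)
    show "(\<lambda>n. min N (Suc M) - n) ` A \<subseteq> {1..M}" by (auto simp: A_def)
    fix n assume n: "n \<in> A"
    hence "0 < real (min N (Suc M) - n)" by (auto simp: A_def)
    moreover have "real (min N (Suc M) - n) \<le> \<bar>real N - real n\<bar>" using n by (auto simp: A_def of_nat_diff)
    ultimately show "1 / \<bar>real N - real n\<bar> \<le> 1 / real (min N (Suc M) - n)" by (intro divide_left_mono mult_pos_pos) auto
  qed
  moreover have "(\<Sum>n\<in>B. 1 / \<bar>real N - real n\<bar>) \<le> (\<Sum>j=1..M. 1 / real j)"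
  proof (rule *[OF AB(2)])
    show "inj_on (\<lambda>n. n - N) B" by (auto simp: inj_on_def B_def)
    show "(\<lambda>n. n - N) ` B \<subseteq> {1..M}" by (auto simp: B_def)
    fix n assume n: "n \<in> B"
    thus "1 / \<bar>real N - real n\<bar> \<le> 1 / real (n - N)" by (auto simp: B_def of_nat_diff)
  qed
  ultimately show ?thesis using AB by (simp add: sum.union_disjoint)
qed

text \<open>From ln y \<le> y - 1, with y the smaller number over the larger. The right side is
  weighted by n and not by N: N will run over all products m^b k, while n \<le> X, and this keeps
  the later bounds uniform in N.\<close>

lemma inverse_ln_diff_le:
  assumes "N \<ge> 1" "n \<ge> 1" "N \<noteq> n"
  shows "1 / \<bar>ln (real N) - ln (real n)\<bar> \<le> 1 + real n * (1 / \<bar>real N - real n\<bar>)"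
proof (cases "n < N")
  case True
  have "ln (real n) - ln (real N) = ln (real n / real N)" using assms by (subst ln_divide_pos) auto
  also have "\<dots> \<le> real n / real N - 1" using assms by (intro ln_le_minus_one) auto
  finally have "1 - real n / real N \<le> \<bar>ln (real N) - ln (real n)\<bar>" by linarith
  hence "(real N - real n) / real N \<le> \<bar>ln (real N) - ln (real n)\<bar>" using assms by (simp add: diff_divide_distrib)
  hence "1 / \<bar>ln (real N) - ln (real n)\<bar> \<le> 1 / ((real N - real n) / real N)"
    using True assms by (intro frac_le) auto
  also have "\<dots> = 1 + real n * (1 / \<bar>real N - real n\<bar>)" using True by (simp add: field_simps)
  finally show ?thesis .
next
  case False
  hence lt: "N < n" using assms by simp
  have "ln (real N) - ln (real n) = ln (real N / real n)" using assms by (subst ln_divide_pos) auto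
  also have "\<dots> \<le> real N / real n - 1" using assms by (intro ln_le_minus_one) auto
  finally have "1 - real N / real n \<le> \<bar>ln (real N) - ln (real n)\<bar>" by linarith
  hence "(real n - real N) / real n \<le> \<bar>ln (real N) - ln (real n)\<bar>" using assms by (simp add: diff_divide_distrib)
  hence "1 / \<bar>ln (real N) - ln (real n)\<bar> \<le> 1 / ((real n - real N) / real n)"
    using lt assms by (intro frac_le) auto
  also have "\<dots> \<le> 1 + real n * (1 / \<bar>real N - real n\<bar>)" using lt by simp
  finally show ?thesis .
qed

lemma off_diagonal_sum_le:
  assumes "X \<ge> 1" "N \<ge> 1"
  shows "(\<Sum>n\<in>{1..nat \<lfloor>X\<rfloor>} - {N}. sqrt (real n) * (1 / \<bar>ln (real N) - ln (real n)\<bar>)) \<le> X powr (3/2) * (3 + 2 * ln X)"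
proof -
  define M where "M = nat \<lfloor>X\<rfloor>"
  have MX: "real M \<le> X" using assms by (simp add: M_def)
  have "(\<Sum>n\<in>{1..M} - {N}. sqrt (real n) * (1 / \<bar>ln (real N) - ln (real n)\<bar>))
      \<le> (\<Sum>n\<in>{1..M} - {N}. sqrt X * (1 + X * (1 / \<bar>real N - real n\<bar>)))"
  proof (intro sum_mono mult_mono)
    fix n assume n: "n \<in> {1..M} - {N}"
    hence nX: "real n \<le> X" using MX by auto
    show "sqrt (real n) \<le> sqrt X" using nX by simp
    have "1 / \<bar>ln (real N) - ln (real n)\<bar> \<le> 1 + real n * (1 / \<bar>real N - real n\<bar>)"
      using n assms by (intro inverse_ln_diff_le) auto
    also have "\<dots> \<le> 1 + X * (1 / \<bar>real N - real n\<bar>)"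
      using nX by (intro add_mono mult_right_mono) auto
    finally show "1 / \<bar>ln (real N) - ln (real n)\<bar> \<le> 1 + X * (1 / \<bar>real N - real n\<bar>)" .
  qed (use assms in auto)
  also have "\<dots> = sqrt X * (real (card ({1..M} - {N})) + X * (\<Sum>n\<in>{1..M} - {N}. 1 / \<bar>real N - real n\<bar>))"
    by (simp only: sum_distrib_left[symmetric] sum.distrib sum_constant) simp
  also have "\<dots> \<le> sqrt X * (X + X * (2 * (1 + ln X)))"
  proof (intro mult_left_mono add_mono)
    have "card ({1..M} - {N}) \<le> card {1..M}" by (intro card_mono) auto
    thus "real (card ({1..M} - {N})) \<le> X" using MX by simp
    show "(\<Sum>n\<in>{1..M} - {N}. 1 / \<bar>real N - real n\<bar>) \<le> 2 * (1 + ln X)"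
      unfolding M_def by (rule order_trans[OF sum_reciprocal_distance_le])
        (intro mult_left_mono harm_le_one_plus_ln assms; simp)
  qed (use assms in auto)
  also have "\<dots> = (X powr (1/2) * X powr 1) * (3 + 2 * ln X)"
    using assms by (simp add: powr_half_sqrt algebra_simps)
  also have "X powr (1/2) * X powr 1 = X powr (3/2)"
    unfolding powr_add[symmetric] by simp
  finally show ?thesis by (simp add: M_def)
qed

lemma norm_integral_cis_le:
  assumes "t0 \<le> T" "u \<noteq> 0"
  shows "norm (integral {t0..T} (\<lambda>t. cis (t * u))) \<le> 2 / \<bar>u\<bar>"
proof -
  have "((\<lambda>t. cis (t * u)) has_integral (cis (T * u) / (\<i> * of_real u) - cis (t0 * u) / (\<i> * of_real u))) {t0..T}"
  proof (rule fundamental_theorem_of_calculus[OF assms(1)])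
    fix t
    have "((\<lambda>z. exp (z * (\<i> * of_real u)) / (\<i> * of_real u)) has_field_derivative exp (of_real t * (\<i> * of_real u)))
        (at (of_real t))"
      using assms by (auto intro!: derivative_eq_intros)
    hence "((\<lambda>t. exp (of_real t * (\<i> * of_real u)) / (\<i> * of_real u)) has_vector_derivative exp (of_real t * (\<i> * of_real u))) (at t within {t0..T})"
      by (rule has_vector_derivative_real_field)
    moreover have "exp (of_real t * (\<i> * of_real u)) = cis (t * u)" for t
      by (simp add: cis_conv_exp mult_ac)
    ultimately show "((\<lambda>t. cis (t * u) / (\<i> * of_real u)) has_vector_derivative cis (t * u)) (at t within {t0..T})" by simp
  qed
  hence "integral {t0..T} (\<lambda>t. cis (t * u)) = cis (T * u) / (\<i> * of_real u) - cis (t0 * u) / (\<i> * of_real u)"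
    by (rule integral_unique)
  also have "norm \<dots> \<le> norm (cis (T * u) / (\<i> * of_real u)) + norm (cis (t0 * u) / (\<i> * of_real u))" by (rule norm_triangle_ineq4)
  also have "\<dots> = 2 / \<bar>u\<bar>" by (simp add: norm_divide norm_mult)
  finally show ?thesis .
qed

text \<open>Truncating both series makes every interchange of sum and integral finite; K tends to
  infinity once bounds independent of K are in place.\<close>

definition kernel_trunc :: "nat \<Rightarrow> nat \<Rightarrow> nat \<Rightarrow> complex \<Rightarrow> complex" where
  "kernel_trunc b K n s = of_nat n powr (s - 1) * zeta_sum K (of_nat b * s + of_real ((1 - real b) / 2)) * zeta_sum K s"

text \<open>The modulus of one summand on Re s = 3/2, where bs + (1-b)/2 has real part b +
  1/2.\<close>

definition line_weight :: "nat \<Rightarrow> nat \<Rightarrow> nat \<Rightarrow> nat \<Rightarrow> real" where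
  "line_weight b n m k = sqrt (real n) * real m powr (- (real b + 1/2)) * real k powr (-3/2)"

lemma kernel_trunc_line:
  assumes "n \<ge> 1"
  shows "kernel_trunc b K n (Complex (3/2) (-t)) =
    (\<Sum>m=1..K. \<Sum>k=1..K. of_real (line_weight b n m k) * cis (t * (ln (real (m ^ b * k)) - ln (real n))))"
proof -
  define s where "s = Complex (3/2) (-t)"
  define s' where "s' = of_nat b * s + of_real ((1 - real b) / 2)"
  have s': "Re s' = real b + 1/2" "Im s' = - (real b * t)" by (auto simp: s'_def s_def field_simps)
  have "kernel_trunc b K n s = (\<Sum>m=1..K. \<Sum>k=1..K. of_nat n powr (s - 1) * (of_nat m powr (-s') * of_nat k powr (-s)))"
    unfolding kernel_trunc_def s'_def[symmetric] zeta_sum_def mult.assoc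
    unfolding sum_product unfolding sum_distrib_left ..
  also have "\<dots> = (\<Sum>m=1..K. \<Sum>k=1..K. of_real (line_weight b n m k) * cis (t * (ln (real (m ^ b * k)) - ln (real n))))"
  proof (intro sum.cong refl)
    fix m k assume "m \<in> {1..K}" "k \<in> {1..K}"
    hence mk: "m \<ge> 1" "k \<ge> 1" by auto
    have "ln (real (m ^ b * k)) = real b * ln (real m) + ln (real k)"
      using mk by (simp add: ln_mult ln_realpow)
    hence c: "cis (t * (ln (real (m ^ b * k)) - ln (real n))) = cis (- t * ln (real n)) * (cis (real b * t * ln (real m)) * cis (t * ln (real k)))"
      by (simp add: cis_mult algebra_simps)
    have "real n powr (1/2) = sqrt (real n)" by (simp add: powr_half_sqrt)
    thus "of_nat n powr (s - 1) * (of_nat m powr (-s') * of_nat k powr (-s)) = of_real (line_weight b n m k) * cis (t * (ln (real (m ^ b * k)) - ln (real n)))"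
      unfolding c of_nat_powr_eq_cis[OF assms] of_nat_powr_eq_cis[OF mk(1)] of_nat_powr_eq_cis[OF mk(2)] line_weight_def
      by (simp add: s' s_def mult_ac)
  qed
  finally show ?thesis by (simp add: s_def)
qed

text \<open>On the diagonal sqrt n splits as m^(b/2) k^(1/2), and the exponents b/2 - (b + 1/2) and
  1/2 - 3/2 are -(b+1)/2 and -1. The same value would result on any other vertical line.\<close>

lemma line_weight_diagonal:
  assumes "m \<ge> 1" "k \<ge> 1" "m ^ b * k = n"
  shows "complex_of_real (line_weight b n m k) = of_nat m powr (- of_real ((real b + 1) / 2)) * of_nat k powr (-1)"
proof -
  have "sqrt (real n) = real n powr (1/2)" by (simp add: powr_half_sqrt)
  also have "\<dots> = (real m powr real b * real k) powr (1/2)" using assms by (simp add: powr_realpow flip: assms(3))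
  also have "\<dots> = real m powr (real b / 2) * real k powr (1/2)" by (simp add: powr_mult powr_powr)
  finally have "line_weight b n m k = (real m powr (real b / 2) * real m powr (- (real b + 1/2))) * (real k powr (1/2) * real k powr (-3/2))"
    by (simp add: line_weight_def)
  also have "real m powr (real b / 2) * real m powr (- (real b + 1/2)) = real m powr (- ((real b + 1) / 2))"
    unfolding powr_add[symmetric] by (rule arg_cong[of _ _ "(powr) (real m)"]) (simp add: field_simps)
  also have "real k powr (1/2) * real k powr (-3/2) = real k powr (-1)"
    unfolding powr_add[symmetric] by simp
  finally show ?thesis
    unfolding of_nat_powr_eq_cis[OF assms(1)] of_nat_powr_eq_cis[OF assms(2)] by simp
qed

section \<open>Diagonal terms as a divisor sum\<close>

definition divisor_coeff :: "nat \<Rightarrow> nat \<Rightarrow> complex" where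
  "divisor_coeff b n = (\<Sum>(m,k)\<in>{(m,k). 1 \<le> m \<and> 1 \<le> k \<and> m ^ b * k = n}.
     of_nat m powr (- of_real ((real b + 1) / 2)) * of_nat k powr (-1))"

lemma divisor_pairs_le:
  assumes "b \<ge> 1" "1 \<le> m" "1 \<le> k" "m ^ b * k \<le> (n::nat)"
  shows "m \<le> n" "k \<le> n"
proof -
  have "m ^ 1 \<le> m ^ b" using assms by (intro power_increasing) auto
  hence m: "m \<le> m ^ b" by simp
  have "m * 1 \<le> m ^ b * k" using m assms by (intro mult_le_mono) auto
  thus "m \<le> n" using assms by simp
  have "1 * k \<le> m ^ b * k" using assms by (intro mult_le_mono) auto
  thus "k \<le> n" using assms(4) unfolding mult_1 by linarith
qed

lemma weighted_divisor_sum_eq: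
  assumes "b \<ge> 1"
  shows "weighted_divisor_sum b x = (\<Sum>n\<in>{n. 1 \<le> n \<and> real n \<le> x}. divisor_coeff b n)"
proof -
  define S where "S = {(m,k). 1 \<le> m \<and> 1 \<le> k \<and> real (m ^ b * k) \<le> x}"
  define f :: "nat \<times> nat \<Rightarrow> complex" where "f = (\<lambda>(m,k). of_nat m powr (- of_real ((real b + 1) / 2)) * of_nat k powr (-1))"
  have fin: "finite {n. 1 \<le> n \<and> real n \<le> x}" by (metis finite_atLeastAtMost nat_floor_eq_atLeastAtMost)
  have "S \<subseteq> {1..nat \<lfloor>x\<rfloor>} \<times> {1..nat \<lfloor>x\<rfloor>}"
  proof
    fix p assume "p \<in> S"
    then obtain m k where p: "p = (m,k)" "1 \<le> m" "1 \<le> k" "real (m ^ b * k) \<le> x" by (auto simp: S_def)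
    have "m ^ b * k \<ge> 1" using p by simp
    hence "m ^ b * k \<in> {1..nat \<lfloor>x\<rfloor>}" unfolding nat_floor_eq_atLeastAtMost using p by auto
    hence "m ^ b * k \<le> nat \<lfloor>x\<rfloor>" by simp
    from divisor_pairs_le[OF assms p(2,3) this] show "p \<in> {1..nat \<lfloor>x\<rfloor>} \<times> {1..nat \<lfloor>x\<rfloor>}" using p by auto
  qed
  hence finS: "finite S" using finite_subset by blast
  have "weighted_divisor_sum b x = sum f S" by (simp add: weighted_divisor_sum_def S_def f_def)
  also have "\<dots> = (\<Sum>n\<in>{n. 1 \<le> n \<and> real n \<le> x}. sum f {p\<in>S. (case p of (m,k) \<Rightarrow> m ^ b * k) = n})"
    using finS fin by (intro sum.group[symmetric]) (auto simp: S_def)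
  also have "\<dots> = (\<Sum>n\<in>{n. 1 \<le> n \<and> real n \<le> x}. divisor_coeff b n)"
    unfolding divisor_coeff_def f_def[symmetric]
    by (intro sum.cong refl) (auto simp: S_def)
  finally show ?thesis .
qed

lemma diagonal_sum_eq:
  assumes "b \<ge> 1" "1 \<le> n" "n \<le> K"
  shows "(\<Sum>m=1..K. \<Sum>k=1..K. if m ^ b * k = n then complex_of_real (line_weight b n m k) else 0) = divisor_coeff b n"
proof -
  define f :: "nat \<times> nat \<Rightarrow> complex" where "f = (\<lambda>(m,k). of_nat m powr (- of_real ((real b + 1) / 2)) * of_nat k powr (-1))"
  have "(\<Sum>m=1..K. \<Sum>k=1..K. if m ^ b * k = n then complex_of_real (line_weight b n m k) else 0)
      = (\<Sum>m=1..K. \<Sum>k=1..K. if m ^ b * k = n then f (m,k) else 0)"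
    by (intro sum.cong refl) (auto simp: f_def line_weight_diagonal)
  also have "\<dots> = (\<Sum>p\<in>{1..K}\<times>{1..K}. if (case p of (m,k) \<Rightarrow> m ^ b * k = n) then f p else 0)"
    by (subst sum.cartesian_product) (auto intro!: sum.cong)
  also have "\<dots> = sum f {p\<in>{1..K}\<times>{1..K}. (case p of (m,k) \<Rightarrow> m ^ b * k = n)}"
    by (rule sum.inter_filter[symmetric]) auto
  also have "{p\<in>{1..K}\<times>{1..K}. (case p of (m,k) \<Rightarrow> m ^ b * k = n)} = {(m,k). 1 \<le> m \<and> 1 \<le> k \<and> m ^ b * k = n}"
  proof -
    have "m \<le> K \<and> k \<le> K" if "1 \<le> m" "1 \<le> k" "m ^ b * k = n" for m k
      using divisor_pairs_le[of b m k n] that assms by auto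
    thus ?thesis by auto
  qed
  finally show ?thesis by (simp add: divisor_coeff_def f_def)
qed

text \<open>For n = m^b k the integrand is constant and contributes the length T - t n. The other
  integrals are at most 2/|ln (m^b k) - ln n|. Summing over n first gives a bound uniform in m and
  k, and the remaining weights, at most (mk)^(-3/2), have a sum bounded independently of K.\<close>

lemma trunc_line_integral:
  fixes t :: "nat \<Rightarrow> real"
  assumes "b \<ge> 1" "X \<ge> 1" "\<And>n. n \<in> {1..nat \<lfloor>X\<rfloor>} \<Longrightarrow> t n \<le> T" "nat \<lfloor>X\<rfloor> \<le> K"
  shows "norm ((\<Sum>n=1..nat \<lfloor>X\<rfloor>. integral {t n..T} (\<lambda>u. kernel_trunc b K n (Complex (3/2) (-u))))
             - (\<Sum>n=1..nat \<lfloor>X\<rfloor>. of_real (T - t n) * divisor_coeff b n))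
         \<le> 2 * (2 powr (3/2) * 2)^2 * (X powr (3/2) * (3 + 2 * ln X))"
proof -
  define M where "M = nat \<lfloor>X\<rfloor>"
  define I where "I = (\<lambda>n m k. integral {t n..T} (\<lambda>u. cis (u * (ln (real (m ^ b * k)) - ln (real n)))))"
  have int: "integral {t n..T} (\<lambda>u. kernel_trunc b K n (Complex (3/2) (-u)))
      = (\<Sum>m=1..K. \<Sum>k=1..K. of_real (line_weight b n m k) * I n m k)" if "n \<in> {1..M}" for n
  proof -
    have ii: "(\<lambda>u. of_real (line_weight b n m k) * cis (u * (ln (real (m ^ b * k)) - ln (real n)))) integrable_on {t n..T}" for m k
      by (intro integrable_continuous_real continuous_intros)
    have "integral {t n..T} (\<lambda>u. kernel_trunc b K n (Complex (3/2) (-u)))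
      = integral {t n..T} (\<lambda>u. \<Sum>m=1..K. \<Sum>k=1..K. of_real (line_weight b n m k) * cis (u * (ln (real (m ^ b * k)) - ln (real n))))"
      using that by (simp add: kernel_trunc_line)
    also have "\<dots> = (\<Sum>m=1..K. \<Sum>k=1..K. integral {t n..T} (\<lambda>u. of_real (line_weight b n m k) * cis (u * (ln (real (m ^ b * k)) - ln (real n)))))"
      using ii by (simp add: integral_sum integrable_sum)
    finally show ?thesis by (simp add: I_def)
  qed
  have lw: "line_weight b n m k \<ge> 0" for n m k by (simp add: line_weight_def)
  have diag: "of_real (T - t n) * divisor_coeff b n
      = (\<Sum>m=1..K. \<Sum>k=1..K. if m ^ b * k = n then of_real (line_weight b n m k) * I n m k else 0)" if "n \<in> {1..M}" for n
  proof -
    have K: "n \<le> K" "n \<ge> 1" using that assms(4) by (auto simp: M_def)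
    have "of_real (T - t n) * divisor_coeff b n
      = (\<Sum>m=1..K. \<Sum>k=1..K. of_real (T - t n) * (if m ^ b * k = n then complex_of_real (line_weight b n m k) else 0))"
      unfolding diagonal_sum_eq[OF assms(1) K(2,1), symmetric] sum_distrib_left ..
    also have "\<dots> = (\<Sum>m=1..K. \<Sum>k=1..K. if m ^ b * k = n then of_real (line_weight b n m k) * I n m k else 0)"
    proof (intro sum.cong refl)
      fix m k
      have "I n m k = of_real (T - t n)" if eq: "m ^ b * k = n"
      proof -
        have "I n m k = integral {t n..T} (\<lambda>u. 1)" unfolding I_def eq by simp
        thus ?thesis using assms(3)[of n] \<open>n \<in> {1..M}\<close> by (simp add: M_def scaleR_conv_of_real)
      qed
      thus "of_real (T - t n) * (if m ^ b * k = n then complex_of_real (line_weight b n m k) else 0)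
         = (if m ^ b * k = n then of_real (line_weight b n m k) * I n m k else 0)" by simp
    qed
    finally show ?thesis .
  qed
  have "(\<Sum>n=1..M. integral {t n..T} (\<lambda>u. kernel_trunc b K n (Complex (3/2) (-u)))) - (\<Sum>n=1..M. of_real (T - t n) * divisor_coeff b n)
    = (\<Sum>n=1..M. \<Sum>m=1..K. \<Sum>k=1..K. of_real (line_weight b n m k) * I n m k)
       - (\<Sum>n=1..M. \<Sum>m=1..K. \<Sum>k=1..K. if m ^ b * k = n then of_real (line_weight b n m k) * I n m k else 0)"
    by (intro arg_cong2[where f = minus] sum.cong refl int diag)
  also have "\<dots> = (\<Sum>n=1..M. \<Sum>m=1..K. \<Sum>k=1..K. if m ^ b * k = n then 0 else of_real (line_weight b n m k) * I n m k)"
    unfolding sum_subtractf[symmetric] by (intro sum.cong refl) auto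
  also have "\<dots> = (\<Sum>m=1..K. \<Sum>n=1..M. \<Sum>k=1..K. if m ^ b * k = n then 0 else of_real (line_weight b n m k) * I n m k)"
    by (rule sum.swap)
  also have "\<dots> = (\<Sum>m=1..K. \<Sum>k=1..K. \<Sum>n=1..M. if m ^ b * k = n then 0 else of_real (line_weight b n m k) * I n m k)"
    by (rule sum.cong[OF refl], rule sum.swap)
  also have "norm \<dots> \<le> (\<Sum>m=1..K. \<Sum>k=1..K. real m powr (-3/2) * real k powr (-3/2) * (2 * (X powr (3/2) * (3 + 2 * ln X))))"
  proof (intro sum_norm_le)
    fix m k assume mk: "m \<in> {1..K}" "k \<in> {1..K}"
    define N where "N = m ^ b * k"
    have N: "N \<ge> 1" using mk by (simp add: N_def)
    define w where "w = real m powr (- (real b + 1/2)) * real k powr (-3/2)"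
    have w: "0 \<le> w" "w \<le> real m powr (-3/2) * real k powr (-3/2)"
      using mk assms(1) by (auto simp: w_def intro!: mult_right_mono powr_mono)
    have "(\<Sum>n=1..M. if N = n then 0 else of_real (line_weight b n m k) * I n m k)
        = (\<Sum>n\<in>{1..M} - {N}. of_real (line_weight b n m k) * I n m k)"
      by (rule sum.mono_neutral_cong_right) auto
    also have "norm \<dots> \<le> (\<Sum>n\<in>{1..M} - {N}. 2 * w * (sqrt (real n) * (1 / \<bar>ln (real N) - ln (real n)\<bar>)))"
    proof (intro sum_norm_le)
      fix n assume n: "n \<in> {1..M} - {N}"
      have "ln (real N) - ln (real n) \<noteq> 0" using n N by auto
      hence "norm (I n m k) \<le> 2 / \<bar>ln (real N) - ln (real n)\<bar>"
        unfolding I_def N_def[symmetric] using assms(3)[of n] n by (intro norm_integral_cis_le) (auto simp: M_def)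
      hence "norm (of_real (line_weight b n m k) * I n m k) \<le> line_weight b n m k * (2 / \<bar>ln (real N) - ln (real n)\<bar>)"
        unfolding norm_mult norm_of_real abs_of_nonneg[OF lw[of n m k]] using lw[of n m k] by (rule mult_left_mono)
      also have "\<dots> = 2 * w * (sqrt (real n) * (1 / \<bar>ln (real N) - ln (real n)\<bar>))" by (simp add: line_weight_def w_def)
      finally show "norm (of_real (line_weight b n m k) * I n m k) \<le> \<dots>" .
    qed
    also have "\<dots> = 2 * w * (\<Sum>n\<in>{1..M} - {N}. sqrt (real n) * (1 / \<bar>ln (real N) - ln (real n)\<bar>))"
      by (simp only: sum_distrib_left)
    also have "\<dots> \<le> 2 * w * (X powr (3/2) * (3 + 2 * ln X))"
      using w unfolding M_def by (intro mult_left_mono off_diagonal_sum_le assms N) auto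
    also have "\<dots> \<le> 2 * (real m powr (-3/2) * real k powr (-3/2)) * (X powr (3/2) * (3 + 2 * ln X))"
      using w assms by (intro mult_right_mono mult_left_mono mult_nonneg_nonneg) auto
    also have "\<dots> = real m powr (-3/2) * real k powr (-3/2) * (2 * (X powr (3/2) * (3 + 2 * ln X)))" by (simp only: mult_ac)
    finally show "norm (\<Sum>n=1..M. if m ^ b * k = n then 0 else of_real (line_weight b n m k) * I n m k)
       \<le> real m powr (-3/2) * real k powr (-3/2) * (2 * (X powr (3/2) * (3 + 2 * ln X)))" by (simp add: N_def)
  qed
  also have "\<dots> = (\<Sum>m=1..K. real m powr (-3/2)) * (\<Sum>k=1..K. real k powr (-3/2)) * (2 * (X powr (3/2) * (3 + 2 * ln X)))"
    unfolding sum_product unfolding sum_distrib_right ..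
  also have "\<dots> \<le> (2 powr (3/2) * 2) * (2 powr (3/2) * 2) * (2 * (X powr (3/2) * (3 + 2 * ln X)))"
    using assms(2) by (intro mult_right_mono mult_mono sum_powr_three_halves_le sum_nonneg mult_nonneg_nonneg) auto
  finally show ?thesis by (simp add: M_def power2_eq_square mult_ac)
qed

section \<open>Removing the truncation\<close>

lemma zeta_sum_limit:
  assumes "Re s > 1"
  shows "(\<lambda>K. zeta_sum K s) \<longlonglongrightarrow> zeta s"
proof -
  have s1: "s \<noteq> 1" using assms by auto
  have "(\<lambda>K. (of_nat K :: complex) powr (1 - s)) \<longlonglongrightarrow> 0"
  proof (rule tendsto_norm_zero_cancel)
    have "(\<lambda>K. real K powr (1 - Re s)) \<longlonglongrightarrow> 0" using assms by real_asymp
    moreover have "\<forall>\<^sub>F K in sequentially. real K powr (1 - Re s) = norm ((of_nat K :: complex) powr (1 - s))"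
      using eventually_ge_at_top[of 1] by eventually_elim (simp add: norm_of_nat_powr)
    ultimately show "(\<lambda>K. norm ((of_nat K :: complex) powr (1 - s))) \<longlonglongrightarrow> 0" by (rule Lim_transform_eventually)
  qed
  hence "(\<lambda>K. zeta s - ((zeta_reg s - zeta_approx K s) / (s - 1)) - of_nat K powr (1 - s) / (s - 1)) \<longlonglongrightarrow> zeta s - 0 / (s - 1) - 0 / (s - 1)"
    using s1 assms by (intro tendsto_intros zeta_reg_limit) auto
  also have "(\<lambda>K. zeta s - ((zeta_reg s - zeta_approx K s) / (s - 1)) - of_nat K powr (1 - s) / (s - 1)) = (\<lambda>K. zeta_sum K s)"
    using s1 by (simp add: zeta_def zeta_approx_def diff_divide_distrib add_divide_distrib)
  finally show ?thesis by simp
qed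

lemma norm_zeta_sum_le:
  assumes "Re s \<ge> 3/2"
  shows "norm (zeta_sum K s) \<le> 2 powr (3/2) * 2"
proof -
  have "norm (zeta_sum K s) \<le> (\<Sum>k=1..K. real k powr (-3/2))"
    unfolding zeta_sum_def
  proof (rule sum_norm_le)
    fix k assume "k \<in> {1..K}"
    thus "norm (of_nat k powr (-s) :: complex) \<le> real k powr (-3/2)"
      using assms by (auto simp: norm_of_nat_powr intro!: powr_mono)
  qed
  with sum_powr_three_halves_le show ?thesis by (rule order_trans[rotated])
qed

lemma kernel_trunc_integral_limit:
  assumes "b \<ge> 1" "n \<ge> 1"
  shows "(\<lambda>K. integral {t0..T} (\<lambda>t. kernel_trunc b K n (Complex (3/2) (-t)))) \<longlonglongrightarrow>
     integral {t0..T} (\<lambda>t. moment_kernel b n (Complex (3/2) (-t)))"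
proof (rule dominated_convergence(2))
  define c :: real where "c = 2 powr (3/2) * 2"
  show "(\<lambda>t. kernel_trunc b K n (Complex (3/2) (-t))) integrable_on {t0..T}" for K
    unfolding kernel_trunc_line[OF assms(2)] by (intro integrable_continuous_real continuous_intros)
  show "(\<lambda>t. sqrt (real n) * c * c) integrable_on {t0..T}" by (rule integrable_const_ivl)
  have Re: "Re (of_nat b * Complex (3/2) (-t) + of_real ((1 - real b) / 2)) = real b + 1/2" for t
    by (simp add: field_simps)
  fix t assume "t \<in> {t0..T}"
  show "norm (kernel_trunc b K n (Complex (3/2) (-t))) \<le> sqrt (real n) * c * c" for K
  proof -
    have "norm (of_nat n powr (Complex (3/2) (-t) - 1) :: complex) = sqrt (real n)"
      using assms by (simp add: norm_of_nat_powr powr_half_sqrt)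
    thus ?thesis unfolding kernel_trunc_def norm_mult c_def using Re assms
      by (intro mult_mono norm_zeta_sum_le) auto
  qed
  show "(\<lambda>K. kernel_trunc b K n (Complex (3/2) (-t))) \<longlonglongrightarrow> moment_kernel b n (Complex (3/2) (-t))"
    unfolding kernel_trunc_def moment_kernel_def using Re assms
    by (intro tendsto_intros zeta_sum_limit) auto
qed

text \<open>The bound for the truncated kernels is free of K, so it survives the limit.\<close>

lemma line_integral_asymp:
  fixes t :: "nat \<Rightarrow> real"
  assumes "b \<ge> 1" "X \<ge> 1" "\<And>n. n \<in> {1..nat \<lfloor>X\<rfloor>} \<Longrightarrow> t n \<le> T"
  shows "norm ((\<Sum>n=1..nat \<lfloor>X\<rfloor>. integral {t n..T} (\<lambda>u. moment_kernel b n (Complex (3/2) (-u))))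
             - (\<Sum>n=1..nat \<lfloor>X\<rfloor>. of_real (T - t n) * divisor_coeff b n))
         \<le> 2 * (2 powr (3/2) * 2)^2 * (X powr (3/2) * (3 + 2 * ln X))"
proof (rule Lim_norm_ubound[OF sequentially_bot])
  show "(\<lambda>K. (\<Sum>n=1..nat \<lfloor>X\<rfloor>. integral {t n..T} (\<lambda>u. kernel_trunc b K n (Complex (3/2) (-u))))
             - (\<Sum>n=1..nat \<lfloor>X\<rfloor>. of_real (T - t n) * divisor_coeff b n)) \<longlonglongrightarrow>
      (\<Sum>n=1..nat \<lfloor>X\<rfloor>. integral {t n..T} (\<lambda>u. moment_kernel b n (Complex (3/2) (-u))))
             - (\<Sum>n=1..nat \<lfloor>X\<rfloor>. of_real (T - t n) * divisor_coeff b n)"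
    using assms(1) by (intro tendsto_intros kernel_trunc_integral_limit) auto
  show "\<forall>\<^sub>F K in sequentially. norm ((\<Sum>n=1..nat \<lfloor>X\<rfloor>. integral {t n..T} (\<lambda>u. kernel_trunc b K n (Complex (3/2) (-u))))
             - (\<Sum>n=1..nat \<lfloor>X\<rfloor>. of_real (T - t n) * divisor_coeff b n))
         \<le> 2 * (2 powr (3/2) * 2)^2 * (X powr (3/2) * (3 + 2 * ln X))"
    using eventually_ge_at_top[of "nat \<lfloor>X\<rfloor>"] by eventually_elim (rule trunc_line_integral[OF assms])
qed

text \<open>The n-th term enters the sum at u = t n, so the integral of a sum of variable length is
  a sum of integrals over [t n, T]. The functions are left general because the lemma is applied both
  to the moment and, with constant functions, to the divisor sum.\<close>

lemma has_integral_variable_length_sum: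
  fixes f :: "nat \<Rightarrow> real \<Rightarrow> complex"
  assumes "\<theta> > 0" "T \<ge> 0"
  defines "t \<equiv> (\<lambda>n::nat. 2 * pi * real n powr (1 / \<theta>))" and "M \<equiv> nat \<lfloor>(T / (2 * pi)) powr \<theta>\<rfloor>"
  assumes f: "\<And>n. 1 \<le> n \<Longrightarrow> continuous_on {t n..T} (f n)"
  shows "((\<lambda>u. \<Sum>n\<in>{n. 1 \<le> n \<and> real n \<le> (u / (2 * pi)) powr \<theta>}. f n u) has_integral
      (\<Sum>n=1..M. integral {t n..T} (f n))) {0..T}"
    and "\<And>n. n \<in> {1..M} \<Longrightarrow> t n \<le> T"
proof -
  have cond: "real n \<le> (u / (2 * pi)) powr \<theta> \<longleftrightarrow> t n \<le> u" if "n \<ge> 1" "u \<ge> 0" for n u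
  proof -
    have n: "real n = (real n powr (1 / \<theta>)) powr \<theta>" using that assms(1) by (simp add: powr_powr)
    have "real n \<le> (u / (2 * pi)) powr \<theta> \<longleftrightarrow> real n powr (1 / \<theta>) \<le> u / (2 * pi)"
    proof
      assume le: "real n \<le> (u / (2 * pi)) powr \<theta>"
      show "real n powr (1 / \<theta>) \<le> u / (2 * pi)"
      proof (rule ccontr)
        assume "\<not> ?thesis"
        hence "(u / (2 * pi)) powr \<theta> < (real n powr (1 / \<theta>)) powr \<theta>"
          using that assms(1) by (intro powr_less_mono2) auto
        thus False using le n by simp
      qed
    next
      assume "real n powr (1 / \<theta>) \<le> u / (2 * pi)"
      hence "(real n powr (1 / \<theta>)) powr \<theta> \<le> (u / (2 * pi)) powr \<theta>"
        using assms(1) by (intro powr_mono2) auto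
      thus "real n \<le> (u / (2 * pi)) powr \<theta>" using n by simp
    qed
    also have "\<dots> \<longleftrightarrow> t n \<le> u" by (simp add: t_def field_simps)
    finally show ?thesis .
  qed
  have M: "n \<in> {1..M} \<longleftrightarrow> 1 \<le> n \<and> t n \<le> T" for n
    unfolding M_def nat_floor_eq_atLeastAtMost using cond[of n T] assms(2) by auto
  thus tT: "t n \<le> T" if "n \<in> {1..M}" for n using that by blast
  have t0: "t n \<ge> 0" for n by (simp add: t_def)
  have "((\<lambda>u. \<Sum>n=1..M. if u \<in> {t n..T} then f n u else 0) has_integral (\<Sum>n=1..M. integral {t n..T} (f n))) {0..T}"
  proof (intro has_integral_sum)
    fix n assume "n \<in> {1..M}"
    hence "(f n has_integral integral {t n..T} (f n)) {t n..T}"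
      using f by (intro integrable_integral integrable_continuous_real) auto
    thus "((\<lambda>u. if u \<in> {t n..T} then f n u else 0) has_integral integral {t n..T} (f n)) {0..T}"
      using t0[of n] by (subst has_integral_restrict) auto
  qed auto
  thus "((\<lambda>u. \<Sum>n\<in>{n. 1 \<le> n \<and> real n \<le> (u / (2 * pi)) powr \<theta>}. f n u) has_integral
      (\<Sum>n=1..M. integral {t n..T} (f n))) {0..T}"
  proof (rule has_integral_eq[rotated])
    fix u assume u: "u \<in> {0..T}"
    have "{n. 1 \<le> n \<and> real n \<le> (u / (2 * pi)) powr \<theta>} = {n\<in>{1..M}. t n \<le> u}"
    proof (intro set_eqI iffI)
      fix n assume "n \<in> {n. 1 \<le> n \<and> real n \<le> (u / (2 * pi)) powr \<theta>}"
      hence n: "1 \<le> n" "t n \<le> u" using cond[of n u] u by auto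
      hence "t n \<le> T" using u by auto
      thus "n \<in> {n\<in>{1..M}. t n \<le> u}" using n M[of n] by auto
    next
      fix n assume "n \<in> {n\<in>{1..M}. t n \<le> u}"
      thus "n \<in> {n. 1 \<le> n \<and> real n \<le> (u / (2 * pi)) powr \<theta>}" using cond[of n u] u by auto
    qed
    hence "(\<Sum>n\<in>{n. 1 \<le> n \<and> real n \<le> (u / (2 * pi)) powr \<theta>}. f n u) = (\<Sum>n=1..M. if t n \<le> u then f n u else 0)"
      by (simp only:) (rule sum.inter_filter, auto)
    also have "\<dots> = (\<Sum>n=1..M. if u \<in> {t n..T} then f n u else 0)"
      using u by (intro sum.cong refl) auto
    finally show "(\<Sum>n=1..M. if u \<in> {t n..T} then f n u else 0)
        = (\<Sum>n\<in>{n. 1 \<le> n \<and> real n \<le> (u / (2 * pi)) powr \<theta>}. f n u)" by simp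
  qed
qed

section \<open>The moment\<close>

lemma sum_inverse_sqrt_le: "(\<Sum>n=1..M. 1 / sqrt (real n)) \<le> 2 * sqrt (real M)"
proof (induction M)
  case (Suc M)
  define p q where "p = sqrt (real M)" and "q = sqrt (real (Suc M))"
  have q: "q > 0" "p \<le> q" "p \<ge> 0" by (auto simp: p_def q_def)
  have "q * q - p * p = 1" by (simp add: p_def q_def)
  hence "1 = (q - p) * (q + p)" by (simp add: algebra_simps)
  also have "\<dots> \<le> (q - p) * (2 * q)" using q by (intro mult_left_mono) auto
  finally have "1 / q \<le> 2 * q - 2 * p" using q by (simp add: field_simps)
  moreover have "(\<Sum>n=1..Suc M. 1 / sqrt (real n)) = (\<Sum>n=1..M. 1 / sqrt (real n)) + 1 / q" by (simp add: q_def)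
  ultimately show ?case using Suc by (simp only: p_def[symmetric] q_def[symmetric])
qed simp

lemma moment_kernel_half_line:
  "of_nat n powr (- (complex_of_real (1/2) + \<i> * complex_of_real u)) * rzeta (1/2 - \<i> * of_real (real b * u)) * rzeta (1/2 - \<i> * of_real u)
     = moment_kernel b n (Complex (1/2) (-u))"
proof -
  have 1: "1/2 - \<i> * of_real u = Complex (1/2) (-u)" by (simp add: complex_eq_iff)
  have 2: "1/2 - \<i> * of_real (real b * u) = of_nat b * Complex (1/2) (-u) + of_real ((1 - real b) / 2)"
    by (simp add: complex_eq_iff field_simps)
  have 3: "- (complex_of_real (1/2) + \<i> * complex_of_real u) = Complex (1/2) (-u) - 1" by (simp add: complex_eq_iff)
  have "rzeta (1/2 - \<i> * of_real (real b * u)) = zeta (1/2 - \<i> * of_real (real b * u))"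
    "rzeta (1/2 - \<i> * of_real u) = zeta (1/2 - \<i> * of_real u)"
    by (intro rzeta_eq_zeta'; simp)+
  thus ?thesis unfolding moment_kernel_def 2 1 3 by simp
qed

lemma moment_kernel_half_line_continuous:
  assumes "b \<ge> 1" "n \<ge> 1" "t0 > 0"
  shows "continuous_on {t0..T} (\<lambda>u. moment_kernel b n (Complex (1/2) (-u)))"
proof (rule continuous_on_compose2[OF holomorphic_on_imp_continuous_on[OF moment_kernel_holomorphic[OF assms(1,2)]]])
  have eq: "(\<lambda>u. Complex (1/2) (-u)) = (\<lambda>u. of_real (1/2) - \<i> * of_real u)" by (auto simp: complex_eq_iff)
  show "continuous_on {t0..T} (\<lambda>u. Complex (1/2) (-u))" unfolding eq by (intro continuous_intros)
  have "(real b - 1) / (2 * real b) < 1/2" using assms by (simp add: field_simps)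
  thus "(\<lambda>u. Complex (1/2) (-u)) ` {t0..T} \<subseteq> {s. (real b - 1) / (2 * real b) < Re s \<and> Im s < 0}"
    using assms by auto
qed

lemma moment_eq_divisor_integral:
  fixes \<theta> :: real and b :: nat
  assumes "b \<ge> 1" "0 < \<theta>" "\<theta> \<le> 1/2"
  shows "\<exists>C\<ge>0. \<forall>T\<ge>2 * pi. norm (M1b1 \<theta> b T - integral {0..T} (\<lambda>u. weighted_divisor_sum b ((u / (2 * pi)) powr \<theta>)))
           \<le> C * (T powr (1 - \<theta> / 2) * (ln T)^2)"
proof -
  obtain C where C: "C \<ge> 0" "\<And>n t0 T. 1 \<le> n \<Longrightarrow> 2 * pi \<le> t0 \<Longrightarrow> t0 \<le> T \<Longrightarrow> real n \<le> t0 \<Longrightarrow>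
     norm (integral {t0..T} (\<lambda>t. moment_kernel b n (Complex (1/2) (-t))) - integral {t0..T} (\<lambda>t. moment_kernel b n (Complex (3/2) (-t))))
      \<le> C * (sqrt (T / real n) + sqrt (real n)) * (ln T)^2"
    using moment_kernel_shift[OF assms(1)] by blast
  define c :: real where "c = 2 * (2 powr (3/2) * 2)^2"
  have c: "c \<ge> 0" by (simp add: c_def)
  \<comment> \<open>3C collects 2R from the sum of sqrt (T/n) and R from the sum of sqrt n; 5c comes
    from 3 + 2 ln X \<le> 5 (ln T)^2.\<close>
  have "norm (M1b1 \<theta> b T - integral {0..T} (\<lambda>u. weighted_divisor_sum b ((u / (2 * pi)) powr \<theta>)))
           \<le> (3 * C + 5 * c) * (T powr (1 - \<theta> / 2) * (ln T)^2)" if T: "T \<ge> 2 * pi" for T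
  proof -
    define X where "X = (T / (2 * pi)) powr \<theta>"
    define t where "t = (\<lambda>n::nat. 2 * pi * real n powr (1 / \<theta>))"
    define M where "M = nat \<lfloor>X\<rfloor>"
    define R where "R = T powr (1 - \<theta> / 2)"
    note T' = one_le_ln[OF T]
    have T0: "T \<ge> 0" using T' by simp
    have X1: "X \<ge> 1" unfolding X_def using T assms by (intro ge_one_powr_ge_zero) auto
    have MX: "real M \<le> X" using X1 by (simp add: M_def)
    have t_ge: "real n \<le> t n" "2 * pi \<le> t n" if "n \<ge> 1" for n
    proof -
      have "real n powr 1 \<le> real n powr (1 / \<theta>)" using that assms by (intro powr_mono) auto
      hence le: "real n \<le> real n powr (1 / \<theta>)" using that by simp
      have "1 * real n powr (1 / \<theta>) \<le> t n" unfolding t_def using pi_gt3 by (intro mult_right_mono) auto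
      thus "real n \<le> t n" using le by linarith
      have "2 * pi * 1 \<le> t n" unfolding t_def using le that by (intro mult_left_mono) auto
      thus "2 * pi \<le> t n" by simp
    qed
    have t_pos: "t n > 0" if "n \<ge> 1" for n using t_ge(2)[OF that] pi_gt3 by linarith
    have tT: "t n \<le> T" if "n \<in> {1..M}" for n
      using has_integral_variable_length_sum(2)[OF assms(2) T0, of "\<lambda>_ _. 0"] that
      by (auto simp: t_def M_def X_def)
    have "M1b1 \<theta> b T = integral {0..T} (\<lambda>u. \<Sum>n\<in>{n. 1 \<le> n \<and> real n \<le> (u / (2 * pi)) powr \<theta>}. moment_kernel b n (Complex (1/2) (-u)))"
      unfolding M1b1_def Dtheta_def sum_distrib_right moment_kernel_half_line ..
    also have "\<dots> = (\<Sum>n=1..M. integral {t n..T} (\<lambda>u. moment_kernel b n (Complex (1/2) (-u))))"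
      unfolding t_def M_def X_def
      by (intro integral_unique has_integral_variable_length_sum(1) assms(2) T0 moment_kernel_half_line_continuous assms(1))
         (use t_pos in \<open>auto simp: t_def\<close>)
    finally have M1: "M1b1 \<theta> b T = (\<Sum>n=1..M. integral {t n..T} (\<lambda>u. moment_kernel b n (Complex (1/2) (-u))))" .
    have "integral {0..T} (\<lambda>u. weighted_divisor_sum b ((u / (2 * pi)) powr \<theta>))
       = integral {0..T} (\<lambda>u. \<Sum>n\<in>{n. 1 \<le> n \<and> real n \<le> (u / (2 * pi)) powr \<theta>}. divisor_coeff b n)"
      unfolding weighted_divisor_sum_eq[OF assms(1)] ..
    also have "\<dots> = (\<Sum>n=1..M. integral {t n..T} (\<lambda>u. divisor_coeff b n))"
      unfolding t_def M_def X_def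
      by (intro integral_unique has_integral_variable_length_sum(1) assms(2) T0 continuous_intros)
    also have "\<dots> = (\<Sum>n=1..M. of_real (T - t n) * divisor_coeff b n)"
      using tT by (intro sum.cong refl) (simp add: scaleR_conv_of_real)
    finally have W: "integral {0..T} (\<lambda>u. weighted_divisor_sum b ((u / (2 * pi)) powr \<theta>)) = (\<Sum>n=1..M. of_real (T - t n) * divisor_coeff b n)" .
    define L where "L = (\<Sum>n=1..M. integral {t n..T} (\<lambda>u. moment_kernel b n (Complex (3/2) (-u))))"
    define D where "D = (\<Sum>n=1..M. of_real (T - t n) * divisor_coeff b n)"
    have XT: "X \<le> T powr \<theta>" unfolding X_def using T' assms pi_gt3 by (intro powr_mono2) (auto simp: field_simps)
    have b1: "sqrt T * sqrt X \<le> R"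
    proof -
      have "sqrt T * sqrt X = T powr (1/2) * X powr (1/2)" using T0 X1 by (simp add: powr_half_sqrt)
      also have "\<dots> \<le> T powr (1/2) * (T powr \<theta>) powr (1/2)" using X1 XT by (intro mult_left_mono powr_mono2) auto
      also have "\<dots> = T powr (1/2 + \<theta> / 2)" by (simp add: powr_powr powr_add)
      \<comment> \<open>Here 1/2 + \<theta>/2 \<le> 1 - \<theta>/2 amounts to \<theta> \<le> 1/2; in
        \<open>b2\<close> the inequality 3\<theta>/2 \<le> 1 - \<theta>/2 amounts to the
        same.\<close>
      also have "\<dots> \<le> R" unfolding R_def using T' assms by (intro powr_mono) auto
      finally show ?thesis .
    qed
    have b2: "X powr (3/2) \<le> R"
    proof -
      have "X powr (3/2) \<le> (T powr \<theta>) powr (3/2)" using X1 XT by (intro powr_mono2) auto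
      also have "\<dots> = T powr (3 * \<theta> / 2)" by (simp add: powr_powr mult.commute)
      also have "\<dots> \<le> R" unfolding R_def using T' assms by (intro powr_mono) auto
      finally show ?thesis .
    qed
    have b3: "X * sqrt X \<le> R"
    proof -
      have "X * sqrt X = X powr 1 * X powr (1/2)" using X1 by (simp add: powr_half_sqrt)
      also have "\<dots> = X powr (3/2)" unfolding powr_add[symmetric] by simp
      finally show ?thesis using b2 by simp
    qed
    have lnX: "ln X \<le> ln T"
    proof -
      have "ln X \<le> ln (T powr \<theta>)" using XT X1 T' by (subst ln_le_cancel_iff) auto
      also have "\<dots> = \<theta> * ln T" by (rule ln_powr)
      also have "\<dots> \<le> 1 * ln T" using assms T' by (intro mult_right_mono) auto
      finally show ?thesis by simp
    qed
    have "norm (M1b1 \<theta> b T - L) \<le> (\<Sum>n=1..M. C * (sqrt (T / real n) + sqrt (real n)) * (ln T)^2)"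
      unfolding M1 L_def sum_subtractf[symmetric]
      by (intro sum_norm_le C(2) t_ge tT) auto
    also have "\<dots> = C * (ln T)^2 * (\<Sum>n=1..M. sqrt (T / real n) + sqrt (real n))"
      unfolding sum_distrib_left by (intro sum.cong refl) (simp only: mult_ac)
    also have "\<dots> \<le> C * (ln T)^2 * (3 * R)"
    proof (intro mult_left_mono)
      have "(\<Sum>n=1..M. sqrt (T / real n)) = sqrt T * (\<Sum>n=1..M. 1 / sqrt (real n))"
        by (simp add: real_sqrt_divide sum_distrib_left)
      also have "\<dots> \<le> sqrt T * (2 * sqrt X)"
        using sum_inverse_sqrt_le[of M] MX T0 by (intro mult_left_mono) (auto intro: order_trans)
      finally have s1: "(\<Sum>n=1..M. sqrt (T / real n)) \<le> 2 * R" using b1 by linarith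
      have "(\<Sum>n=1..M. sqrt (real n)) \<le> (\<Sum>n=1..M. sqrt X)" using MX by (intro sum_mono) auto
      also have "\<dots> = real M * sqrt X" by simp
      also have "\<dots> \<le> X * sqrt X" using MX X1 by (intro mult_right_mono) auto
      finally have "(\<Sum>n=1..M. sqrt (real n)) \<le> R" using b3 by linarith
      with s1 show "(\<Sum>n=1..M. sqrt (T / real n) + sqrt (real n)) \<le> 3 * R" by (simp only: sum.distrib)
    qed (use C in auto)
    finally have n1: "norm (M1b1 \<theta> b T - L) \<le> 3 * C * (R * (ln T)^2)" by (simp only: mult_ac)
    have "norm (L - D) \<le> c * (X powr (3/2) * (3 + 2 * ln X))"
      unfolding L_def D_def M_def c_def using tT X1 assms by (intro line_integral_asymp) (auto simp: M_def)
    also have "\<dots> \<le> c * (R * (5 * (ln T)^2))"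
    proof (intro mult_left_mono mult_mono b2 c)
      have "1 * 1 \<le> (ln T)^2" "1 * ln T \<le> (ln T)^2" using T' unfolding power2_eq_square by (intro mult_mono; simp)+
      thus "3 + 2 * ln X \<le> 5 * (ln T)^2" using lnX by linarith
    qed (use X1 in \<open>auto simp: R_def\<close>)
    finally have n2: "norm (L - D) \<le> 5 * c * (R * (ln T)^2)" by (simp only: mult_ac)
    have "norm (M1b1 \<theta> b T - D) \<le> norm (M1b1 \<theta> b T - L) + norm (L - D)" by norm
    also have "\<dots> \<le> (3 * C + 5 * c) * (R * (ln T)^2)" using n1 n2 by (simp only: distrib_right)
    finally show ?thesis unfolding W D_def R_def .
  qed
  thus ?thesis using C c by (intro exI[of _ "3 * C + 5 * c"]) auto
qed

text \<open>Taking an antiderivative G as input reduces each case of the theorem to differentiating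
  its claimed formula. The error x^(-1/2) at x = (u/(2 pi))^\<theta> is of order u^(-\<theta>/2),
  whose integral is of order T^(1 - \<theta>/2); the constant G (2 pi) is absorbed.\<close>

lemma moment_asymptotics:
  fixes \<theta> :: real and b :: nat and h :: "real \<Rightarrow> complex"
  assumes b: "b \<ge> 1" and \<theta>: "0 < \<theta>" "\<theta> \<le> 1/2"
    and h: "\<exists>C\<ge>0. \<forall>x\<ge>1. norm (weighted_divisor_sum b x - h x) \<le> C * (1 + ln x)^2 * x powr (-1/2)"
    and G: "\<And>u. u \<ge> 2 * pi \<Longrightarrow> (G has_vector_derivative h ((u / (2 * pi)) powr \<theta>)) (at u)"
  shows "(\<lambda>T. M1b1 \<theta> b T - G T) \<in> O[at_top](\<lambda>T. of_real (T powr (1 - \<theta> / 2) * (ln T)^2))"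
proof -
  obtain C1 where C1: "C1 \<ge> 0" "\<And>T. T \<ge> 2 * pi \<Longrightarrow> norm (M1b1 \<theta> b T - integral {0..T} (\<lambda>u. weighted_divisor_sum b ((u / (2 * pi)) powr \<theta>)))
           \<le> C1 * (T powr (1 - \<theta> / 2) * (ln T)^2)"
    using moment_eq_divisor_integral[OF b \<theta>] by blast
  obtain C2 where C2: "C2 \<ge> 0" "\<And>x. x \<ge> 1 \<Longrightarrow> norm (weighted_divisor_sum b x - h x) \<le> C2 * (1 + ln x)^2 * x powr (-1/2)"
    using h by blast
  define W where "W = (\<lambda>u. weighted_divisor_sum b ((u / (2 * pi)) powr \<theta>))"
  define g where "g = (\<lambda>u. h ((u / (2 * pi)) powr \<theta>))"
  \<comment> \<open>The 4 comes from (2 ln T)^2, the power of 2 pi from rewriting x^(-1/2) in terms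
    of u.\<close>
  define K where "K = C2 * 4 * (2 * pi) powr (\<theta> / 2)"
  have K: "K \<ge> 0" using C2 by (simp add: K_def)
  have p: "1 - \<theta> / 2 > 0" using \<theta> by simp
  have Wint: "(W has_integral (\<Sum>n=1..nat \<lfloor>(T / (2 * pi)) powr \<theta>\<rfloor>. integral {2 * pi * real n powr (1 / \<theta>)..T} (\<lambda>u. divisor_coeff b n))) {0..T}" if "T \<ge> 0" for T
    unfolding W_def weighted_divisor_sum_eq[OF b] using that \<theta>
    by (intro has_integral_variable_length_sum(1) continuous_intros) auto
  \<comment> \<open>At T = 2 pi only n = 1 is left, on a one-point interval. The integral may
    therefore start at 2 pi, where x \<ge> 1 and the expansion h is available.\<close>
  have W0: "integral {0..2 * pi} W = 0"
    using integral_unique[OF Wint[of "2 * pi"]] by simp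
  have main: "norm (M1b1 \<theta> b T - G T) \<le> (C1 + K / (1 - \<theta> / 2) + norm (G (2 * pi))) * (T powr (1 - \<theta> / 2) * (ln T)^2)"
    if T: "T \<ge> 2 * pi" for T
  proof -
    define R where "R = T powr (1 - \<theta> / 2)"
    note T' = one_le_ln[OF T]
    have R1: "R \<ge> 1" unfolding R_def using T' p by (intro ge_one_powr_ge_zero) auto
    have pi0: "2 * pi > 0" by simp
    have W_on: "W integrable_on {0..T}" using Wint[of T] T' by (auto simp: integrable_on_def)
    have W_on': "W integrable_on {2 * pi..T}" using W_on by (rule integrable_on_subinterval) auto
    have split: "integral {0..T} W = integral {2 * pi..T} W"
      using Henstock_Kurzweil_Integration.integral_combine[of 0 "2 * pi" T W] W_on T W0 by simp
    have gint: "(g has_integral (G T - G (2 * pi))) {2 * pi..T}"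
      unfolding g_def by (intro fundamental_theorem_of_calculus T has_vector_derivative_at_within[OF G]) auto
    \<comment> \<open>The logarithms are bounded by their size at T, so that only a power of u has
      to be integrated.\<close>
    have powint: "((\<lambda>u. K * (ln T)^2 * u powr (- \<theta> / 2)) has_integral
        (K * (ln T)^2 * (T powr (1 - \<theta> / 2) / (1 - \<theta> / 2)) - K * (ln T)^2 * ((2 * pi) powr (1 - \<theta> / 2) / (1 - \<theta> / 2)))) {2 * pi..T}"
    proof (rule fundamental_theorem_of_calculus[OF T])
      fix u assume u: "u \<in> {2 * pi..T}"
      hence u0: "u > 0" using pi0 by (metis atLeastAtMost_iff less_le_trans)
      have "((\<lambda>u. u powr (1 - \<theta> / 2)) has_real_derivative (1 - \<theta> / 2) * u powr (1 - \<theta> / 2 - 1)) (at u within {2 * pi..T})"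
        using u0 by (rule has_real_derivative_powr[THEN has_field_derivative_at_within])
      hence "((\<lambda>u. K * (ln T)^2 * (u powr (1 - \<theta> / 2) / (1 - \<theta> / 2))) has_real_derivative
          K * (ln T)^2 * ((1 - \<theta> / 2) * u powr (1 - \<theta> / 2 - 1) / (1 - \<theta> / 2))) (at u within {2 * pi..T})"
        by (intro DERIV_cmult DERIV_cdivide)
      moreover have "(1 - \<theta> / 2) * u powr (1 - \<theta> / 2 - 1) / (1 - \<theta> / 2) = u powr (- \<theta> / 2)"
        using p by simp
      ultimately show "((\<lambda>u. K * (ln T)^2 * (u powr (1 - \<theta> / 2) / (1 - \<theta> / 2))) has_vector_derivative K * (ln T)^2 * u powr (- \<theta> / 2)) (at u within {2 * pi..T})"
        by (simp only: has_real_derivative_iff_has_vector_derivative)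
    qed
    have "norm (integral {2 * pi..T} (\<lambda>u. W u - g u)) \<le> integral {2 * pi..T} (\<lambda>u. K * (ln T)^2 * u powr (- \<theta> / 2))"
    proof (rule integral_norm_bound_integral)
      show "(\<lambda>u. W u - g u) integrable_on {2 * pi..T}"
        using W_on' gint by (intro integrable_diff) (auto simp: integrable_on_def)
      show "(\<lambda>u. K * (ln T)^2 * u powr (- \<theta> / 2)) integrable_on {2 * pi..T}" using powint by (auto simp: integrable_on_def)
      fix u assume u: "u \<in> {2 * pi..T}"
      hence u0: "u > 0" using pi0 by (metis atLeastAtMost_iff less_le_trans)
      define x where "x = (u / (2 * pi)) powr \<theta>"
      have x1: "x \<ge> 1" unfolding x_def using u \<theta> by (intro ge_one_powr_ge_zero) auto
      have "ln x = \<theta> * ln (u / (2 * pi))" unfolding x_def by (rule ln_powr)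
      also have "\<dots> \<le> 1 * ln (u / (2 * pi))" using u \<theta> by (intro mult_right_mono ln_ge_zero) auto
      also have "\<dots> \<le> ln T"
      proof -
        have "u / (2 * pi) \<le> u / 1" using u0 pi_gt3 by (intro divide_left_mono) auto
        hence "u / (2 * pi) \<le> T" using u by auto
        moreover have "u / (2 * pi) > 0" using u0 by simp
        ultimately show ?thesis using T' by (simp add: ln_le_cancel_iff)
      qed
      finally have lx: "1 + ln x \<le> 2 * ln T" using T' by linarith
      have "norm (W u - g u) \<le> C2 * (1 + ln x)^2 * x powr (-1/2)"
        unfolding W_def g_def x_def[symmetric] by (rule C2(2)[OF x1])
      also have "\<dots> \<le> C2 * (2 * ln T)^2 * x powr (-1/2)"
        using C2 lx x1 by (intro mult_right_mono mult_left_mono power_mono) auto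
      also have "x powr (-1/2) = (2 * pi) powr (\<theta> / 2) * u powr (- \<theta> / 2)"
      proof -
        have "x powr (-1/2) = (u / (2 * pi)) powr (- (\<theta> / 2))" by (simp add: x_def powr_powr)
        also have "\<dots> = u powr (- (\<theta> / 2)) / (2 * pi) powr (- (\<theta> / 2))"
          using u0 by (subst powr_divide) auto
        also have "\<dots> = u powr (- (\<theta> / 2)) * (2 * pi) powr (\<theta> / 2)"
          unfolding powr_minus[of "2 * pi"] by (simp only: divide_inverse inverse_inverse_eq)
        finally show ?thesis by (simp add: mult.commute)
      qed
      also have "C2 * (2 * ln T)^2 * ((2 * pi) powr (\<theta> / 2) * u powr (- \<theta> / 2)) = K * (ln T)^2 * u powr (- \<theta> / 2)"
        by (simp add: K_def power2_eq_square)
      finally show "norm (W u - g u) \<le> K * (ln T)^2 * u powr (- \<theta> / 2)" .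
    qed
    also have "\<dots> \<le> K * (ln T)^2 * (R / (1 - \<theta> / 2))"
    proof -
      have "0 \<le> K * (ln T)^2 * ((2 * pi) powr (1 - \<theta> / 2) / (1 - \<theta> / 2))" using K p by simp
      thus ?thesis unfolding integral_unique[OF powint] R_def by linarith
    qed
    also have "\<dots> = K / (1 - \<theta> / 2) * (R * (ln T)^2)" by simp
    finally have n1: "norm (integral {2 * pi..T} (\<lambda>u. W u - g u)) \<le> K / (1 - \<theta> / 2) * (R * (ln T)^2)" .
    have "integral {2 * pi..T} (\<lambda>u. W u - g u) = integral {0..T} W - (G T - G (2 * pi))"
      using integral_diff[OF W_on', of g] gint split integral_unique[OF gint] by (auto simp: integrable_on_def)
    hence n2: "norm (integral {0..T} W - (G T - G (2 * pi))) \<le> K / (1 - \<theta> / 2) * (R * (ln T)^2)" using n1 by simp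
    have n3: "norm (M1b1 \<theta> b T - integral {0..T} W) \<le> C1 * (R * (ln T)^2)"
      using C1(2)[OF T] by (simp add: W_def R_def)
    have "1 * 1 \<le> R * (ln T)^2" using R1 T' by (intro mult_mono) auto
    hence n4: "norm (G (2 * pi)) * 1 \<le> norm (G (2 * pi)) * (R * (ln T)^2)" by (intro mult_left_mono) auto
    have "norm (M1b1 \<theta> b T - G T) \<le> norm (M1b1 \<theta> b T - integral {0..T} W) + norm (integral {0..T} W - (G T - G (2 * pi))) + norm (G (2 * pi))"
      by norm
    also have "\<dots> \<le> (C1 + K / (1 - \<theta> / 2) + norm (G (2 * pi))) * (R * (ln T)^2)"
      using n2 n3 n4 unfolding distrib_right by linarith
    finally show ?thesis unfolding R_def .
  qed
  show ?thesis
  proof (rule bigoI)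
    show "\<forall>\<^sub>F T in at_top. norm (M1b1 \<theta> b T - G T)
       \<le> (C1 + K / (1 - \<theta> / 2) + norm (G (2 * pi))) * norm (complex_of_real (T powr (1 - \<theta> / 2) * (ln T)^2))"
      using eventually_ge_at_top[of "2 * pi"]
    proof eventually_elim
      case (elim T)
      have "norm (complex_of_real (T powr (1 - \<theta> / 2) * (ln T)^2)) = T powr (1 - \<theta> / 2) * (ln T)^2"
        unfolding norm_of_real by simp
      thus ?case using main[OF elim] by simp
    qed
  qed
qed

lemma ln_scaled_powr:
  fixes \<theta> u :: real
  assumes "u > 0"
  shows "ln ((u / (2 * pi)) powr \<theta>) = \<theta> * (ln u - ln (2 * pi))"
  using assms by (simp add: ln_powr ln_divide_pos)

lemma moment_asymptotics_1:
  fixes \<theta> :: real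
  assumes "0 < \<theta>" "\<theta> \<le> 1/2"
  shows "(\<lambda>T. M1b1 \<theta> 1 T - (of_real (\<theta>^2 / 2 * T * (ln T)^2 + c1 \<theta> * T * ln T) + c0 \<theta> * of_real T))
           \<in> O[at_top](\<lambda>T. of_real (T powr (1 - \<theta> / 2) * (ln T)^2))"
proof (rule moment_asymptotics[OF order_refl assms weighted_divisor_sum_asymp_1])
  fix u :: real assume "u \<ge> 2 * pi"
  hence u: "u > 0" using pi_gt3 by linarith
  define \<Lambda> where "\<Lambda> = ln (2 * pi)"
  define g :: real where "g = euler_mascheroni"
  \<comment> \<open>\<open>r\<close> is \<open>c0\<close> without its \<open>stieltjes1\<close>
    part, after \<open>F01\<close> and \<open>F11\<close> have been evaluated.\<close>
  define r where "r = g^2 - (2 * g * \<theta> - \<theta>^2) - \<theta> * (2 * g - \<theta>) * \<Lambda> + \<theta>^2 / 2 * \<Lambda>^2"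
  have lam: "lam \<theta> + 1 = 2 / \<theta>" by (simp add: lam_def)
  \<comment> \<open>With lam + 1 = 2/\<theta> both constants collapse. They are what integrating the
    squared and the simple logarithm by parts leaves behind.\<close>
  have F1: "F11 \<theta> = \<theta>" and F0: "F01 \<theta> = 2 * g * \<theta> - \<theta>^2"
    using assms by (simp_all add: F11_def F01_def lam g_def power2_eq_square)
  have c1: "c1 \<theta> = \<theta> * (2 * g - \<theta>) - \<theta>^2 * \<Lambda>" by (simp add: c1_def F1 g_def \<Lambda>_def)
  have c0: "c0 \<theta> = of_real r + 2 * stieltjes1"
    by (simp add: c0_def F1 F0 g_def \<Lambda>_def r_def)
  have "((\<lambda>T. \<theta>^2 / 2 * T * (ln T)^2 + c1 \<theta> * T * ln T + r * T) has_real_derivative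
      (\<theta>^2 / 2 * ((ln u)^2 + 2 * ln u) + c1 \<theta> * (ln u + 1) + r)) (at u)"
    using u by (auto intro!: derivative_eq_intros simp: field_simps power2_eq_square)
  also have "\<theta>^2 / 2 * ((ln u)^2 + 2 * ln u) + c1 \<theta> * (ln u + 1) + r
     = (\<theta> * (ln u - \<Lambda>))^2 / 2 + 2 * g * (\<theta> * (ln u - \<Lambda>)) + g^2"
    by (simp add: c1 r_def power2_eq_square field_simps)
  finally have "((\<lambda>T. complex_of_real (\<theta>^2 / 2 * T * (ln T)^2 + c1 \<theta> * T * ln T + r * T)) has_vector_derivative
      of_real ((\<theta> * (ln u - \<Lambda>))^2 / 2 + 2 * g * (\<theta> * (ln u - \<Lambda>)) + g^2)) (at u)"
    by (rule has_vector_derivative_of_real)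
  from has_vector_derivative_add[OF this has_vector_derivative_mult_right[OF has_vector_derivative_of_real[OF DERIV_ident], of "2 * stieltjes1"]]
  have "((\<lambda>T. complex_of_real (\<theta>^2 / 2 * T * (ln T)^2 + c1 \<theta> * T * ln T + r * T) + 2 * stieltjes1 * of_real T) has_vector_derivative
      of_real ((\<theta> * (ln u - \<Lambda>))^2 / 2 + 2 * g * (\<theta> * (ln u - \<Lambda>)) + g^2) + 2 * stieltjes1 * of_real 1) (at u)" .
  also have "(\<lambda>T. complex_of_real (\<theta>^2 / 2 * T * (ln T)^2 + c1 \<theta> * T * ln T + r * T) + 2 * stieltjes1 * of_real T)
     = (\<lambda>T. of_real (\<theta>^2 / 2 * T * (ln T)^2 + c1 \<theta> * T * ln T) + c0 \<theta> * of_real T)"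
    unfolding c0 by (rule ext) (simp add: algebra_simps)
  finally show "((\<lambda>T. of_real (\<theta>^2 / 2 * T * (ln T)^2 + c1 \<theta> * T * ln T) + c0 \<theta> * of_real T) has_vector_derivative
      of_real ((ln ((u / (2 * pi)) powr \<theta>))^2 / 2 + 2 * euler_mascheroni * ln ((u / (2 * pi)) powr \<theta>) + euler_mascheroni^2) + 2 * stieltjes1) (at u)"
    unfolding ln_scaled_powr[OF u] \<Lambda>_def[symmetric] g_def[symmetric] by simp
qed

lemma moment_asymptotics_gt_1:
  fixes \<theta> :: real and b :: nat
  assumes "0 < \<theta>" "\<theta> \<le> 1/2" "b > 1"
  shows "(\<lambda>T. M1b1 \<theta> b T - (of_real T * Kb \<theta> b (ln T)
                 - C1b1 \<theta> b * of_real (T powr (1 - \<theta> * (1/2 - 1 / (2 * real b))))))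
           \<in> O[at_top](\<lambda>T. of_real (T powr (1 - \<theta> / 2) * (ln T)^2))"
proof (rule moment_asymptotics[OF _ assms(1,2) weighted_divisor_sum_asymp[OF assms(3)]])
  show "b \<ge> 1" using assms by simp
  fix u :: real assume "u \<ge> 2 * pi"
  hence u: "u > 0" using pi_gt3 by linarith
  define a where "a = (real b + 1) / 2"
  define \<beta> where "\<beta> = 1/2 - 1 / (2 * real b)"
  define \<Lambda> where "\<Lambda> = ln (2 * pi)"
  define g :: real where "g = euler_mascheroni"
  define z where "z = zeta (of_real a)"
  define z' where "z' = deriv zeta (of_real a)"
  define y where "y = zeta (of_real (1 - \<beta>))"
  define p where "p = 1 - \<theta> * \<beta>"
  \<comment> \<open>The derivative of T ln T contributes an extra \<theta> z, which the summand
    -\<theta> z of \<open>c\<close> removes.\<close>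
  define c where "c = z * of_real g + of_nat b * z' - of_real \<theta> * z - of_real \<theta> * z * of_real \<Lambda>"
  have b: "real b > 1" using assms by simp
  have a1: "a > 1" using b by (simp add: a_def)
  have \<beta>: "0 < \<beta>" "\<beta> < 1/2" using b by (auto simp: \<beta>_def field_simps)
  have rz: "rzeta (of_real ((real b + 1) / 2)) = z" "deriv rzeta (of_real ((real b + 1) / 2)) = z'"
    unfolding z_def z'_def a_def[symmetric] using a1 by (auto intro!: rzeta_eq_zeta' deriv_rzeta_eq)
  have "1 - \<beta> = 1 / (2 * real b) + 1/2" by (simp add: \<beta>_def)
  hence ry: "rzeta (of_real (1 / (2 * real b) + 1/2)) = y"
    unfolding y_def using \<beta> by (subst rzeta_eq_zeta') auto
  have K: "of_real T * Kb \<theta> b (ln T) = (of_real \<theta> * z) * of_real (T * ln T) + c * of_real T" for T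
    unfolding Kb_def Eb_def rz Let_def by (simp add: c_def \<Lambda>_def g_def algebra_simps)
  have p0: "p > 0"
  proof -
    have "\<theta> * \<beta> \<le> 1/2 * (1/2)" using assms \<beta> by (intro mult_mono) auto
    thus ?thesis by (simp add: p_def)
  qed
  define q where "q = 4 * real b / (\<theta> * (real b - 1) * (lam \<theta> * real b + 1)) * (2 * pi) powr (\<theta> * \<beta>)"
  have C: "C1b1 \<theta> b = of_real q * y"
    unfolding C1b1_def ry q_def \<beta>_def by simp
  \<comment> \<open>Integrating u^(-\<theta> \<beta>) divides by p = 1 - \<theta> \<beta>. The
    denominator of \<open>C1b1\<close> encodes this factor through \<theta> (lam b + 1) =
    2bp.\<close>
  have qp: "q * p = (2 * pi) powr (\<theta> * \<beta>) / (a - 1)"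
  proof -
    have e: "\<theta> * (lam \<theta> * real b + 1) = 2 * real b * p"
      using assms(1) b by (simp add: lam_def p_def \<beta>_def field_simps)
    have "4 * real b / (\<theta> * (real b - 1) * (lam \<theta> * real b + 1)) = 4 * real b / ((real b - 1) * (\<theta> * (lam \<theta> * real b + 1)))"
      by (simp only: mult_ac)
    also have "\<dots> = 1 / ((a - 1) * p)"
      unfolding e using b p0 a1 by (simp add: a_def field_simps)
    finally have "4 * real b / (\<theta> * (real b - 1) * (lam \<theta> * real b + 1)) = 1 / ((a - 1) * p)" .
    thus ?thesis unfolding q_def using p0 by simp
  qed
  have d1: "((\<lambda>T. complex_of_real (T * ln T)) has_vector_derivative of_real (ln u + 1)) (at u)"
    by (rule has_vector_derivative_of_real) (use u in \<open>auto intro!: derivative_eq_intros\<close>)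
  have d2: "((\<lambda>T. complex_of_real T) has_vector_derivative of_real 1) (at u)"
    by (rule has_vector_derivative_of_real[OF DERIV_ident])
  have d3: "((\<lambda>T. complex_of_real (T powr p)) has_vector_derivative of_real (p * u powr (p - 1))) (at u)"
    by (rule has_vector_derivative_of_real[OF has_real_derivative_powr[OF u]])
  have D: "((\<lambda>T. (of_real \<theta> * z) * of_real (T * ln T) + c * of_real T
          - (of_real q * y) * of_real (T powr p)) has_vector_derivative
      ((of_real \<theta> * z) * of_real (ln u + 1) + c * of_real 1
          - (of_real q * y) * of_real (p * u powr (p - 1)))) (at u)"
    by (intro has_vector_derivative_diff has_vector_derivative_add has_vector_derivative_mult_right d1 d2 d3)
  have "((u / (2 * pi)) powr \<theta>) powr (- \<beta>) / (a - 1) = q * (p * u powr (p - 1))"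
  proof -
    have "((u / (2 * pi)) powr \<theta>) powr (- \<beta>) = (u / (2 * pi)) powr (- (\<theta> * \<beta>))"
      unfolding powr_powr by (rule arg_cong[of _ _ "(powr) (u / (2 * pi))"]) simp
    also have "\<dots> = u powr (- (\<theta> * \<beta>)) / (2 * pi) powr (- (\<theta> * \<beta>))"
      using u by (subst powr_divide) auto
    also have "\<dots> = u powr (p - 1) * (2 * pi) powr (\<theta> * \<beta>)"
      unfolding powr_minus[of "2 * pi"] by (simp add: divide_inverse p_def)
    finally have "((u / (2 * pi)) powr \<theta>) powr (- \<beta>) / (a - 1) = ((2 * pi) powr (\<theta> * \<beta>) / (a - 1)) * u powr (p - 1)" by simp
    thus ?thesis unfolding qp[symmetric] by (simp only: mult.assoc)
  qed
  hence E: "complex_of_real (((u / (2 * pi)) powr \<theta>) powr (- \<beta>) / (a - 1)) * y = of_real q * y * of_real (p * u powr (p - 1))"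
    by (simp only: of_real_mult mult_ac)
  have "(of_real \<theta> * z) * of_real (ln u + 1) + c * of_real 1
       = z * of_real (ln ((u / (2 * pi)) powr \<theta>) + g) + of_nat b * z'"
    unfolding ln_scaled_powr[OF u] \<Lambda>_def[symmetric] by (simp add: c_def algebra_simps)
  with D E have "((\<lambda>T. (of_real \<theta> * z) * of_real (T * ln T) + c * of_real T
          - (of_real q * y) * of_real (T powr p)) has_vector_derivative
      z * of_real (ln ((u / (2 * pi)) powr \<theta>) + g) + of_nat b * z' - of_real (((u / (2 * pi)) powr \<theta>) powr (- \<beta>) / (a - 1)) * y) (at u)"
    by (simp only:)
  thus "((\<lambda>T. of_real T * Kb \<theta> b (ln T) - C1b1 \<theta> b * of_real (T powr (1 - \<theta> * (1/2 - 1 / (2 * real b))))) has_vector_derivative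
      zeta (of_real ((real b + 1) / 2)) * of_real (ln ((u / (2 * pi)) powr \<theta>) + euler_mascheroni) + of_nat b * deriv zeta (of_real ((real b + 1) / 2))
       - of_real (((u / (2 * pi)) powr \<theta>) powr (- (1/2 - 1 / (2 * real b))) / ((real b + 1) / 2 - 1)) * zeta (of_real (1 - (1/2 - 1 / (2 * real b))))) (at u)"
    unfolding K C p_def z_def z'_def y_def g_def a_def \<beta>_def .
qed

theorem theorem1p4:
  fixes \<theta> :: real and b :: nat
  assumes "0 < \<theta>" and "\<theta> \<le> 1/2"
  shows "(b > 1 \<longrightarrow>
           (\<lambda>T. M1b1 \<theta> b T - (of_real T * Kb \<theta> b (ln T)
                 - C1b1 \<theta> b * of_real (T powr (1 - \<theta> * (1/2 - 1 / (2 * real b))))))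
           \<in> O[at_top](\<lambda>T. of_real (T powr (1 - \<theta> / 2) * (ln T)^2)))
       \<and> (b = 1 \<longrightarrow>
           (\<lambda>T. M1b1 \<theta> 1 T - (of_real (\<theta>^2 / 2 * T * (ln T)^2 + c1 \<theta> * T * ln T)
                 + c0 \<theta> * of_real T))
           \<in> O[at_top](\<lambda>T. of_real (T powr (1 - \<theta> / 2) * (ln T)^2)))"
  using moment_asymptotics_gt_1[OF assms] moment_asymptotics_1[OF assms] by blast

end
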